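(* Let $(\mathbb{B}^2,g)$ be the Euclidean unit ball in $\mathbb{R}^2$ equipped with the metric $g=dr^2\oplus r^2d\theta^2$ and let $\eta:=-y\partial_x+x\partial_y$ be the Killing vector field in $\mathbb{R}^2$. For $t>0$, the spectrum of the magnetic Steklov operator $T^{[1],t\eta}$ on differential $1$-forms on $\mathbb{S}^1$ associated with the magnetic potential $t\eta$ is given by $$t\,\frac{\cosh(t/2)}{\sinh(t/2)},\qquad \frac{(-t)^{k+1}}{k!\left(e^{-t}-\sum_{j=0}^k\frac{(-t)^j}{j!}\right)},\qquad \frac{t^{k+1}}{k!\left(e^{t}-\sum_{j=0}^k\frac{t^j}{j!}\right)},\qquad k\geq 1.$$ In particular, the lowest eigenvalue is $\frac{t^2}{e^t-1-t}$, and it is less than $\sigma_{1,1}(\mathbb{B}^2)=2$.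
   Context: Vector fields are identified with real $1$-forms via the metric. For a real $1$-form $\eta$ (magnetic potential) on a compact Riemannian manifold $M$ with boundary, set $d^\eta:=d+i\eta\wedge$, $\delta^\eta:=\delta-i\eta\lrcorner$ ($\delta$ the formal $L^2$-adjoint of $d$), $\Delta^\eta:=d^\eta\delta^\eta+\delta^\eta d^\eta$, acting on smooth complex forms. Let $\iota:\partial M\to M$ be the inclusion and $\nu$ the inward unit normal along $\partial M$. For every $\psi\in\Omega^k(\partial M,\mathbb{C})$ there is a unique $\hat\psi\in\Omega^k(M,\mathbb{C})$ with $\Delta^\eta\hat\psi=0$ on $M$ and $\iota^*\hat\psi=\psi$, $\nu\lrcorner\hat\psi=0$ on $\partial M$. The magnetic Steklov operator on $k$-forms is $T^{[k],\eta}:\Omega^k(\partial M,\mathbb{C})\to\Omega^k(\partial M,\mathbb{C})$, $T^{[k],\eta}\psi:=-\nu\lrcorner d^\eta\hat\psi$. It has a discrete non-negative spectrum; $\sigma_{1,k}(M)$ denotes the lowest eigenvalue of $T^{[k],0}$. *)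

theory Defs
  imports "HOL-Analysis.Analysis"
begin

text \<open>
  Throughout, \<open>M\<close> is meant to be the closure of a bounded open set with smooth boundary in a
  Euclidean space, with the flat metric (below: the closed unit disk).  Then derivatives within
  \<open>M\<close> are unique, also at boundary points, and every notion below depends only on the values
  of a form at the points of \<open>M\<close>.
\<close>

definition dirderiv ::
    "'a::real_normed_vector set \<Rightarrow> ('a \<Rightarrow> 'b::real_normed_vector) \<Rightarrow> 'a \<Rightarrow> 'a \<Rightarrow> 'b" where
  "dirderiv M f x v = frechet_derivative f (at x within M) v"

fun Ck_on ::
    "nat \<Rightarrow> 'a::real_normed_vector set \<Rightarrow> ('a \<Rightarrow> 'b::real_normed_vector) \<Rightarrow> bool" where
  "Ck_on 0 M f \<longleftrightarrow> continuous_on M f"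
| "Ck_on (Suc k) M f \<longleftrightarrow> f differentiable_on M \<and> (\<forall>v. Ck_on k M (\<lambda>x. dirderiv M f x v))"

text \<open>Smoothness up to the boundary.\<close>

definition smooth_on ::
    "'a::real_normed_vector set \<Rightarrow> ('a \<Rightarrow> 'b::real_normed_vector) \<Rightarrow> bool" where
  "smooth_on M f \<longleftrightarrow> (\<forall>k. Ck_on k M f)"

text \<open>
  Complex differential forms of degree 0, 1, 2 are functions of a point and of 0, 1, 2 tangent
  vectors.
\<close>

definition one_forms :: "'a::euclidean_space set \<Rightarrow> ('a \<Rightarrow> 'a \<Rightarrow> complex) set" where
  "one_forms M = {\<omega>. (\<forall>x\<in>M. linear (\<omega> x)) \<and> (\<forall>v. smooth_on M (\<lambda>x. \<omega> x v))}"

definition ext_d0 ::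
    "'a::euclidean_space set \<Rightarrow> ('a \<Rightarrow> complex) \<Rightarrow> 'a \<Rightarrow> 'a \<Rightarrow> complex" where
  "ext_d0 M f x v = dirderiv M f x v"

definition ext_d1 ::
    "'a::euclidean_space set \<Rightarrow> ('a \<Rightarrow> 'a \<Rightarrow> complex) \<Rightarrow> 'a \<Rightarrow> 'a \<Rightarrow> 'a \<Rightarrow> complex" where
  "ext_d1 M \<omega> x v w = dirderiv M (\<lambda>y. \<omega> y w) x v - dirderiv M (\<lambda>y. \<omega> y v) x w"

text \<open>
  The formal \<open>L\<^sup>2\<close>-adjoints of \<open>ext_d0\<close> and \<open>ext_d1\<close> for the flat metric:
  \<open>\<delta> = - (\<Sum>b. b \<lrcorner> \<nabla>\<^sub>b)\<close> over an orthonormal basis.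
\<close>

definition codiff1 ::
    "'a::euclidean_space set \<Rightarrow> ('a \<Rightarrow> 'a \<Rightarrow> complex) \<Rightarrow> 'a \<Rightarrow> complex" where
  "codiff1 M \<omega> x = - (\<Sum>b\<in>Basis. dirderiv M (\<lambda>y. \<omega> y b) x b)"

definition codiff2 ::
    "'a::euclidean_space set \<Rightarrow> ('a \<Rightarrow> 'a \<Rightarrow> 'a \<Rightarrow> complex) \<Rightarrow> 'a \<Rightarrow> 'a \<Rightarrow> complex" where
  "codiff2 M \<Omega> x v = - (\<Sum>b\<in>Basis. dirderiv M (\<lambda>y. \<Omega> y b v) x b)"

text \<open>
  \<open>d\<^sup>\<eta> = d + \<i> \<eta> \<and>\<close> and \<open>\<delta>\<^sup>\<eta> = \<delta> - \<i> \<eta> \<lrcorner>\<close>.  The magnetic potential is a vector field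
  \<open>\<eta>\<close>, identified with the 1-form \<open>v \<mapsto> \<eta> x \<bullet> v\<close>.
\<close>

definition mag_d0 ::
    "'a::euclidean_space set \<Rightarrow> ('a \<Rightarrow> 'a) \<Rightarrow> ('a \<Rightarrow> complex) \<Rightarrow> 'a \<Rightarrow> 'a \<Rightarrow> complex" where
  "mag_d0 M \<eta> f x v = ext_d0 M f x v + \<i> * (of_real (\<eta> x \<bullet> v) * f x)"

definition mag_d1 ::
    "'a::euclidean_space set \<Rightarrow> ('a \<Rightarrow> 'a) \<Rightarrow> ('a \<Rightarrow> 'a \<Rightarrow> complex) \<Rightarrow> 'a \<Rightarrow> 'a \<Rightarrow> 'a \<Rightarrow> complex" where
  "mag_d1 M \<eta> \<omega> x v w =
     ext_d1 M \<omega> x v w + \<i> * (of_real (\<eta> x \<bullet> v) * \<omega> x w - of_real (\<eta> x \<bullet> w) * \<omega> x v)"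

definition mag_codiff1 ::
    "'a::euclidean_space set \<Rightarrow> ('a \<Rightarrow> 'a) \<Rightarrow> ('a \<Rightarrow> 'a \<Rightarrow> complex) \<Rightarrow> 'a \<Rightarrow> complex" where
  "mag_codiff1 M \<eta> \<omega> x = codiff1 M \<omega> x - \<i> * \<omega> x (\<eta> x)"

definition mag_codiff2 ::
    "'a::euclidean_space set \<Rightarrow> ('a \<Rightarrow> 'a) \<Rightarrow> ('a \<Rightarrow> 'a \<Rightarrow> 'a \<Rightarrow> complex) \<Rightarrow> 'a \<Rightarrow> 'a \<Rightarrow> complex" where
  "mag_codiff2 M \<eta> \<Omega> x v = codiff2 M \<Omega> x v - \<i> * \<Omega> x (\<eta> x) v"

definition mag_laplace1 ::
    "'a::euclidean_space set \<Rightarrow> ('a \<Rightarrow> 'a) \<Rightarrow> ('a \<Rightarrow> 'a \<Rightarrow> complex) \<Rightarrow> 'a \<Rightarrow> 'a \<Rightarrow> complex" where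
  "mag_laplace1 M \<eta> \<omega> x v =
     mag_d0 M \<eta> (mag_codiff1 M \<eta> \<omega>) x v + mag_codiff2 M \<eta> (mag_d1 M \<eta> \<omega>) x v"

abbreviation unit_disk :: "(real^2) set" where
  "unit_disk \<equiv> cball 0 1"

abbreviation unit_circle :: "(real^2) set" where
  "unit_circle \<equiv> sphere 0 1"

definition inward_normal :: "real^2 \<Rightarrow> real^2" where
  "inward_normal x = - x"

text \<open>
  A 1-form on the unit circle is stored as a function that vanishes unless it is applied to a
  point \<open>x\<close> of the circle and a vector \<open>v\<close> tangent at \<open>x\<close> (that is, \<open>v \<bullet> x = 0\<close>).  Hence
  equality of such forms is equality of functions.
\<close>

definition circle_pullback :: "(real^2 \<Rightarrow> real^2 \<Rightarrow> complex) \<Rightarrow> real^2 \<Rightarrow> real^2 \<Rightarrow> complex" where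
  "circle_pullback \<omega> x v = (if x \<in> unit_circle \<and> v \<bullet> x = 0 then \<omega> x v else 0)"

definition circle_one_forms :: "(real^2 \<Rightarrow> real^2 \<Rightarrow> complex) set" where
  "circle_one_forms = {\<psi>.
     (\<forall>x v. \<not> (x \<in> unit_circle \<and> v \<bullet> x = 0) \<longrightarrow> \<psi> x v = 0) \<and>
     (\<forall>x\<in>unit_circle. \<forall>u v a b. u \<bullet> x = 0 \<longrightarrow> v \<bullet> x = 0 \<longrightarrow>
        \<psi> x (a *\<^sub>R u + b *\<^sub>R v) = a *\<^sub>R \<psi> x u + b *\<^sub>R \<psi> x v) \<and>
     smooth_on UNIV (\<lambda>\<theta>::real. \<psi> (vector [cos \<theta>, sin \<theta>]) (vector [- sin \<theta>, cos \<theta>]))}"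

definition is_harmonic_extension ::
    "(real^2 \<Rightarrow> real^2) \<Rightarrow> (real^2 \<Rightarrow> real^2 \<Rightarrow> complex) \<Rightarrow> (real^2 \<Rightarrow> real^2 \<Rightarrow> complex) \<Rightarrow> bool" where
  "is_harmonic_extension \<eta> \<psi> \<omega> \<longleftrightarrow>
     \<omega> \<in> one_forms unit_disk \<and>
     (\<forall>x\<in>unit_disk. \<forall>v. mag_laplace1 unit_disk \<eta> \<omega> x v = 0) \<and>
     circle_pullback \<omega> = \<psi> \<and>
     (\<forall>x\<in>unit_circle. \<omega> x (inward_normal x) = 0)"

text \<open>
  For smooth \<open>\<psi>\<close> the extension exists and is unique as a form on the disk; the choice below concerns only the irrelevant
  values outside the disk.
\<close>

definition harmonic_extension ::
    "(real^2 \<Rightarrow> real^2) \<Rightarrow> (real^2 \<Rightarrow> real^2 \<Rightarrow> complex) \<Rightarrow> real^2 \<Rightarrow> real^2 \<Rightarrow> complex" where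
  "harmonic_extension \<eta> \<psi> = (SOME \<omega>. is_harmonic_extension \<eta> \<psi> \<omega>)"

text \<open>\<open>T \<psi> = - \<nu> \<lrcorner> d\<^sup>\<eta> \<omega>\<close> for the harmonic extension \<open>\<omega>\<close> of \<open>\<psi>\<close>.\<close>

definition magnetic_steklov1 ::
    "(real^2 \<Rightarrow> real^2) \<Rightarrow> (real^2 \<Rightarrow> real^2 \<Rightarrow> complex) \<Rightarrow> real^2 \<Rightarrow> real^2 \<Rightarrow> complex" where
  "magnetic_steklov1 \<eta> \<psi> =
     circle_pullback
       (\<lambda>x v. - mag_d1 unit_disk \<eta> (harmonic_extension \<eta> \<psi>) x (inward_normal x) v)"

definition steklov_spectrum1 :: "(real^2 \<Rightarrow> real^2) \<Rightarrow> complex set" where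
  "steklov_spectrum1 \<eta> =
     {z. \<exists>\<psi>\<in>circle_one_forms.
        \<psi> \<noteq> (\<lambda>x v. 0) \<and> magnetic_steklov1 \<eta> \<psi> = (\<lambda>x v. z * \<psi> x v)}"

definition is_lowest_eigenvalue1 :: "(real^2 \<Rightarrow> real^2) \<Rightarrow> real \<Rightarrow> bool" where
  "is_lowest_eigenvalue1 \<eta> s \<longleftrightarrow>
     of_real s \<in> steklov_spectrum1 \<eta> \<and> (\<forall>z\<in>steklov_spectrum1 \<eta>. z \<in> \<real> \<and> s \<le> Re z)"

definition rotation_field :: "real^2 \<Rightarrow> real^2" where
  "rotation_field x = vector [- (x $ 2), x $ 1]"

end

theory Submission
  imports Defs
begin

text \<open>
  Write \<open>z = x + \<i> y\<close>, \<open>D = \<partial>\<^sub>x + \<i> \<partial>\<^sub>y - t z\<close> and \<open>D' = \<partial>\<^sub>x - \<i> \<partial>\<^sub>y + t z'\<close> with \<open>z'\<close> the conjugate of \<open>z\<close>.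
  The components \<open>\<omega>\<^sub>1 \<plusminus> \<i> \<omega>\<^sub>2\<close> of a 1-form decouple the equation \<open>\<Delta>\<^sup>\<eta> \<omega> = 0\<close> into
  \<open>D D' (\<omega>\<^sub>1 + \<i> \<omega>\<^sub>2) = 0\<close> and \<open>D' D (\<omega>\<^sub>1 - \<i> \<omega>\<^sub>2) = 0\<close>, and complex conjugation together with
  \<open>t \<mapsto> - t\<close> turns the second equation into the first.  Since \<open>D\<close> and \<open>D'\<close> are conjugate, by
  Gaussians, to multiples of the Wirtinger derivatives, the first equation has the solutions
  \<open>exp (- t s / 2) z\<^sup>m\<^sup>+\<^sup>1 \<phi>\<^sub>m(s)\<close> and \<open>exp (- t s / 2) z'\<^sup>m\<close>, where \<open>s = z z'\<close> and
  \<open>\<phi>\<^sub>m(s) = \<integral>\<^sub>0\<^sup>1 u\<^sup>m exp (t s u) du\<close>.  Superposing them solves the Dirichlet problem for smooth data.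
  Conversely, the Fourier coefficients of an arbitrary solution along circles satisfy a linear
  differential equation in the radius, whose only solution regular at the origin determines the
  Steklov operator: it multiplies the \<open>l\<close>-th coefficient by \<open>exp t / \<phi>\<^sub>l(1)\<close> for \<open>l > 0\<close>, by the same expression
  with \<open>- t\<close> and \<open>- l\<close> for \<open>l < 0\<close>, and by the sum of the two for \<open>l = 0\<close>.
\<close>

section \<open>Smooth functions on convex bodies\<close>

text \<open>Where the integral \<open>\<phi>_m\<close> comes from: after conjugation with the
  Gaussian, \<open>D D' p = 0\<close> says that the z-derivative of \<open>exp (t s / 2) p\<close>
  is \<open>exp (t s) h\<close> with h holomorphic. For \<open>h = z^m\<close>, integration in z
  from 0 with z' held fixed gives \<open>z^(m+1) \<phi>_m(s)\<close>; antiholomorphic functions are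
  the constants of integration. Two choices in the definitions shape the proof. The Frechet
  derivative within the closed disk is a choice, so derivatives must be known to be unique at
  boundary points too. The harmonic extension is a choice as well. A form that witnesses an
  eigenvalue is an arbitrary smooth form, so an extension has to be produced for all smooth data, by
  series that can be differentiated term by term up to the boundary. Conversely, the extension that
  is picked is known only through its smoothness, its equation and its boundary values, so the
  Steklov operator must be read off from these alone; this is what the Fourier coefficients along
  circles do.\<close>

definition convex_body :: "'a::real_normed_vector set \<Rightarrow> bool" where
  "convex_body M \<longleftrightarrow> convex M \<and> interior M \<noteq> {}"

lemma convex_body_UNIV [simp]: "convex_body UNIV"
  by (simp add: convex_body_def)

lemma convex_body_cball [simp]:
  fixes a :: "'a::euclidean_space"
  shows "e > 0 \<Longrightarrow> convex_body (cball a e)"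
  by (simp add: convex_body_def)

text \<open>On the segment from x to a point y of M, both derivatives give the one-sided derivative
  at 0 of the same curve, so they agree on \<open>y - x\<close>. Nonempty interior makes these
  differences span the space, even if x is a boundary point.\<close>

lemma has_derivative_unique_convex_body:
  fixes f :: "'a::real_normed_vector \<Rightarrow> 'b::real_normed_vector"
  assumes "convex_body M" "x \<in> M"
    and f': "(f has_derivative f') (at x within M)"
    and g': "(f has_derivative g') (at x within M)"
  shows "f' = g'"
proof
  fix v :: 'a
  have "convex M" using assms(1) by (simp add: convex_body_def)
  have dir: "f' (y - x) = g' (y - x)" if "y \<in> M" for y
  proof -
    have sub: "(\<lambda>s::real. x + s *\<^sub>R (y - x)) ` {0..1} \<subseteq> M"
    proof safe
      fix s :: real assume "s \<in> {0..1}"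
      then have "(1 - s) *\<^sub>R x + s *\<^sub>R y \<in> M"
        using \<open>convex M\<close> \<open>x \<in> M\<close> \<open>y \<in> M\<close> by (intro convexD) auto
      then show "x + s *\<^sub>R (y - x) \<in> M" by (simp add: algebra_simps)
    qed
    have seg: "((\<lambda>s::real. x + s *\<^sub>R (y - x)) has_derivative (\<lambda>s. s *\<^sub>R (y - x))) (at 0 within {0..1})"
      by (auto intro!: derivative_eq_intros)
    have "((\<lambda>s::real. f (x + s *\<^sub>R (y - x))) has_vector_derivative h (y - x)) (at 0 within {0..1})"
      if h: "(f has_derivative h) (at x within M)" for h
    proof -
      have "(f \<circ> (\<lambda>s::real. x + s *\<^sub>R (y - x)) has_derivative h \<circ> (\<lambda>s. s *\<^sub>R (y - x))) (at 0 within {0..1})"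
        by (rule diff_chain_within[OF seg]) (use has_derivative_subset[OF h sub] in simp)
      then show ?thesis
        using has_derivative_linear[OF h]
        by (simp add: has_vector_derivative_def o_def linear_cmul)
    qed
    then show ?thesis
      using vector_derivative_unique_within[of 0 "{0..1::real}"] f' g'
      by (metis at_within_Icc_at_right trivial_limit_at_right_real zero_less_one)
  qed
  \<comment> \<open>A small multiple of v is the difference of two points of an interior ball, and
    both maps are known to agree on the vectors from x to each of them.\<close>
  obtain a e where a: "e > 0" "ball a e \<subseteq> M"
    using assms(1) by (metis convex_body_def ex_in_conv mem_interior)
  define c where "c = e / (2 * (norm v + 1))"
  have np: "norm v + 1 > 0" by (simp add: add_nonneg_pos)
  have "c > 0" using a(1) np by (simp add: c_def)
  have "c * norm v < e"
  proof -
    have "c * norm v \<le> c * (norm v + 1)" using \<open>c > 0\<close> by simp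
    also have "\<dots> = e / 2" using np by (simp add: c_def field_simps)
    finally show ?thesis using a(1) by linarith
  qed
  then have "a + c *\<^sub>R v \<in> M" using a \<open>c > 0\<close> by (intro subsetD[OF a(2)]) (simp add: dist_norm)
  moreover have "a \<in> M" using a by (intro subsetD[OF a(2)]) simp
  ultimately have "f' (a + c *\<^sub>R v - x) - f' (a - x) = g' (a + c *\<^sub>R v - x) - g' (a - x)"
    using dir by simp
  then have "f' (c *\<^sub>R v) = g' (c *\<^sub>R v)"
    using has_derivative_linear[OF f'] has_derivative_linear[OF g']
    by (simp flip: linear_diff)
  then show "f' v = g' v"
    using \<open>c > 0\<close> has_derivative_linear[OF f'] has_derivative_linear[OF g'] by (simp add: linear_cmul)
qed

section \<open>Directional derivatives within a set and the classes C^k\<close>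

lemma dirderiv_eqI:
  assumes "convex_body M" "x \<in> M" "(f has_derivative f') (at x within M)"
  shows "dirderiv M f x v = f' v"
proof -
  have "(f has_derivative frechet_derivative f (at x within M)) (at x within M)"
    using assms(3) by (metis differentiableI frechet_derivative_works)
  then show ?thesis
    using has_derivative_unique_convex_body[OF assms] by (simp add: dirderiv_def)
qed

lemma has_derivative_dirderiv:
  "f differentiable (at x within M) \<Longrightarrow> (f has_derivative dirderiv M f x) (at x within M)"
  by (simp add: dirderiv_def[abs_def] frechet_derivative_works)

text \<open>\<open>frechet_derivative\<close> is a choice, so it is shown that f and g have exactly
  the same derivatives at x. This also covers functions that have none.\<close>

lemma dirderiv_cong:
  assumes "\<And>y. y \<in> M \<Longrightarrow> f y = g y" "x \<in> M"
  shows "dirderiv M f x v = dirderiv M g x v"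
proof -
  have "(f has_derivative h) (at x within M) \<longleftrightarrow> (g has_derivative h) (at x within M)" for h
    using assms has_derivative_transform[of x M f g h] has_derivative_transform[of x M g f h] by auto
  then show ?thesis by (simp add: dirderiv_def frechet_derivative_def)
qed

lemma Ck_on_cong:
  assumes "\<And>y. y \<in> M \<Longrightarrow> f y = g y"
  shows "Ck_on k M f \<longleftrightarrow> Ck_on k M g"
  using assms
proof (induction k arbitrary: f g)
  case 0
  then show ?case by (auto intro: continuous_on_cong)
next
  case (Suc k)
  have "f differentiable_on M \<longleftrightarrow> g differentiable_on M"
    using Suc.prems differentiable_transform_within[of _ _ M 1]
    unfolding differentiable_on_def by (metis zero_less_one)
  moreover have "Ck_on k M (\<lambda>x. dirderiv M f x v) \<longleftrightarrow> Ck_on k M (\<lambda>x. dirderiv M g x v)" for v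
    by (rule Suc.IH) (rule dirderiv_cong, use Suc.prems in auto)
  ultimately show ?case by simp
qed

text \<open>Lets an explicit derivative replace the chosen one; each closure property below is an
  induction on k through this rule.\<close>

lemma Ck_on_Suc_I:
  assumes "convex_body M"
    and "\<And>x. x \<in> M \<Longrightarrow> (f has_derivative f' x) (at x within M)"
    and "\<And>v. Ck_on k M (\<lambda>x. f' x v)"
  shows "Ck_on (Suc k) M f"
proof -
  have "Ck_on k M (\<lambda>x. dirderiv M f x v)" for v
    using assms(3)[of v] by (subst Ck_on_cong) (auto intro: dirderiv_eqI assms(1,2))
  then show ?thesis
    using assms(2) by (auto simp: differentiable_on_def differentiable_def)
qed

lemma Ck_on_Suc_D:
  assumes "Ck_on (Suc k) M f" "x \<in> M"
  shows "(f has_derivative dirderiv M f x) (at x within M)"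
  using assms by (auto simp: differentiable_on_def intro: has_derivative_dirderiv)

lemma Ck_on_SucD: "Ck_on (Suc k) M f \<Longrightarrow> Ck_on k M f"
proof (induction k arbitrary: f)
  case 0
  then show ?case by (simp add: differentiable_imp_continuous_on)
next
  case (Suc k)
  from Suc.prems have "\<And>v. Ck_on (Suc k) M (\<lambda>x. dirderiv M f x v)" by (subst (asm) Ck_on.simps) simp
  then show ?case using Suc.IH Suc.prems by simp
qed

lemma Ck_on_const [simp]: "convex_body M \<Longrightarrow> Ck_on k M (\<lambda>x. c)"
proof (induction k arbitrary: c)
  case (Suc k)
  show ?case by (rule Ck_on_Suc_I[where f' = "\<lambda>_ _. 0"]) (use Suc in auto)
qed simp

lemma Ck_on_bounded_linear:
  assumes "convex_body M" "bounded_linear h"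
  shows "Ck_on k M f \<Longrightarrow> Ck_on k M (\<lambda>x. h (f x))"
proof (induction k arbitrary: f)
  case 0
  then show ?case
    using bounded_linear.continuous_on[OF assms(2)] by simp
next
  case (Suc k)
  show ?case
  proof (rule Ck_on_Suc_I[OF assms(1)])
    show "((\<lambda>x. h (f x)) has_derivative (\<lambda>v. h (dirderiv M f x v))) (at x within M)" if "x \<in> M" for x
      by (rule bounded_linear.has_derivative[OF assms(2) Ck_on_Suc_D[OF Suc.prems that]])
    show "Ck_on k M (\<lambda>x. h (dirderiv M f x v))" for v
      using Suc by simp
  qed
qed

lemma Ck_on_linear_map:
  assumes "convex_body M" "bounded_linear h"
  shows "Ck_on k M h"
proof (cases k)
  case 0
  then show ?thesis using linear_continuous_on[OF assms(2)] by simp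
next
  case (Suc n)
  show ?thesis unfolding Suc
    by (rule Ck_on_Suc_I[where f' = "\<lambda>_. h"])
      (use assms in \<open>auto intro: bounded_linear_imp_has_derivative\<close>)
qed

lemma Ck_on_add:
  assumes "convex_body M"
  shows "Ck_on k M f \<Longrightarrow> Ck_on k M g \<Longrightarrow> Ck_on k M (\<lambda>x. f x + g x)"
proof (induction k arbitrary: f g)
  case 0
  then show ?case by (auto intro: continuous_intros)
next
  case (Suc k)
  show ?case
  proof (rule Ck_on_Suc_I[OF assms(1)])
    show "((\<lambda>x. f x + g x) has_derivative (\<lambda>v. dirderiv M f x v + dirderiv M g x v)) (at x within M)"
      if "x \<in> M" for x
      using Ck_on_Suc_D[OF Suc.prems(1) that] Ck_on_Suc_D[OF Suc.prems(2) that]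
      by (rule has_derivative_add)
    show "Ck_on k M (\<lambda>x. dirderiv M f x v + dirderiv M g x v)" for v
      using Suc by simp
  qed
qed

lemma Ck_on_mult:
  fixes f g :: "'a::real_normed_vector \<Rightarrow> 'b::real_normed_algebra"
  assumes "convex_body M"
  shows "Ck_on k M f \<Longrightarrow> Ck_on k M g \<Longrightarrow> Ck_on k M (\<lambda>x. f x * g x)"
proof (induction k arbitrary: f g)
  case 0
  then show ?case by (auto intro: continuous_intros)
next
  case (Suc k)
  show ?case
  proof (rule Ck_on_Suc_I[OF assms(1)])
    show "((\<lambda>x. f x * g x) has_derivative
        (\<lambda>v. f x * dirderiv M g x v + dirderiv M f x v * g x)) (at x within M)"
      if "x \<in> M" for x
      using Ck_on_Suc_D[OF Suc.prems(1) that] Ck_on_Suc_D[OF Suc.prems(2) that]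
      by (rule has_derivative_mult)
    show "Ck_on k M (\<lambda>x. f x * dirderiv M g x v + dirderiv M f x v * g x)" for v
      using Suc Ck_on_SucD[OF Suc.prems(1)] Ck_on_SucD[OF Suc.prems(2)]
      by (intro Ck_on_add Suc.IH assms) simp_all
  qed
qed

lemma Ck_on_exp:
  fixes f :: "'a::real_normed_vector \<Rightarrow> 'b::{real_normed_field,banach}"
  assumes "convex_body M"
  shows "Ck_on k M f \<Longrightarrow> Ck_on k M (\<lambda>x. exp (f x))"
proof (induction k)
  case 0
  then show ?case by (auto intro: continuous_intros)
next
  case (Suc k)
  show ?case
  proof (rule Ck_on_Suc_I[OF assms(1)])
    show "((\<lambda>x. exp (f x)) has_derivative (\<lambda>v. exp (f x) * dirderiv M f x v)) (at x within M)"
      if "x \<in> M" for x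
      using has_derivative_compose[OF Ck_on_Suc_D[OF Suc.prems that], of exp "\<lambda>v. exp (f x) * v"]
      by (auto simp: has_field_derivative_def[symmetric] intro!: DERIV_exp)
    show "Ck_on k M (\<lambda>x. exp (f x) * dirderiv M f x v)" for v
      using Suc.prems Suc.IH[OF Ck_on_SucD[OF Suc.prems]] by (intro Ck_on_mult assms) simp_all
  qed
qed

section \<open>Closure properties of smooth functions\<close>

lemma smooth_on_has_derivative:
  "smooth_on M f \<Longrightarrow> x \<in> M \<Longrightarrow> (f has_derivative dirderiv M f x) (at x within M)"
  unfolding smooth_on_def using Ck_on_Suc_D by blast

lemma smooth_on_dirderiv: "smooth_on M f \<Longrightarrow> smooth_on M (\<lambda>x. dirderiv M f x v)"
  unfolding smooth_on_def by (metis Ck_on.simps(2))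

lemma smooth_on_imp_continuous_on: "smooth_on M f \<Longrightarrow> continuous_on M f"
  unfolding smooth_on_def by (metis Ck_on.simps(1))

lemma smooth_on_add:
  "convex_body M \<Longrightarrow> smooth_on M f \<Longrightarrow> smooth_on M g \<Longrightarrow> smooth_on M (\<lambda>x. f x + g x)"
  by (simp add: smooth_on_def Ck_on_add)

lemma smooth_on_mult:
  fixes f g :: "'a::real_normed_vector \<Rightarrow> 'b::real_normed_algebra"
  shows "convex_body M \<Longrightarrow> smooth_on M f \<Longrightarrow> smooth_on M g \<Longrightarrow> smooth_on M (\<lambda>x. f x * g x)"
  by (simp add: smooth_on_def Ck_on_mult)

lemma smooth_on_exp:
  fixes f :: "'a::real_normed_vector \<Rightarrow> 'b::{real_normed_field,banach}"
  shows "convex_body M \<Longrightarrow> smooth_on M f \<Longrightarrow> smooth_on M (\<lambda>x. exp (f x))"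
  by (simp add: smooth_on_def Ck_on_exp)

lemma smooth_on_const: "convex_body M \<Longrightarrow> smooth_on M (\<lambda>x. c)"
  by (simp add: smooth_on_def)

lemma smooth_on_bounded_linear:
  "convex_body M \<Longrightarrow> bounded_linear h \<Longrightarrow> smooth_on M f \<Longrightarrow> smooth_on M (\<lambda>x. h (f x))"
  by (simp add: smooth_on_def Ck_on_bounded_linear)

lemma smooth_on_linear_map: "convex_body M \<Longrightarrow> bounded_linear h \<Longrightarrow> smooth_on M h"
  by (simp add: smooth_on_def Ck_on_linear_map)

lemma smooth_on_cmult:
  fixes f :: "'a::real_normed_vector \<Rightarrow> 'b::real_normed_algebra"
  shows "convex_body M \<Longrightarrow> smooth_on M f \<Longrightarrow> smooth_on M (\<lambda>x. c * f x)"
  by (intro smooth_on_mult smooth_on_const)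

lemma smooth_on_diff:
  fixes f g :: "'a::real_normed_vector \<Rightarrow> 'b::real_normed_vector"
  assumes "convex_body M" "smooth_on M f" "smooth_on M g"
  shows "smooth_on M (\<lambda>x. f x - g x)"
  using smooth_on_add[OF assms(1,2) smooth_on_bounded_linear[OF assms(1) _ assms(3), of uminus]]
  by (simp add: bounded_linear_minus bounded_linear_ident)

section \<open>Complex components of 1-forms on the disk\<close>

definition cx :: "real^2 \<Rightarrow> complex" where
  "cx x = Complex (x $ 1) (x $ 2)"

lemma bounded_linear_cx: "bounded_linear cx"
proof -
  have "linear cx" by (rule linearI) (simp_all add: cx_def complex_eq_iff)
  then show ?thesis by (simp add: linear_conv_bounded_linear)
qed

lemma cx_eq: "cx x = of_real (x $ 1) + \<i> * of_real (x $ 2)"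
  by (simp add: cx_def complex_eq_iff)

lemma cnj_cx_eq: "cnj (cx x) = of_real (x $ 1) - \<i> * of_real (x $ 2)"
  by (simp add: cx_def complex_eq_iff)

lemma norm_cx [simp]: "norm (cx x) = norm x"
  by (simp add: cx_def norm_vec_def L2_set_def UNIV_2 cmod_def)

lemma Basis_vec2: "(Basis :: (real^2) set) = {axis 1 1, axis 2 1}"
  by (auto simp: Basis_vec_def UNIV_2)

lemma sum_Basis_vec2:
  fixes f :: "real^2 \<Rightarrow> 'a::comm_monoid_add"
  shows "(\<Sum>b\<in>Basis. f b) = f (axis 1 1) + f (axis 2 1)"
  by (simp add: Basis_vec2 axis_eq_axis)

lemma vec2_decomp: "(v::real^2) = v $ 1 *\<^sub>R axis 1 1 + v $ 2 *\<^sub>R axis 2 1"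
  by (simp add: vec_eq_iff forall_2 axis_def)

lemma linear_vec2:
  fixes h :: "real^2 \<Rightarrow> 'a::real_vector"
  assumes "linear h"
  shows "h v = v $ 1 *\<^sub>R h (axis 1 1) + v $ 2 *\<^sub>R h (axis 2 1)"
  by (metis (no_types, lifting) assms linear_add linear_cmul vec2_decomp)

text \<open>
  \<open>dz\<close> and \<open>dzbar\<close> are twice the Wirtinger derivatives; \<open>mag_dz\<close> and \<open>mag_dzbar\<close> are the operators
  \<open>D'\<close> and \<open>D\<close> above.
\<close>

definition dz :: "(real^2 \<Rightarrow> complex) \<Rightarrow> real^2 \<Rightarrow> complex" where
  "dz f x = dirderiv unit_disk f x (axis 1 1) - \<i> * dirderiv unit_disk f x (axis 2 1)"

definition dzbar :: "(real^2 \<Rightarrow> complex) \<Rightarrow> real^2 \<Rightarrow> complex" where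
  "dzbar f x = dirderiv unit_disk f x (axis 1 1) + \<i> * dirderiv unit_disk f x (axis 2 1)"

definition mag_dz :: "real \<Rightarrow> (real^2 \<Rightarrow> complex) \<Rightarrow> real^2 \<Rightarrow> complex" where
  "mag_dz t f x = dz f x + of_real t * cnj (cx x) * f x"

definition mag_dzbar :: "real \<Rightarrow> (real^2 \<Rightarrow> complex) \<Rightarrow> real^2 \<Rightarrow> complex" where
  "mag_dzbar t f x = dzbar f x - of_real t * cx x * f x"

text \<open>Twice the coefficient of the differential of z' in \<omega>; \<open>comp_minus\<close>
  is likewise twice the coefficient of the differential of z. So \<open>\<omega> x v\<close> is half
  of \<open>comp_plus \<omega> x * cnj (cx v) + comp_minus \<omega> x * cx v\<close>.\<close>

definition comp_plus :: "(real^2 \<Rightarrow> real^2 \<Rightarrow> complex) \<Rightarrow> real^2 \<Rightarrow> complex" where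
  "comp_plus \<omega> x = \<omega> x (axis 1 1) + \<i> * \<omega> x (axis 2 1)"

definition comp_minus :: "(real^2 \<Rightarrow> real^2 \<Rightarrow> complex) \<Rightarrow> real^2 \<Rightarrow> complex" where
  "comp_minus \<omega> x = \<omega> x (axis 1 1) - \<i> * \<omega> x (axis 2 1)"

lemma dirderiv_vec2:
  fixes f :: "real^2 \<Rightarrow> complex"
  assumes "smooth_on M f" "x \<in> M"
  shows "dirderiv M f x v = of_real (v $ 1) * dirderiv M f x (axis 1 1)
                          + of_real (v $ 2) * dirderiv M f x (axis 2 1)"
  using linear_vec2[OF has_derivative_linear[OF smooth_on_has_derivative[OF assms]], of v]
  by (simp add: scaleR_conv_of_real)

lemma dirderiv_lincomb:
  fixes f g :: "'a::real_normed_vector \<Rightarrow> complex"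
  assumes "convex_body M" "smooth_on M f" "smooth_on M g" "x \<in> M"
  shows "dirderiv M (\<lambda>y. a * f y + b * g y) x v = a * dirderiv M f x v + b * dirderiv M g x v"
  by (rule dirderiv_eqI[OF assms(1,4)])
    (auto intro!: derivative_eq_intros smooth_on_has_derivative assms)

text \<open>Equality is asked on M only, because the expansion of a form in basis components is
  available only at points of M, where the form is linear.\<close>

lemma dirderiv_lincomb_cong:
  fixes f g :: "'a::real_normed_vector \<Rightarrow> complex"
  assumes "convex_body M" "smooth_on M f" "smooth_on M g" "x \<in> M"
    and "\<And>y. y \<in> M \<Longrightarrow> h y = a * f y + b * g y"
  shows "dirderiv M h x v = a * dirderiv M f x v + b * dirderiv M g x v"
  using dirderiv_cong[OF assms(5,4)] dirderiv_lincomb[OF assms(1-4)] by simp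

lemma smooth_on_dz: "smooth_on unit_disk f \<Longrightarrow> smooth_on unit_disk (dz f)"
  unfolding dz_def by (intro smooth_on_diff smooth_on_cmult smooth_on_dirderiv) simp_all

lemma smooth_on_dzbar: "smooth_on unit_disk f \<Longrightarrow> smooth_on unit_disk (dzbar f)"
  unfolding dzbar_def by (intro smooth_on_add smooth_on_cmult smooth_on_dirderiv) simp_all

lemma smooth_on_cx: "convex_body M \<Longrightarrow> smooth_on M cx"
  by (simp add: smooth_on_linear_map bounded_linear_cx)

lemma smooth_on_cnj: "convex_body M \<Longrightarrow> smooth_on M f \<Longrightarrow> smooth_on M (\<lambda>x. cnj (f x))"
  by (rule smooth_on_bounded_linear[OF _ bounded_linear_cnj])

lemma smooth_on_mag_dz: "smooth_on unit_disk f \<Longrightarrow> smooth_on unit_disk (mag_dz t f)"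
  unfolding mag_dz_def
  by (intro smooth_on_add smooth_on_mult smooth_on_const smooth_on_cnj smooth_on_cx smooth_on_dz) simp_all

lemma smooth_on_mag_dzbar: "smooth_on unit_disk f \<Longrightarrow> smooth_on unit_disk (mag_dzbar t f)"
  unfolding mag_dzbar_def
  by (intro smooth_on_diff smooth_on_mult smooth_on_const smooth_on_cx smooth_on_dzbar) simp_all

lemma one_forms_linear: "\<omega> \<in> one_forms M \<Longrightarrow> x \<in> M \<Longrightarrow> linear (\<omega> x)"
  and one_forms_smooth: "\<omega> \<in> one_forms M \<Longrightarrow> smooth_on M (\<lambda>x. \<omega> x v)"
  by (auto simp: one_forms_def)

lemma one_form_vec2:
  fixes M :: "(real^2) set"
  assumes "\<omega> \<in> one_forms M" "x \<in> M"
  shows "\<omega> x v = of_real (v $ 1) * \<omega> x (axis 1 1) + of_real (v $ 2) * \<omega> x (axis 2 1)"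
  using linear_vec2[OF one_forms_linear[OF assms], of v] by (simp add: scaleR_conv_of_real)

lemma smooth_on_comp_plus: "\<omega> \<in> one_forms unit_disk \<Longrightarrow> smooth_on unit_disk (comp_plus \<omega>)"
  unfolding comp_plus_def by (intro smooth_on_add smooth_on_cmult one_forms_smooth) simp_all

lemma smooth_on_comp_minus: "\<omega> \<in> one_forms unit_disk \<Longrightarrow> smooth_on unit_disk (comp_minus \<omega>)"
  unfolding comp_minus_def by (intro smooth_on_diff smooth_on_cmult one_forms_smooth) simp_all

section \<open>The magnetic operators of the rotation field in complex components\<close>

abbreviation potential :: "real \<Rightarrow> real^2 \<Rightarrow> real^2" where
  "potential t \<equiv> (\<lambda>x. t *\<^sub>R rotation_field x)"

lemma potential_nth: "potential t x $ 1 = - t * x $ 2" "potential t x $ 2 = t * x $ 1"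
  by (simp_all add: rotation_field_def)

lemma potential_inner: "potential t x \<bullet> v = t * (x $ 1 * v $ 2 - x $ 2 * v $ 1)"
  by (simp add: inner_vec_def UNIV_2 rotation_field_def algebra_simps)

lemma dz_comp:
  assumes "\<omega> \<in> one_forms unit_disk" "x \<in> unit_disk"
  defines "d \<equiv> \<lambda>i j. dirderiv unit_disk (\<lambda>y. \<omega> y (axis i 1)) x (axis j 1)"
  shows "dz (comp_plus \<omega>) x = d 1 1 + \<i> * d 2 1 - \<i> * d 1 2 + d 2 2"
    and "dzbar (comp_minus \<omega>) x = d 1 1 - \<i> * d 2 1 + \<i> * d 1 2 + d 2 2"
proof -
  have s: "smooth_on unit_disk (\<lambda>y. \<omega> y v)" for v by (rule one_forms_smooth[OF assms(1)])
  have p: "dirderiv unit_disk (comp_plus \<omega>) x v = 1 * dirderiv unit_disk (\<lambda>y. \<omega> y (axis 1 1)) x v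
      + \<i> * dirderiv unit_disk (\<lambda>y. \<omega> y (axis 2 1)) x v" for v
    by (rule dirderiv_lincomb_cong[OF _ s s assms(2)]) (simp_all add: comp_plus_def)
  have m: "dirderiv unit_disk (comp_minus \<omega>) x v = 1 * dirderiv unit_disk (\<lambda>y. \<omega> y (axis 1 1)) x v
      + (- \<i>) * dirderiv unit_disk (\<lambda>y. \<omega> y (axis 2 1)) x v" for v
    by (rule dirderiv_lincomb_cong[OF _ s s assms(2)]) (simp_all add: comp_minus_def)
  show "dz (comp_plus \<omega>) x = d 1 1 + \<i> * d 2 1 - \<i> * d 1 2 + d 2 2"
    and "dzbar (comp_minus \<omega>) x = d 1 1 - \<i> * d 2 1 + \<i> * d 1 2 + d 2 2"
    by (simp_all add: dz_def dzbar_def p m d_def algebra_simps)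
qed

lemma mag_dz_comp:
  assumes "\<omega> \<in> one_forms unit_disk" "x \<in> unit_disk"
  defines "d \<equiv> \<lambda>i j. dirderiv unit_disk (\<lambda>y. \<omega> y (axis i 1)) x (axis j 1)"
    and "a \<equiv> \<omega> x (axis 1 1)" and "b \<equiv> \<omega> x (axis 2 1)"
    and "x1 \<equiv> complex_of_real (x $ 1)" and "x2 \<equiv> complex_of_real (x $ 2)"
  shows "mag_dz t (comp_plus \<omega>) x =
      d 1 1 + \<i> * d 2 1 - \<i> * d 1 2 + d 2 2 + of_real t * (x1 - \<i> * x2) * (a + \<i> * b)"
    and "mag_dzbar t (comp_minus \<omega>) x =
      d 1 1 - \<i> * d 2 1 + \<i> * d 1 2 + d 2 2 - of_real t * (x1 + \<i> * x2) * (a - \<i> * b)"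
  unfolding mag_dz_def mag_dzbar_def dz_comp[OF assms(1,2)] d_def a_def b_def x1_def x2_def
    comp_plus_def comp_minus_def cnj_cx_eq by (simp_all only: cx_eq)

text \<open>Let \<open>N_j\<close> be the j-th partial derivative plus \<i> times the j-th component
  of the potential. That potential, as a complex number, is \<open>\<i> t z\<close>, so
  \<open>D = N_1 + \<i> N_2\<close> and \<open>D' = N_1 - \<i> N_2\<close>. Hence
  \<open>D' (comp_plus \<omega>)\<close> and \<open>D (comp_minus \<omega>)\<close> are divergence
  plus and minus \<i> times curl: their sum gives the codifferential, their difference the exterior
  derivative.\<close>

lemma mag_codiff1_potential:
  assumes "\<omega> \<in> one_forms unit_disk" "x \<in> unit_disk"
  shows "mag_codiff1 unit_disk (potential t) \<omega> x
       = - (1/2) * mag_dz t (comp_plus \<omega>) x + - (1/2) * mag_dzbar t (comp_minus \<omega>) x"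
  unfolding mag_dz_comp[OF assms] mag_codiff1_def codiff1_def sum_Basis_vec2
    one_form_vec2[OF assms, of "potential t x"] potential_nth of_real_mult of_real_minus
  by (simp add: field_simps)

lemma mag_d1_potential:
  assumes "\<omega> \<in> one_forms unit_disk" "x \<in> unit_disk"
  shows "mag_d1 unit_disk (potential t) \<omega> x v w
       = - (\<i>/2) * (mag_dz t (comp_plus \<omega>) x - mag_dzbar t (comp_minus \<omega>) x)
          * of_real (v $ 1 * w $ 2 - v $ 2 * w $ 1)"
proof -
  have s: "smooth_on unit_disk (\<lambda>y. \<omega> y v)" for v by (rule one_forms_smooth[OF assms(1)])
  have "dirderiv unit_disk (\<lambda>y. \<omega> y w) x v = of_real (w $ 1) * dirderiv unit_disk (\<lambda>y. \<omega> y (axis 1 1)) x v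
      + of_real (w $ 2) * dirderiv unit_disk (\<lambda>y. \<omega> y (axis 2 1)) x v" for v w
    by (rule dirderiv_lincomb_cong[OF _ s s assms(2)])
      (simp, rule one_form_vec2[OF assms(1)])
  note der = this[of w v] this[of v w]
  show ?thesis
    unfolding mag_d1_def ext_d1_def der dirderiv_vec2[OF s assms(2), of _ v]
      dirderiv_vec2[OF s assms(2), of _ w] one_form_vec2[OF assms, of v] one_form_vec2[OF assms, of w]
      potential_inner mag_dz_comp[OF assms] of_real_mult of_real_diff
    using i_squared by algebra
qed

text \<open>With P and Q the two first-order expressions, the codifferential is a multiple of
  \<open>P + Q\<close> and the curl one of \<open>P - Q\<close>. When the remaining operators are
  applied, the cross terms \<open>D Q\<close> and \<open>D' P\<close> cancel, so the two components
  decouple without any commutator of D and D'.\<close>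

lemma mag_laplace1_potential:
  assumes "\<omega> \<in> one_forms unit_disk" "x \<in> unit_disk"
  shows "mag_laplace1 unit_disk (potential t) \<omega> x v
       = - (1/2) * (mag_dzbar t (mag_dz t (comp_plus \<omega>)) x * cnj (cx v)
                    + mag_dz t (mag_dzbar t (comp_minus \<omega>)) x * cx v)"
proof -
  define P where "P = mag_dz t (comp_plus \<omega>)"
  define Q where "Q = mag_dzbar t (comp_minus \<omega>)"
  have sP: "smooth_on unit_disk P" and sQ: "smooth_on unit_disk Q"
    using assms(1) by (simp_all add: P_def Q_def smooth_on_mag_dz smooth_on_mag_dzbar
        smooth_on_comp_plus smooth_on_comp_minus)
  have d0: "dirderiv unit_disk (mag_codiff1 unit_disk (potential t) \<omega>) x v
      = - (1/2) * dirderiv unit_disk P x v + - (1/2) * dirderiv unit_disk Q x v"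
    by (rule dirderiv_lincomb_cong[OF _ sP sQ assms(2)])
      (simp, unfold P_def Q_def, rule mag_codiff1_potential[OF assms(1)])
  have d2: "dirderiv unit_disk (\<lambda>y. mag_d1 unit_disk (potential t) \<omega> y b v) x b
      = (- (\<i>/2) * of_real (b $ 1 * v $ 2 - b $ 2 * v $ 1)) * dirderiv unit_disk P x b
        + ((\<i>/2) * of_real (b $ 1 * v $ 2 - b $ 2 * v $ 1)) * dirderiv unit_disk Q x b" for b
    by (rule dirderiv_lincomb_cong[OF _ sP sQ assms(2)])
      (simp, unfold P_def Q_def mag_d1_potential[OF assms(1)], simp add: algebra_simps)
  define p1 p2 q1 q2 where "p1 = dirderiv unit_disk P x (axis 1 1)"
    and "p2 = dirderiv unit_disk P x (axis 2 1)"
    and "q1 = dirderiv unit_disk Q x (axis 1 1)"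
    and "q2 = dirderiv unit_disk Q x (axis 2 1)"
  have dP: "dirderiv unit_disk P x u = of_real (u $ 1) * p1 + of_real (u $ 2) * p2"
    and dQ: "dirderiv unit_disk Q x u = of_real (u $ 1) * q1 + of_real (u $ 2) * q2" for u
    unfolding p1_def p2_def q1_def q2_def by (rule dirderiv_vec2[OF _ assms(2)] sP sQ)+
  have ax: "axis 1 1 $ (1::2) = (1::real)" "axis 1 1 $ (2::2) = (0::real)"
    "axis 2 1 $ (1::2) = (0::real)" "axis 2 1 $ (2::2) = (1::real)"
    by (simp_all add: axis_def)
  show ?thesis
    unfolding mag_laplace1_def mag_d0_def ext_d0_def mag_codiff2_def codiff2_def sum_Basis_vec2 d0 d2
      mag_codiff1_potential[OF assms] mag_d1_potential[OF assms] potential_inner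
      P_def[symmetric] Q_def[symmetric] mag_dzbar_def[of t P] mag_dz_def[of t Q] dz_def dzbar_def
      dP dQ ax potential_nth cnj_cx_eq
      of_real_mult of_real_diff of_real_minus of_real_0 of_real_1
    unfolding cx_eq
    using i_squared by algebra
qed

section \<open>Fourier series\<close>

definition fourier_coeff :: "(real \<Rightarrow> complex) \<Rightarrow> int \<Rightarrow> complex" where
  "fourier_coeff f l = (1 / (2 * pi)) * integral {0..2*pi} (\<lambda>\<theta>. f \<theta> * cis (- (of_int l * \<theta>)))"

lemma continuous_on_cis_linear [continuous_intros]:
  "continuous_on S f \<Longrightarrow> continuous_on S (\<lambda>\<theta>. cis (f \<theta>))"
  unfolding cis_conv_exp by (intro continuous_intros)

lemma fourier_coeff_cong:
  "(\<And>\<theta>. \<theta> \<in> {0..2*pi} \<Longrightarrow> f \<theta> = g \<theta>) \<Longrightarrow> fourier_coeff f l = fourier_coeff g l"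
  unfolding fourier_coeff_def by (metis (mono_tags, lifting) integral_cong)

lemma integrable_fourier:
  "continuous_on {0..2*pi} f \<Longrightarrow> (\<lambda>\<theta>. f \<theta> * cis (- (of_int l * \<theta>))) integrable_on {0..2*pi}"
  by (intro integrable_continuous_real continuous_intros)

lemma fourier_coeff_add:
  assumes "continuous_on {0..2*pi} f" "continuous_on {0..2*pi} g"
  shows "fourier_coeff (\<lambda>\<theta>. f \<theta> + g \<theta>) l = fourier_coeff f l + fourier_coeff g l"
  using integrable_fourier[OF assms(1)] integrable_fourier[OF assms(2)]
  by (simp add: fourier_coeff_def ring_distribs integral_add add_divide_distrib)

lemma fourier_coeff_cmult: "fourier_coeff (\<lambda>\<theta>. c * f \<theta>) l = c * fourier_coeff f l"
proof -
  have "integral {0..2*pi} (\<lambda>\<theta>. c * f \<theta> * cis (- (of_int l * \<theta>)))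
      = c * integral {0..2*pi} (\<lambda>\<theta>. f \<theta> * cis (- (of_int l * \<theta>)))"
    by (subst integral_mult_right[symmetric]) (simp add: mult.assoc)
  then show ?thesis by (simp add: fourier_coeff_def)
qed

lemma fourier_coeff_diff:
  assumes "continuous_on {0..2*pi} f" "continuous_on {0..2*pi} g"
  shows "fourier_coeff (\<lambda>\<theta>. f \<theta> - g \<theta>) l = fourier_coeff f l - fourier_coeff g l"
  using fourier_coeff_add[OF assms(1), of "\<lambda>\<theta>. - 1 * g \<theta>"] fourier_coeff_cmult[of "- 1" g] assms(2)
  by (simp add: continuous_on_minus)

lemma fourier_coeff_shift:
  "fourier_coeff (\<lambda>\<theta>. f \<theta> * cis (of_int k * \<theta>)) l = fourier_coeff f (l - k)"
  by (simp add: fourier_coeff_def mult.assoc cis_mult algebra_simps)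

lemma fourier_coeff_cnj: "fourier_coeff (\<lambda>\<theta>. cnj (f \<theta>)) l = cnj (fourier_coeff f (- l))"
proof -
  have "integral {0..2*pi} (\<lambda>\<theta>. cnj (f \<theta>) * cis (- (of_int l * \<theta>)))
      = integral {0..2*pi} (\<lambda>\<theta>. cnj (f \<theta> * cis (- (of_int (- l) * \<theta>))))"
    by (simp add: cis_cnj)
  also have "\<dots> = cnj (integral {0..2*pi} (\<lambda>\<theta>. f \<theta> * cis (- (of_int (- l) * \<theta>))))"
    by (rule integral_cnj[symmetric])
  finally show ?thesis by (simp add: fourier_coeff_def)
qed

lemma fourier_coeff_bound:
  assumes "continuous_on {0..2*pi} f" "\<And>\<theta>. \<theta> \<in> {0..2*pi} \<Longrightarrow> norm (f \<theta>) \<le> B"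
  shows "norm (fourier_coeff f l) \<le> B"
proof -
  have "norm (integral {0..2*pi} (\<lambda>\<theta>. f \<theta> * cis (- (of_int l * \<theta>)))) \<le> B * (2 * pi - 0)"
    using assms by (intro integral_bound continuous_intros) (auto simp: norm_mult)
  then show ?thesis by (simp add: fourier_coeff_def norm_mult norm_divide field_simps)
qed

lemma has_vector_derivative_cis_linear:
  "((\<lambda>\<theta>. cis (c * \<theta>)) has_vector_derivative \<i> * of_real c * cis (c * \<theta>)) (at \<theta> within S)"
proof -
  have "((\<lambda>z. exp (\<i> * of_real c * z)) has_field_derivative \<i> * of_real c * exp (\<i> * of_real c * of_real \<theta>))
      (at (of_real \<theta>))"
    by (auto intro!: derivative_eq_intros)
  from has_vector_derivative_real_field[OF this] show ?thesis
    by (simp add: cis_conv_exp o_def mult.assoc)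
qed

lemma fourier_coeff_deriv:
  assumes f: "\<And>\<theta>. \<theta> \<in> {0..2*pi} \<Longrightarrow> (f has_vector_derivative f' \<theta>) (at \<theta> within {0..2*pi})"
    and cont: "continuous_on {0..2*pi} f'"
    and per: "f (2 * pi) = f 0"
  shows "fourier_coeff f' l = \<i> * of_int l * fourier_coeff f l"
proof -
  define e where "e \<theta> = cis (- (of_int l * \<theta>))" for \<theta>
  have contf: "continuous_on {0..2*pi} f"
    using f by (meson continuous_on_vector_derivative)
  have e: "(e has_vector_derivative - \<i> * of_int l * e \<theta>) (at \<theta> within {0..2*pi})" for \<theta>
    using has_vector_derivative_cis_linear[of "- of_int l" \<theta> "{0..2*pi}"] by (simp add: e_def[abs_def])
  have "((\<lambda>\<theta>. f \<theta> * (- \<i> * of_int l * e \<theta>) + f' \<theta> * e \<theta>) has_integral f (2*pi) * e (2*pi) - f 0 * e 0) {0..2*pi}"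
    by (intro fundamental_theorem_of_calculus has_vector_derivative_mult f e) auto
  moreover have "e (2 * pi) = e 0"
    by (simp add: e_def cis.code complex_eq_iff mult.commute[of _ "2*pi"] cos_int_2pin sin_int_2pin
        del: mult_minus_right flip: mult_minus_right of_int_minus)
  ultimately have z: "integral {0..2*pi} (\<lambda>\<theta>. f \<theta> * (- \<i> * of_int l * e \<theta>) + f' \<theta> * e \<theta>) = 0"
    using per by (simp add: integral_unique)
  have "0 = integral {0..2*pi} (\<lambda>\<theta>. - (\<i> * of_int l) * (f \<theta> * e \<theta>) + f' \<theta> * e \<theta>)"
    using z by (simp add: algebra_simps)
  also have "\<dots> = - (\<i> * of_int l) * integral {0..2*pi} (\<lambda>\<theta>. f \<theta> * e \<theta>) + integral {0..2*pi} (\<lambda>\<theta>. f' \<theta> * e \<theta>)"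
    unfolding e_def using integrable_fourier[OF contf] integrable_fourier[OF cont]
    by (subst integral_add) (simp_all only: integrable_on_mult_right integral_mult_right)
  finally show ?thesis by (simp add: fourier_coeff_def e_def)
qed

text \<open>For \<open>k \<noteq> l\<close> the rule for derivatives shows that \<open>k - l\<close>
  times the coefficient is 0, so no integral has to be evaluated.\<close>

lemma fourier_coeff_cis: "fourier_coeff (\<lambda>\<theta>. cis (of_int k * \<theta>)) l = (if k = l then 1 else 0)"
proof (cases "k = l")
  case True
  then show ?thesis by (simp add: fourier_coeff_def cis_mult scaleR_conv_of_real)
next
  case False
  have "fourier_coeff (\<lambda>\<theta>. \<i> * of_int k * cis (of_int k * \<theta>)) l
      = \<i> * of_int l * fourier_coeff (\<lambda>\<theta>. cis (of_int k * \<theta>)) l"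
  proof (rule fourier_coeff_deriv)
    show "((\<lambda>\<theta>. cis (of_int k * \<theta>)) has_vector_derivative \<i> * of_int k * cis (of_int k * \<theta>))
        (at \<theta> within {0..2*pi})" for \<theta>
      using has_vector_derivative_cis_linear[of "of_int k" \<theta> "{0..2*pi}"] by simp
    show "cis (of_int k * (2 * pi)) = cis (of_int k * 0)"
      by (simp add: complex_eq_iff mult.commute[of _ "2*pi"] cos_int_2pin sin_int_2pin)
  qed (intro continuous_intros)
  then have "(of_int k - of_int l) * fourier_coeff (\<lambda>\<theta>. cis (of_int k * \<theta>)) l = 0"
    unfolding fourier_coeff_cmult by (simp add: algebra_simps)
  then show ?thesis using False by simp
qed

section \<open>Completeness of the exponentials on the circle\<close>

lemma continuous_on_real_polynomial_function:
  "real_polynomial_function g \<Longrightarrow> continuous_on S g"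
  by (simp add: continuous_at_imp_continuous_on continuous_real_polymonial_function)

lemma continuous_on_comp_cis:
  fixes v :: "complex \<Rightarrow> complex"
  assumes "continuous_on (sphere 0 1) v"
  shows "continuous_on S (\<lambda>\<theta>. v (cis \<theta>))"
  by (rule continuous_on_compose2[OF assms continuous_on_cis_linear[OF continuous_on_id]]) auto

text \<open>
  Quantifying over all \<open>u\<close> makes the statement stable under products of polynomials.
\<close>

lemma fourier_coeff_zero_polynomial:
  assumes "real_polynomial_function g"
    and "continuous_on (sphere 0 1) u" "\<And>l. fourier_coeff (\<lambda>\<theta>. u (cis \<theta>)) l = 0"
  shows "fourier_coeff (\<lambda>\<theta>. u (cis \<theta>) * of_real (g (cis \<theta>))) l = 0"
proof -
  show ?thesis using assms
  proof (induction g arbitrary: u l rule: real_polynomial_function.induct)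
    case (linear h)
    \<comment> \<open>On the circle a real-linear function is a combination of the exponentials of
      index 1 and -1, so multiplication by it merely shifts Fourier coefficients.\<close>
    define \<alpha> \<beta> where "\<alpha> = (of_real (h 1) - \<i> * of_real (h \<i>)) / 2"
      and "\<beta> = (of_real (h 1) + \<i> * of_real (h \<i>)) / 2"
    have h: "of_real (h (cis \<theta>)) = \<alpha> * cis (of_int 1 * \<theta>) + \<beta> * cis (of_int (- 1) * \<theta>)" for \<theta>
    proof -
      have "h (cis \<theta>) = h (cos \<theta> *\<^sub>R 1 + sin \<theta> *\<^sub>R \<i>)"
        by (simp add: complex_eq_iff arg_cong[of _ _ h])
      also have "\<dots> = cos \<theta> * h 1 + sin \<theta> * h \<i>"
        using linear by (simp add: bounded_linear.linear linear_add linear_cmul)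
      finally show ?thesis by (simp add: \<alpha>_def \<beta>_def complex_eq_iff field_simps)
    qed
    have "fourier_coeff (\<lambda>\<theta>. u (cis \<theta>) * of_real (h (cis \<theta>))) l =
       fourier_coeff (\<lambda>\<theta>. \<alpha> * (u (cis \<theta>) * cis (of_int 1 * \<theta>)) + \<beta> * (u (cis \<theta>) * cis (of_int (- 1) * \<theta>))) l"
      unfolding h by (simp add: algebra_simps)
    also have "\<dots> = 0"
      by (subst fourier_coeff_add)
        (simp_all add: fourier_coeff_cmult fourier_coeff_shift[of _ 1, simplified]
          fourier_coeff_shift[of _ "- 1", simplified] linear(3)
          continuous_on_comp_cis[OF linear(2)] continuous_on_mult continuous_on_cis_linear continuous_on_minus)
    finally show ?case .
  next
    case (const c)
    have "fourier_coeff (\<lambda>\<theta>. u (cis \<theta>) * of_real c) l = of_real c * fourier_coeff (\<lambda>\<theta>. u (cis \<theta>)) l"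
      by (simp only: mult.commute[of _ "of_real c"] fourier_coeff_cmult)
    then show ?case using const by simp
  next
    case (add g h)
    have g: "continuous_on (sphere 0 1) (\<lambda>z. u z * of_real (g z))"
      and h: "continuous_on (sphere 0 1) (\<lambda>z. u z * of_real (h z))"
      using add.hyps add.prems(1)
      by (auto intro!: continuous_on_mult continuous_on_of_real continuous_on_real_polynomial_function)
    have "fourier_coeff (\<lambda>\<theta>. u (cis \<theta>) * of_real (g (cis \<theta>)) + u (cis \<theta>) * of_real (h (cis \<theta>))) l = 0"
      using add.IH[OF add.prems]
      by (subst fourier_coeff_add[OF continuous_on_comp_cis[OF g] continuous_on_comp_cis[OF h]]) simp
    then show ?case by (simp add: distrib_left)
  next
    case (mult g h)
    have "continuous_on (sphere 0 1) (\<lambda>z. u z * complex_of_real (g z))"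
      using mult.hyps mult.prems(1)
      by (auto intro!: continuous_on_mult continuous_on_of_real continuous_on_real_polynomial_function)
    from mult.IH(2)[OF this mult.IH(1)[OF mult.prems]] show ?case by (simp add: mult.assoc)
  qed
qed

text \<open>By Stone-Weierstrass, \<open>cnj F\<close> is a uniform limit of polynomials g in the
  two real coordinates. Since \<open>F g\<close> has mean zero, the mean of \<open>F * cnj F\<close>
  is arbitrarily small, hence 0, and continuity gives \<open>F = 0\<close>.\<close>

lemma fourier_coeff_unique_circle:
  assumes F: "continuous_on (sphere 0 1) F" "\<And>l. fourier_coeff (\<lambda>\<theta>. F (cis \<theta>)) l = 0"
  shows "\<theta> \<in> {0..2*pi} \<Longrightarrow> F (cis \<theta>) = 0"
proof -
  have "bounded (F ` sphere 0 1)"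
    by (intro compact_imp_bounded compact_continuous_image[OF F(1)] compact_sphere)
  then obtain B where B: "B > 0" "\<And>z. z \<in> sphere 0 1 \<Longrightarrow> norm (F z) \<le> B"
    unfolding bounded_pos ball_simps by blast
  let ?I = "fourier_coeff (\<lambda>\<theta>. F (cis \<theta>) * cnj (F (cis \<theta>))) 0"
  have contF2: "continuous_on {0..2*pi} (\<lambda>\<theta>. F (cis \<theta>) * cnj (F (cis \<theta>)))"
    using continuous_on_comp_cis[OF F(1)] by (intro continuous_intros)
  have small: "norm ?I \<le> B * e" if "e > 0" for e
  proof -
    have "continuous_on (sphere 0 1) (\<lambda>z. cnj (F z))" using F(1) by (intro continuous_intros)
    from Stone_Weierstrass_polynomial_function[OF compact_sphere this \<open>e > 0\<close>]
    obtain g where g: "polynomial_function g" "\<And>z. z \<in> sphere 0 1 \<Longrightarrow> norm (cnj (F z) - g z) < e"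
      by auto
    have re: "real_polynomial_function (\<lambda>z. Re (g z))" and im: "real_polynomial_function (\<lambda>z. Im (g z))"
      using g(1)[unfolded polynomial_function_def, rule_format, OF bounded_linear_Re]
        g(1)[unfolded polynomial_function_def, rule_format, OF bounded_linear_Im]
      by (simp_all add: o_def)
    have contg: "continuous_on (sphere 0 1) g" by (rule continuous_on_polymonial_function[OF g(1)])
    have "fourier_coeff (\<lambda>\<theta>. F (cis \<theta>) * g (cis \<theta>)) 0
      = fourier_coeff (\<lambda>\<theta>. F (cis \<theta>) * of_real (Re (g (cis \<theta>))) + \<i> * (F (cis \<theta>) * of_real (Im (g (cis \<theta>))))) 0"
      by (rule fourier_coeff_cong) (simp add: complex_eq_iff algebra_simps)
    also have "\<dots> = 0"
      by (subst fourier_coeff_add)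
        (simp_all add: fourier_coeff_cmult fourier_coeff_zero_polynomial[OF re F]
          fourier_coeff_zero_polynomial[OF im F] continuous_on_comp_cis[OF F(1)]
          continuous_on_comp_cis[OF contg] continuous_on_mult continuous_on_of_real
          continuous_on_Re continuous_on_Im)
    finally have "?I = ?I - fourier_coeff (\<lambda>\<theta>. F (cis \<theta>) * g (cis \<theta>)) 0" by simp
    also have "\<dots> = fourier_coeff (\<lambda>\<theta>. F (cis \<theta>) * cnj (F (cis \<theta>)) - F (cis \<theta>) * g (cis \<theta>)) 0"
      using continuous_on_comp_cis[OF F(1)] continuous_on_comp_cis[OF contg] by (intro fourier_coeff_diff[symmetric] continuous_intros)
    also have "norm \<dots> \<le> B * e"
    proof (rule fourier_coeff_bound)
      show "norm (F (cis \<theta>) * cnj (F (cis \<theta>)) - F (cis \<theta>) * g (cis \<theta>)) \<le> B * e" for \<theta>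
        using B(1) B(2)[of "cis \<theta>"] g(2)[of "cis \<theta>"]
        by (simp flip: right_diff_distrib add: norm_mult mult_mono)
      show "continuous_on {0..2*pi} (\<lambda>\<theta>. F (cis \<theta>) * cnj (F (cis \<theta>)) - F (cis \<theta>) * g (cis \<theta>))"
        using continuous_on_comp_cis[OF F(1)] continuous_on_comp_cis[OF contg] by (intro continuous_intros)
    qed
    finally show ?thesis .
  qed
  have "?I = 0"
  proof (rule ccontr)
    assume "?I \<noteq> 0"
    then have "norm ?I > 0" by simp
    then show False using small[of "norm ?I / (2 * B)"] B(1) by (simp add: field_simps)
  qed
  then have "integral {0..2*pi} (\<lambda>\<theta>. F (cis \<theta>) * cnj (F (cis \<theta>))) = 0"
    by (simp add: fourier_coeff_def)
  moreover have "((\<lambda>\<theta>. F (cis \<theta>) * cnj (F (cis \<theta>))) has_integral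
      integral {0..2*pi} (\<lambda>\<theta>. F (cis \<theta>) * cnj (F (cis \<theta>)))) {0..2*pi}"
    using integrable_continuous_real[OF contF2] by blast
  ultimately have "((\<lambda>\<theta>. Re (F (cis \<theta>) * cnj (F (cis \<theta>)))) has_integral Re 0) {0..2*pi}"
    by (intro has_integral_Re) simp
  moreover have "continuous_on {0..2*pi} (\<lambda>\<theta>. Re (F (cis \<theta>) * cnj (F (cis \<theta>))))"
    by (intro continuous_intros contF2)
  moreover have nn: "Re (F (cis \<theta>) * cnj (F (cis \<theta>))) = (norm (F (cis \<theta>)))\<^sup>2" for \<theta>
    by (simp flip: complex_norm_square)
  ultimately show "F (cis \<theta>) = 0" if "\<theta> \<in> {0..2*pi}" for \<theta>
    using integral_eq_0_iff[of 0 "2*pi" "\<lambda>\<theta>. Re (F (cis \<theta>) * cnj (F (cis \<theta>)))"] that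
    unfolding nn by (auto simp: integral_unique)
qed

lemma periodic_int:
  fixes f :: "real \<Rightarrow> 'a"
  assumes "\<And>\<theta>. f (\<theta> + 2 * pi) = f \<theta>"
  shows "f (\<theta> + 2 * pi * of_int n) = f \<theta>"
proof (induction n arbitrary: \<theta> rule: int_induct[where k = 0])
  case (step1 i)
  then show ?case using assms[of "\<theta> + 2 * pi * of_int i"] by (simp add: algebra_simps)
next
  case (step2 i)
  then show ?case using assms[of "\<theta> + 2 * pi * of_int (i - 1)"] by (simp add: algebra_simps)
qed simp

lemma periodic_cis_eq:
  fixes f :: "real \<Rightarrow> 'a"
  assumes "\<And>\<theta>. f (\<theta> + 2 * pi) = f \<theta>" "cis \<theta> = cis \<phi>"
  shows "f \<theta> = f \<phi>"
proof -
  obtain n where "\<theta> = \<phi> + 2 * pi * of_int n"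
    using assms(2) by (metis cis.sel sin_cos_eq_iff mult.commute mult.assoc)
  then show ?thesis using periodic_int[of f, OF assms(1)] by simp
qed

text \<open>Transfers the statement from the circle to periodic functions on the line, by descending
  f to the circle.\<close>

lemma fourier_coeff_unique:
  assumes f: "continuous_on UNIV f" "\<And>\<theta>. f (\<theta> + 2 * pi) = f \<theta>" "\<And>l. fourier_coeff f l = 0"
  shows "f \<theta> = 0"
proof -
  define F where "F z = f (Arg2pi z)" for z
  have F: "F (cis \<theta>) = f \<theta>" for \<theta>
  proof -
    have "cis (Arg2pi (cis \<theta>)) = cis \<theta>"
      by (metis Arg2pi_eq cis_conv_exp mult_1 norm_cis of_real_1)
    then show ?thesis unfolding F_def by (rule periodic_cis_eq[of f, OF f(2)])
  qed
  have circ: "\<exists>\<theta>\<in>{0..2*pi}. z = cis \<theta>" if "z \<in> sphere 0 1" for z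
    using that Arg2pi_eq[of z] Arg2pi_ge_0[of z] Arg2pi_lt_2pi[of z]
    by (intro bexI[of _ "Arg2pi z"]) (auto simp: cis_conv_exp)
  \<comment> \<open>\<open>Arg2pi\<close> jumps at 1, so continuity is not inherited from it.
    Instead the graph of F is the image of a compact interval, hence closed, and F has values in a
    compact set.\<close>
  have contF: "continuous_on (sphere 0 1) F"
  proof (rule continuous_from_closed_graph)
    have fc: "continuous_on {0..2*pi} f" using f(1) continuous_on_subset by blast
    show "compact (f ` {0..2*pi})" by (intro compact_continuous_image fc) simp
    show "F \<in> sphere 0 1 \<rightarrow> f ` {0..2*pi}" using circ F by fastforce
    have "(\<lambda>z. (z, F z)) ` sphere 0 1 = (\<lambda>\<theta>. (cis \<theta>, f \<theta>)) ` {0..2*pi}"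
      using circ F by force
    moreover have "compact ((\<lambda>\<theta>. (cis \<theta>, f \<theta>)) ` {0..2*pi})"
      by (intro compact_continuous_image continuous_intros fc) simp
    ultimately show "closed ((\<lambda>z. (z, F z)) ` sphere 0 1)" by (simp add: compact_imp_closed)
  qed
  obtain \<phi> where "\<phi> \<in> {0..2*pi}" "cis \<theta> = cis \<phi>" using circ[of "cis \<theta>"] by auto
  moreover have "f \<theta> = f \<phi>" by (rule periodic_cis_eq[of f, OF f(2)]) fact
  ultimately show ?thesis
    using fourier_coeff_unique_circle[OF contF, of \<phi>] f(3) unfolding F by simp
qed

section \<open>Decay of the Fourier coefficients of smooth periodic functions\<close>

lemma smooth_on_real_deriv:
  fixes f :: "real \<Rightarrow> complex"
  assumes "smooth_on UNIV f"
  shows "(f has_vector_derivative dirderiv UNIV f \<theta> 1) (at \<theta> within S)"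
proof -
  have d: "(f has_derivative dirderiv UNIV f \<theta>) (at \<theta>)"
    using smooth_on_has_derivative[OF assms] by simp
  have "dirderiv UNIV f \<theta> v = v *\<^sub>R dirderiv UNIV f \<theta> 1" for v
    using linear_cmul[OF has_derivative_linear[OF d], of v 1] by simp
  then have "dirderiv UNIV f \<theta> = (\<lambda>v. v *\<^sub>R dirderiv UNIV f \<theta> 1)" by (rule ext)
  then show ?thesis using has_derivative_at_withinI[OF d] unfolding has_vector_derivative_def by metis
qed

lemma dirderiv_periodic:
  fixes f :: "real \<Rightarrow> complex"
  assumes "smooth_on UNIV f" "\<And>\<theta>. f (\<theta> + c) = f \<theta>"
  shows "dirderiv UNIV f (\<theta> + c) v = dirderiv UNIV f \<theta> v"
proof -
  have "((\<lambda>x. f (x + c)) has_derivative dirderiv UNIV f (\<theta> + c)) (at \<theta>)"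
    by (rule has_derivative_compose[of "\<lambda>x. x + c" "\<lambda>x. x", simplified])
      (use smooth_on_has_derivative[OF assms(1)] in \<open>auto intro!: derivative_eq_intros\<close>)
  then show ?thesis using dirderiv_eqI[of UNIV \<theta> f] assms(2) by simp
qed

text \<open>Each differentiation multiplies the coefficient by \<open>\<i> l\<close> and stays
  within smooth periodic functions; N of them give the N-th power.\<close>

lemma fourier_coeff_decay_aux:
  assumes "smooth_on UNIV f" "\<And>\<theta>. f (\<theta> + 2 * pi) = f \<theta>"
  shows "\<exists>C. \<forall>l. norm (fourier_coeff f l) * \<bar>of_int l\<bar> ^ N \<le> C"
  using assms
proof (induction N arbitrary: f)
  case 0
  have c: "continuous_on {0..2*pi} f"
    using smooth_on_imp_continuous_on[OF 0(1)] continuous_on_subset by blast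
  then have "bounded (f ` {0..2*pi})" by (intro compact_imp_bounded compact_continuous_image) auto
  then obtain B where "\<And>\<theta>. \<theta> \<in> {0..2*pi} \<Longrightarrow> norm (f \<theta>) \<le> B"
    unfolding bounded_iff ball_simps by blast
  then have "norm (fourier_coeff f l) \<le> B" for l by (rule fourier_coeff_bound[OF c])
  then show ?case by auto
next
  case (Suc N)
  let ?f' = "\<lambda>\<theta>. dirderiv UNIV f \<theta> 1"
  have s: "smooth_on UNIV ?f'" by (rule smooth_on_dirderiv[OF Suc.prems(1)])
  obtain C where C: "\<And>l. norm (fourier_coeff ?f' l) * \<bar>of_int l\<bar> ^ N \<le> C"
    using Suc.IH[OF s] dirderiv_periodic[OF Suc.prems] by blast
  have "fourier_coeff ?f' l = \<i> * of_int l * fourier_coeff f l" for l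
  proof (rule fourier_coeff_deriv)
    show "continuous_on {0..2*pi} ?f'"
      using smooth_on_imp_continuous_on[OF s] continuous_on_subset by blast
    show "f (2 * pi) = f 0" using Suc.prems(2)[of 0] by simp
  qed (rule smooth_on_real_deriv[OF Suc.prems(1)])
  then have "norm (fourier_coeff ?f' l) = \<bar>of_int l\<bar> * norm (fourier_coeff f l)" for l
    by (simp add: norm_mult)
  then have "norm (fourier_coeff f l) * \<bar>of_int l\<bar> ^ Suc N \<le> C" for l
    using C[of l] by (simp add: mult_ac)
  then show ?case by blast
qed

text \<open>The weight \<open>\<bar>l\<bar> + 1\<close> stays positive at \<open>l = 0\<close>. The
  factor \<open>2 ^ N\<close> comes from \<open>\<bar>l\<bar> + 1 \<le> 2 \<bar>l\<bar>\<close> for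
  the other l.\<close>

lemma fourier_coeff_decay:
  assumes "smooth_on UNIV f" "\<And>\<theta>. f (\<theta> + 2 * pi) = f \<theta>"
  shows "\<exists>C. \<forall>l. norm (fourier_coeff f l) * (\<bar>of_int l\<bar> + 1) ^ N \<le> C"
proof -
  obtain C0 where C0: "\<And>l. norm (fourier_coeff f l) * \<bar>of_int l\<bar> ^ 0 \<le> C0"
    using exE[OF fourier_coeff_decay_aux[of f, OF assms, of 0]] by metis
  obtain C where C: "\<And>l. norm (fourier_coeff f l) * \<bar>of_int l\<bar> ^ N \<le> C"
    using exE[OF fourier_coeff_decay_aux[of f, OF assms, of N]] by metis
  have "norm (fourier_coeff f l) * (\<bar>of_int l\<bar> + 1) ^ N \<le> 2 ^ N * (C0 + C)" for l
  proof -
    have "(\<bar>real_of_int l\<bar> + 1) ^ N \<le> 2 ^ N * (1 + \<bar>of_int l\<bar> ^ N)"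
    proof (cases "l = 0")
      case True
      have "1 * 1 \<le> 2 ^ N * (1 + (0::real) ^ N)" by (intro mult_mono) auto
      then show ?thesis using True by simp
    next
      case False
      then have "(\<bar>real_of_int l\<bar> + 1) ^ N \<le> (2 * \<bar>real_of_int l\<bar>) ^ N"
        by (intro power_mono) linarith+
      then show ?thesis by (simp add: power_mult_distrib distrib_left add_increasing)
    qed
    then have "norm (fourier_coeff f l) * (\<bar>of_int l\<bar> + 1) ^ N
        \<le> norm (fourier_coeff f l) * (2 ^ N * (1 + \<bar>of_int l\<bar> ^ N))"
      by (intro mult_left_mono) auto
    also have "\<dots> = 2 ^ N * (norm (fourier_coeff f l) + norm (fourier_coeff f l) * \<bar>of_int l\<bar> ^ N)"
      by (simp add: algebra_simps)
    also have "\<dots> \<le> 2 ^ N * (C0 + C)"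
      using C0[of l] C[of l] by (intro mult_left_mono add_mono) auto
    finally show ?thesis .
  qed
  then show ?thesis by blast
qed

lemma summable_fourier_coeff:
  assumes "smooth_on UNIV f" "\<And>\<theta>. f (\<theta> + 2 * pi) = f \<theta>" "\<And>n. int n \<le> \<bar>k n\<bar>"
  shows "summable (\<lambda>n. norm (fourier_coeff f (k n)) * (real n + 1) ^ N)"
proof -
  \<comment> \<open>The two spare powers of the weight leave the convergent series of inverse
    squares.\<close>
  obtain C where C: "\<And>l. norm (fourier_coeff f l) * (\<bar>of_int l\<bar> + 1) ^ (N + 2) \<le> C"
    using exE[OF fourier_coeff_decay[of f, OF assms(1,2), of "N + 2"]] by metis
  have "summable (\<lambda>n. inverse (real (Suc n) ^ 2))"
    using inverse_power_summable[of 2, where 'a = real] by (subst summable_Suc_iff) simp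
  then have "summable (\<lambda>n. C * inverse (real (Suc n) ^ 2))" by (rule summable_mult)
  then show ?thesis
  proof (rule summable_comparison_test')
    fix n :: nat
    have "real n \<le> \<bar>of_int (k n)\<bar>"
      using assms(3)[of n] by (metis of_int_abs of_int_le_iff of_int_of_nat_eq)
    have "norm (fourier_coeff f (k n)) * (real n + 1) ^ (N + 2)
        \<le> norm (fourier_coeff f (k n)) * (\<bar>of_int (k n)\<bar> + 1) ^ (N + 2)"
      using \<open>real n \<le> \<bar>of_int (k n)\<bar>\<close> by (intro mult_left_mono power_mono) simp_all
    also have "\<dots> \<le> C" by (rule C)
    finally have "norm (fourier_coeff f (k n)) * (real n + 1) ^ N * (real n + 1)\<^sup>2 \<le> C"
      by (simp only: power_add mult.assoc)
    then show "norm (norm (fourier_coeff f (k n)) * (real n + 1) ^ N) \<le> C * inverse (real (Suc n) ^ 2)"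
      by (simp add: field_simps)
  qed
qed

section \<open>Fourier series\<close>

lemma fourier_coeff_uniform_limit:
  assumes u: "uniform_limit {0..2*pi} F f sequentially"
    and c: "\<And>n. continuous_on {0..2*pi} (F n)"
  shows "(\<lambda>n. fourier_coeff (F n) l) \<longlonglongrightarrow> fourier_coeff f l"
proof (rule tendstoI)
  fix e :: real assume "e > 0"
  have cf: "continuous_on {0..2*pi} f"
    by (rule uniform_limit_theorem[OF _ u]) (simp_all add: c)
  show "\<forall>\<^sub>F n in sequentially. dist (fourier_coeff (F n) l) (fourier_coeff f l) < e"
  proof (rule eventually_mono[OF uniform_limitD[OF u, of "e / 2"]])
    show "e / 2 > 0" using \<open>e > 0\<close> by simp
  next
    fix n assume n: "\<forall>x\<in>{0..2*pi}. dist (F n x) (f x) < e / 2"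
    have "norm (fourier_coeff (\<lambda>x. F n x - f x) l) \<le> e / 2"
      using n by (intro fourier_coeff_bound continuous_intros c cf) (force simp: dist_norm)
    then show "dist (fourier_coeff (F n) l) (fourier_coeff f l) < e"
      using \<open>e > 0\<close> by (simp add: dist_norm fourier_coeff_diff[OF c cf])
  qed
qed

lemma fourier_coeff_suminf:
  assumes "summable (\<lambda>n. norm (a n))"
  shows "fourier_coeff (\<lambda>\<theta>. \<Sum>n. a n * cis (of_int (k n) * \<theta>)) l = (\<Sum>n. if k n = l then a n else 0)"
    and "continuous_on UNIV (\<lambda>\<theta>. \<Sum>n. a n * cis (of_int (k n) * \<theta>))"
proof -
  have u: "uniform_limit UNIV (\<lambda>n \<theta>. \<Sum>i<n. a i * cis (of_int (k i) * \<theta>))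
      (\<lambda>\<theta>. \<Sum>n. a n * cis (of_int (k n) * \<theta>)) sequentially"
    by (rule Weierstrass_m_test[OF _ assms]) (simp add: norm_mult)
  have c: "continuous_on S (\<lambda>\<theta>. \<Sum>i<n. a i * cis (of_int (k i) * \<theta>))" for n S
    by (intro continuous_intros)
  show "continuous_on UNIV (\<lambda>\<theta>. \<Sum>n. a n * cis (of_int (k n) * \<theta>))"
    by (rule uniform_limit_theorem[OF _ u]) (simp_all add: c)
  have "fourier_coeff (\<lambda>\<theta>. \<Sum>i<n. a i * cis (of_int (k i) * \<theta>)) l = (\<Sum>i<n. if k i = l then a i else 0)" for n
  proof (induction n)
    case 0
    show ?case by (simp add: fourier_coeff_def)
  next
    case (Suc n)
    have "fourier_coeff (\<lambda>\<theta>. (\<Sum>i<n. a i * cis (of_int (k i) * \<theta>)) + a n * cis (of_int (k n) * \<theta>)) l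
      = (\<Sum>i<n. if k i = l then a i else 0) + a n * (if k n = l then 1 else 0)"
      by (subst fourier_coeff_add) (simp_all only: c Suc fourier_coeff_cmult fourier_coeff_cis
          continuous_on_mult continuous_on_const continuous_on_cis_linear continuous_on_id)
    then show ?case by simp
  qed
  then have "(\<lambda>n. \<Sum>i<n. if k i = l then a i else 0) \<longlonglongrightarrow>
      fourier_coeff (\<lambda>\<theta>. \<Sum>n. a n * cis (of_int (k n) * \<theta>)) l"
    using fourier_coeff_uniform_limit[OF uniform_limit_on_subset[OF u] c, of l] by simp
  then show "fourier_coeff (\<lambda>\<theta>. \<Sum>n. a n * cis (of_int (k n) * \<theta>)) l = (\<Sum>n. if k n = l then a n else 0)"
    using sums_unique by (auto simp: sums_def)
qed

text \<open>f and the sum of its series are continuous, periodic and have the same coefficients. The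
  split into indices \<open>n + 1\<close> and \<open>- n\<close> matches the two families of modes:
  the first carries a factor \<open>z^(n+1)\<close>, the second is the n-th power of z'.\<close>

lemma fourier_expansion:
  assumes f: "smooth_on UNIV f" "\<And>\<theta>. f (\<theta> + 2 * pi) = f \<theta>"
  shows "f \<theta> = (\<Sum>n. fourier_coeff f (int n + 1) * cis (of_int (int n + 1) * \<theta>))
             + (\<Sum>n. fourier_coeff f (- int n) * cis (of_int (- int n) * \<theta>))"
proof -
  define S1 where "S1 \<theta> = (\<Sum>n. fourier_coeff f (int n + 1) * cis (of_int (int n + 1) * \<theta>))" for \<theta>
  define S2 where "S2 \<theta> = (\<Sum>n. fourier_coeff f (- int n) * cis (of_int (- int n) * \<theta>))" for \<theta>
  have sm1: "summable (\<lambda>n. norm (fourier_coeff f (int n + 1)))"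
    and sm2: "summable (\<lambda>n. norm (fourier_coeff f (- int n)))"
    using summable_fourier_coeff[OF f, of "\<lambda>n. int n + 1" 0] summable_fourier_coeff[OF f, of "\<lambda>n. - int n" 0]
    by simp_all
  note S = fourier_coeff_suminf[OF sm1, of "\<lambda>n. int n + 1", folded S1_def]
    fourier_coeff_suminf[OF sm2, of "\<lambda>n. - int n", folded S2_def]
  have c: "continuous_on T f" "continuous_on T S1" "continuous_on T S2" for T
    using smooth_on_imp_continuous_on[OF f(1)] S(2,4) continuous_on_subset by blast+
  have "(\<Sum>n. if int n + 1 = l then fourier_coeff f (int n + 1) else 0)
      + (\<Sum>n. if - int n = l then fourier_coeff f (- int n) else 0) = fourier_coeff f l" for l
  proof (cases "l \<ge> 1")
    case True
    then have "(\<lambda>n. if int n + 1 = l then fourier_coeff f (int n + 1) else 0)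
        = (\<lambda>n. if n = nat (l - 1) then fourier_coeff f l else 0)"
      by (intro ext) auto
    moreover have "(\<lambda>n. if - int n = l then fourier_coeff f (- int n) else 0) = (\<lambda>n. 0)"
      using True by auto
    ultimately show ?thesis
      using sums_unique[OF sums_single[of "nat (l - 1)" "\<lambda>_. fourier_coeff f l"]] by simp
  next
    case False
    then have "(\<lambda>n. if - int n = l then fourier_coeff f (- int n) else 0)
        = (\<lambda>n. if n = nat (- l) then fourier_coeff f l else 0)"
      by (intro ext) auto
    moreover have "(\<lambda>n. if int n + 1 = l then fourier_coeff f (int n + 1) else 0) = (\<lambda>n. 0)"
      using False by auto
    ultimately show ?thesis
      using sums_unique[OF sums_single[of "nat (- l)" "\<lambda>_. fourier_coeff f l"]] by simp
  qed
  then have zero: "fourier_coeff (\<lambda>\<theta>. f \<theta> - (S1 \<theta> + S2 \<theta>)) l = 0" for l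
    by (subst fourier_coeff_diff[OF c(1) continuous_on_add[OF c(2,3)]])
      (simp add: fourier_coeff_add[OF c(2,3)] S(1,3))
  have cisper: "cis (of_int k * (\<theta> + 2 * pi)) = cis (of_int k * \<theta>)" for k \<theta>
  proof -
    have "cis (of_int k * (2 * pi)) = 1"
      by (simp add: complex_eq_iff mult.commute[of _ "2*pi"] cos_int_2pin sin_int_2pin)
    then show ?thesis by (simp only: distrib_left flip: cis_mult) simp
  qed
  have "f \<theta> - (S1 \<theta> + S2 \<theta>) = 0"
  proof (rule fourier_coeff_unique[OF _ _ zero])
    show "continuous_on UNIV (\<lambda>\<theta>. f \<theta> - (S1 \<theta> + S2 \<theta>))"
      by (intro continuous_on_diff continuous_on_add c)
    show "f (\<theta> + 2 * pi) - (S1 (\<theta> + 2 * pi) + S2 (\<theta> + 2 * pi)) = f \<theta> - (S1 \<theta> + S2 \<theta>)" for \<theta>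
      by (simp only: S1_def S2_def cisper f(2))
  qed
  then show ?thesis by (simp add: S1_def S2_def)
qed

section \<open>The integrals in the eigenvalues\<close>

text \<open>Kummer's confluent hypergeometric function with parameters \<open>m + 1\<close>,
  \<open>m + 2\<close> at \<open>t * s\<close>, divided by \<open>m + 1\<close>. The integral form
  treats \<open>t = 0\<close> and negative t alike and reduces estimates to estimates of
  integrands.\<close>

definition phi :: "real \<Rightarrow> nat \<Rightarrow> real \<Rightarrow> real" where
  "phi t m s = integral {0..1} (\<lambda>u. u ^ m * exp (t * s * u))"

lemma phi_integrable: "(\<lambda>u::real. u ^ m * exp (t * s * u)) integrable_on {0..1}"
  by (intro integrable_continuous_real continuous_intros)

text \<open>Integrates the u-derivative of \<open>u^(m+1) exp (t s u)\<close> over [0,1]. The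
  left-hand side is what remains of the z-derivative of \<open>z^(m+1) \<phi>_m(s)\<close> after
  removal of \<open>z^m\<close>, so this identity is the reason why the modes solve the
  equation.\<close>

lemma phi_recursion: "(real m + 1) * phi t m s + t * s * phi t (Suc m) s = exp (t * s)"
proof -
  have "((\<lambda>u. (real m + 1) * (u ^ m * exp (t * s * u)) + t * s * (u ^ Suc m * exp (t * s * u)))
      has_integral 1 ^ Suc m * exp (t * s * 1) - 0 ^ Suc m * exp (t * s * 0)) {0..1}"
  proof (intro fundamental_theorem_of_calculus)
    fix u :: real
    show "((\<lambda>u. u ^ Suc m * exp (t * s * u)) has_vector_derivative
        (real m + 1) * (u ^ m * exp (t * s * u)) + t * s * (u ^ Suc m * exp (t * s * u))) (at u within {0..1})"
      unfolding has_real_derivative_iff_has_vector_derivative[symmetric]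
      by (auto intro!: derivative_eq_intros simp del: power_Suc simp: algebra_simps)
  qed simp
  from integral_unique[OF this] show ?thesis
    unfolding phi_def using phi_integrable[of m t s] phi_integrable[of "Suc m" t s]
    by (subst (asm) integral_add) (simp_all only: integrable_on_mult_right integral_mult_right, simp)
qed

lemma phi_deriv: "((phi t m) has_real_derivative t * phi t (Suc m) s) (at s within S)"
proof -
  have "((\<lambda>s. integral (cbox 0 1) (\<lambda>u. u ^ m * exp (t * s * u))) has_vector_derivative
      integral (cbox 0 1) (\<lambda>u. t * (u ^ Suc m * exp (t * s * u)))) (at s within UNIV)"
  proof (rule leibniz_rule_vector_derivative)
    show "((\<lambda>s. u ^ m * exp (t * s * u)) has_vector_derivative t * (u ^ Suc m * exp (t * s * u)))
        (at s within UNIV)" for s u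
      by (auto intro!: derivative_eq_intros simp flip: has_real_derivative_iff_has_vector_derivative)
    show "continuous_on (UNIV \<times> cbox 0 1) (\<lambda>(s, u). t * (u ^ Suc m * exp (t * s * u)))"
      unfolding split_beta by (intro continuous_intros)
  qed (use phi_integrable in auto)
  then have "((phi t m) has_real_derivative t * phi t (Suc m) s) (at s)"
    by (simp add: phi_def[abs_def] has_real_derivative_iff_has_vector_derivative)
  then show ?thesis by (rule has_field_derivative_at_within)
qed

text \<open>The parameters on the two sides are independent, so that comparisons between different
  eigenvalues also reduce to pointwise inequalities.\<close>

lemma phi_mono:
  assumes "\<And>u. u \<in> {0..1} \<Longrightarrow> u ^ m * exp (t * s * u) \<le> c * (u ^ n * exp (t' * s' * u))"
  shows "phi t m s \<le> c * phi t' n s'"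
proof -
  have "phi t m s \<le> integral {0..1} (\<lambda>u. c * (u ^ n * exp (t' * s' * u)))"
    unfolding phi_def
    by (intro integral_le phi_integrable integrable_on_mult_right assms)
  then show ?thesis by (simp add: phi_def)
qed

lemma phi_0: "phi 0 m s = 1 / (real m + 1)"
  using phi_recursion[of m 0 s] by (simp add: field_simps)

text \<open>Comparison with \<open>t = 0\<close>. In the Dirichlet problem Fourier coefficients are
  divided by \<open>phi t m 1\<close>; this bound shows that the division costs only one factor
  \<open>m + 1\<close>.\<close>

lemma phi_lower: "phi t m 1 \<ge> exp (- \<bar>t\<bar>) / (real m + 1)"
proof -
  have "phi 0 m 1 \<le> exp \<bar>t\<bar> * phi t m 1"
  proof (rule phi_mono)
    fix u :: real assume u: "u \<in> {0..1}"
    then have "\<bar>t * u\<bar> \<le> \<bar>t\<bar> * 1" unfolding abs_mult by (intro mult_left_mono) auto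
    then have "0 \<le> \<bar>t\<bar> + t * u" by linarith
    then have "1 \<le> exp \<bar>t\<bar> * exp (t * u)" by (simp flip: exp_add)
    then show "u ^ m * exp (0 * 1 * u) \<le> exp \<bar>t\<bar> * (u ^ m * exp (t * 1 * u))"
      using u mult_left_mono[of 1 "exp \<bar>t\<bar> * exp (t * u)" "u ^ m"] by (simp add: mult_ac)
  qed
  then show ?thesis unfolding phi_0 by (simp add: exp_minus divide_simps mult_ac)
qed

lemma phi_pos: "phi t m 1 > 0"
  by (rule less_le_trans[OF _ phi_lower]) simp

lemma phi_nonneg: "phi t m s \<ge> 0"
  unfolding phi_def by (intro integral_nonneg phi_integrable) auto

lemma phi_upper:
  assumes "0 \<le> s" "s \<le> 1"
  shows "phi t m s \<le> exp \<bar>t\<bar>"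
proof -
  have "phi t m s \<le> exp \<bar>t\<bar> * phi 0 0 0"
  proof (rule phi_mono)
    fix u :: real assume u: "u \<in> {0..1}"
    have "\<bar>s * u\<bar> \<le> 1" using u assms by (simp add: abs_mult mult_le_one)
    then have "t * (s * u) \<le> \<bar>t\<bar> * 1"
      by (metis abs_ge_self abs_ge_zero abs_mult mult_left_mono order_trans)
    then have "u ^ m * exp (t * s * u) \<le> 1 * exp \<bar>t\<bar>"
      using u by (intro mult_mono power_le_one) (auto simp: mult.assoc)
    then show "u ^ m * exp (t * s * u) \<le> exp \<bar>t\<bar> * (u ^ 0 * exp (0 * 0 * u))" by simp
  qed
  then show ?thesis by (simp add: phi_0)
qed

section \<open>Uniqueness: Fourier coefficients along circles\<close>

definition polar :: "real \<Rightarrow> real \<Rightarrow> real^2" where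
  "polar r \<theta> = r *\<^sub>R vector [cos \<theta>, sin \<theta>]"

lemma polar_nth [simp]: "polar r \<theta> $ 1 = r * cos \<theta>" "polar r \<theta> $ 2 = r * sin \<theta>"
  by (simp_all add: polar_def)

lemma cx_polar: "cx (polar r \<theta>) = of_real r * cis \<theta>"
  by (simp add: cx_def complex_eq_iff)

lemma norm_polar: "norm (polar r \<theta>) = \<bar>r\<bar>"
  by (simp add: norm_mult cx_polar flip: norm_cx)

lemma polar_in_disk: "r \<in> {0..1} \<Longrightarrow> polar r \<theta> \<in> unit_disk"
  by (simp add: norm_polar)

lemma polar_eq: "polar r \<theta> = r *\<^sub>R (cos \<theta> *\<^sub>R axis 1 1 + sin \<theta> *\<^sub>R axis 2 1)"
  by (simp add: vec_eq_iff forall_2 axis_def)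

lemma continuous_on_polar: "continuous_on S (\<lambda>(r, \<theta>). polar r \<theta>)"
  unfolding polar_eq split_beta by (intro continuous_intros)

lemma continuous_on_smooth_polar:
  assumes "smooth_on unit_disk g"
  shows "continuous_on ({0..1} \<times> T) (\<lambda>(r, \<theta>). g (polar r \<theta>))"
    and "r \<in> {0..1} \<Longrightarrow> continuous_on T (\<lambda>\<theta>. g (polar r \<theta>))"
proof -
  show *: "continuous_on ({0..1} \<times> T) (\<lambda>(r, \<theta>). g (polar r \<theta>))" for T
    unfolding split_beta
    by (rule continuous_on_compose2[OF smooth_on_imp_continuous_on[OF assms]
          continuous_on_polar[unfolded split_beta]]) (force simp: norm_polar)
  show "continuous_on T (\<lambda>\<theta>. g (polar r \<theta>))" if "r \<in> {0..1}"
  proof -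
    have "Pair r ` T \<subseteq> {0..1} \<times> T" using that by auto
    from continuous_on_compose2[OF *[of T] _ this] show ?thesis
      by (simp add: continuous_on_Pair)
  qed
qed

text \<open>
  The factors \<open>r\<close> avoid the singularity of \<open>\<partial>\<^sub>r \<plusminus> (\<i>/r) \<partial>\<^sub>\<theta>\<close> at the origin.
\<close>

lemma fourier_polar:
  assumes g: "smooth_on unit_disk g" and r: "r \<in> {0..1}"
  obtains D :: complex where
    "((\<lambda>r. fourier_coeff (\<lambda>\<theta>. g (polar r \<theta>)) k) has_vector_derivative D) (at r within {0..1})"
    "r * fourier_coeff (\<lambda>\<theta>. dz g (polar r \<theta>)) (k - 1) = r * D + of_int k * fourier_coeff (\<lambda>\<theta>. g (polar r \<theta>)) k"
    "r * fourier_coeff (\<lambda>\<theta>. dzbar g (polar r \<theta>)) (k + 1) = r * D - of_int k * fourier_coeff (\<lambda>\<theta>. g (polar r \<theta>)) k"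
proof -
  define gx where "gx x = dirderiv unit_disk g x (axis 1 1)" for x
  define gy where "gy x = dirderiv unit_disk g x (axis 2 1)" for x
  have sx: "smooth_on unit_disk gx" and sy: "smooth_on unit_disk gy"
    unfolding gx_def gy_def by (rule smooth_on_dirderiv[OF g])+
  note cx = continuous_on_smooth_polar[OF sx] and cy = continuous_on_smooth_polar[OF sy]
    and cg = continuous_on_smooth_polar[OF g]
  define gr where "gr r \<theta> = of_real (cos \<theta>) * gx (polar r \<theta>) + of_real (sin \<theta>) * gy (polar r \<theta>)" for r \<theta>
  define gt where "gt \<theta> = of_real (- r * sin \<theta>) * gx (polar r \<theta>) + of_real (r * cos \<theta>) * gy (polar r \<theta>)" for \<theta>
  have chain: "((\<lambda>s. g (h s)) has_vector_derivative of_real (v $ 1) * gx (h s) + of_real (v $ 2) * gy (h s))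
      (at s within S)"
    if "(h has_vector_derivative v) (at s within S)" "s \<in> S" "h ` S \<subseteq> unit_disk" for h v s and S :: "real set"
  proof -
    have "(g has_derivative dirderiv unit_disk g (h s)) (at (h s) within h ` S)"
      using smooth_on_has_derivative[OF g] has_derivative_subset that(2,3) by blast
    from vector_derivative_diff_chain_within[OF that(1) this]
    show ?thesis
      using dirderiv_vec2[OF g, of "h s" v] that(2,3) by (auto simp: o_def gx_def gy_def)
  qed
  have der_r: "((\<lambda>r. g (polar r \<theta>)) has_vector_derivative gr r \<theta>) (at r within {0..1})" if "r \<in> {0..1}" for r \<theta>
  proof -
    have "((\<lambda>r. polar r \<theta>) has_vector_derivative polar 1 \<theta>) (at r within {0..1})"
      unfolding polar_eq by (auto intro!: derivative_eq_intros)
    moreover have "(\<lambda>r. polar r \<theta>) ` {0..1} \<subseteq> unit_disk" using polar_in_disk by blast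
    ultimately show ?thesis using chain[OF _ that] by (fastforce simp: gr_def)
  qed
  have der_t: "((\<lambda>\<theta>. g (polar r \<theta>)) has_vector_derivative gt \<theta>) (at \<theta> within T)" if "\<theta> \<in> T" for \<theta> T
  proof -
    have "((\<lambda>\<theta>. polar r \<theta>) has_vector_derivative r *\<^sub>R (- sin \<theta> *\<^sub>R axis 1 1 + cos \<theta> *\<^sub>R axis 2 1)) (at \<theta> within T)"
      unfolding polar_eq
      by (auto intro!: derivative_eq_intros simp flip: has_real_derivative_iff_has_vector_derivative)
    moreover have "(\<lambda>\<theta>. polar r \<theta>) ` T \<subseteq> unit_disk" using polar_in_disk[OF r] by blast
    ultimately show ?thesis using chain[OF _ that] by (fastforce simp: gt_def axis_def)
  qed
  have cgr: "continuous_on {0..2*pi} (gr r)" and cgt: "continuous_on {0..2*pi} gt"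
    unfolding gr_def gt_def by (intro continuous_intros cx(2) cy(2) r)+
  have D: "((\<lambda>r. fourier_coeff (\<lambda>\<theta>. g (polar r \<theta>)) k) has_vector_derivative fourier_coeff (gr r) k)
      (at r within {0..1})"
  proof -
    have "((\<lambda>r. integral (cbox 0 (2*pi)) (\<lambda>\<theta>. g (polar r \<theta>) * cis (- (of_int k * \<theta>)))) has_vector_derivative
      integral (cbox 0 (2*pi)) (\<lambda>\<theta>. gr r \<theta> * cis (- (of_int k * \<theta>)))) (at r within {0..1})"
    proof (rule leibniz_rule_vector_derivative)
      show "((\<lambda>r. g (polar r \<theta>) * cis (- (of_int k * \<theta>))) has_vector_derivative
          gr r \<theta> * cis (- (of_int k * \<theta>))) (at r within {0..1})" if "r \<in> {0..1}" for r \<theta>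
        by (intro has_vector_derivative_mult_left der_r that)
      show "(\<lambda>\<theta>. g (polar r \<theta>) * cis (- (of_int k * \<theta>))) integrable_on cbox 0 (2*pi)" if "r \<in> {0..1}" for r
        using integrable_fourier[OF cg(2)[OF that]] by simp
      show "continuous_on ({0..1} \<times> cbox 0 (2*pi)) (\<lambda>(r, \<theta>). gr r \<theta> * cis (- (of_int k * \<theta>)))"
        using cx(1) cy(1) unfolding gr_def split_beta by (intro continuous_intros) auto
    qed (use r in auto)
    then show ?thesis
      unfolding fourier_coeff_def by (intro has_vector_derivative_mult_right) simp
  qed
  have T: "fourier_coeff gt k = \<i> * of_int k * fourier_coeff (\<lambda>\<theta>. g (polar r \<theta>)) k"
    by (rule fourier_coeff_deriv[OF der_t cgt]) (simp_all add: polar_def)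
  \<comment> \<open>Polar form of the Wirtinger derivatives; the factor \<open>cis\<close> is what
    moves the Fourier index by one in the conclusions.\<close>
  have e1: "r * (dz g (polar r \<theta>) * cis (of_int 1 * \<theta>)) = r * gr r \<theta> + (- \<i>) * gt \<theta>" for \<theta>
    by (simp add: dz_def gr_def gt_def cis.code gx_def[symmetric] gy_def[symmetric] complex_eq_iff algebra_simps)
  have e2: "r * (dzbar g (polar r \<theta>) * cis (of_int (- 1) * \<theta>)) = r * gr r \<theta> + \<i> * gt \<theta>" for \<theta>
    by (simp add: dzbar_def gr_def gt_def cis.code gx_def[symmetric] gy_def[symmetric] complex_eq_iff algebra_simps)
  have s: "fourier_coeff (\<lambda>\<theta>. r * gr r \<theta> + c * gt \<theta>) k
      = r * fourier_coeff (gr r) k + c * fourier_coeff gt k" for c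
    by (subst fourier_coeff_add) (simp_all add: cgr cgt continuous_on_mult_left fourier_coeff_cmult)
  show thesis
  proof (rule that[OF D])
    have "r * fourier_coeff (\<lambda>\<theta>. dz g (polar r \<theta>)) (k - 1)
        = fourier_coeff (\<lambda>\<theta>. r * gr r \<theta> + (- \<i>) * gt \<theta>) k"
      unfolding e1[symmetric] fourier_coeff_cmult fourier_coeff_shift ..
    then show "r * fourier_coeff (\<lambda>\<theta>. dz g (polar r \<theta>)) (k - 1)
        = r * fourier_coeff (gr r) k + of_int k * fourier_coeff (\<lambda>\<theta>. g (polar r \<theta>)) k"
      unfolding s T by (simp add: algebra_simps)
    have "r * fourier_coeff (\<lambda>\<theta>. dzbar g (polar r \<theta>)) (k - (- 1))
        = fourier_coeff (\<lambda>\<theta>. r * gr r \<theta> + \<i> * gt \<theta>) k"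
      unfolding e2[symmetric] fourier_coeff_cmult fourier_coeff_shift ..
    then show "r * fourier_coeff (\<lambda>\<theta>. dzbar g (polar r \<theta>)) (k + 1)
        = r * fourier_coeff (gr r) k - of_int k * fourier_coeff (\<lambda>\<theta>. g (polar r \<theta>)) k"
      unfolding s T by (simp add: algebra_simps)
  qed
qed

text \<open>The potential terms \<open>t z'\<close> and \<open>- t z\<close> shift the Fourier index
  in the same direction as the derivative they accompany, so their whole effect is to replace k by
  \<open>k + t r^2\<close>.\<close>

lemma fourier_polar_mag:
  assumes g: "smooth_on unit_disk g" and r: "r \<in> {0..1}"
  obtains D :: complex where
    "((\<lambda>r. fourier_coeff (\<lambda>\<theta>. g (polar r \<theta>)) k) has_vector_derivative D) (at r within {0..1})"
    "r * fourier_coeff (\<lambda>\<theta>. mag_dz t g (polar r \<theta>)) (k - 1)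
       = r * D + of_real (of_int k + t * r ^ 2) * fourier_coeff (\<lambda>\<theta>. g (polar r \<theta>)) k"
    "r * fourier_coeff (\<lambda>\<theta>. mag_dzbar t g (polar r \<theta>)) (k + 1)
       = r * D - of_real (of_int k + t * r ^ 2) * fourier_coeff (\<lambda>\<theta>. g (polar r \<theta>)) k"
proof -
  obtain D :: complex where D: "((\<lambda>r. fourier_coeff (\<lambda>\<theta>. g (polar r \<theta>)) k) has_vector_derivative D) (at r within {0..1})"
    "r * fourier_coeff (\<lambda>\<theta>. dz g (polar r \<theta>)) (k - 1) = r * D + of_int k * fourier_coeff (\<lambda>\<theta>. g (polar r \<theta>)) k"
    "r * fourier_coeff (\<lambda>\<theta>. dzbar g (polar r \<theta>)) (k + 1) = r * D - of_int k * fourier_coeff (\<lambda>\<theta>. g (polar r \<theta>)) k"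
    by (rule fourier_polar[OF g r])
  note c = continuous_on_smooth_polar(2)[OF g r] continuous_on_smooth_polar(2)[OF smooth_on_dz[OF g] r]
    continuous_on_smooth_polar(2)[OF smooth_on_dzbar[OF g] r]
  have c': "continuous_on T (\<lambda>\<theta>. c * (g (polar r \<theta>) * cis (of_int j * \<theta>)))" for T c j
    by (intro continuous_intros c)
  have e1: "mag_dz t g (polar r \<theta>)
      = dz g (polar r \<theta>) + of_real (t * r) * (g (polar r \<theta>) * cis (of_int (- 1) * \<theta>))" for \<theta>
    by (simp add: mag_dz_def cx_polar cis_cnj)
  have e2: "mag_dzbar t g (polar r \<theta>)
      = dzbar g (polar r \<theta>) + (- of_real (t * r)) * (g (polar r \<theta>) * cis (of_int 1 * \<theta>))" for \<theta>
    by (simp add: mag_dzbar_def cx_polar)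
  have f1: "fourier_coeff (\<lambda>\<theta>. mag_dz t g (polar r \<theta>)) (k - 1)
      = fourier_coeff (\<lambda>\<theta>. dz g (polar r \<theta>)) (k - 1) + of_real (t * r) * fourier_coeff (\<lambda>\<theta>. g (polar r \<theta>)) k"
    unfolding e1 fourier_coeff_add[OF c(2) c'] fourier_coeff_cmult fourier_coeff_shift by simp
  have f2: "fourier_coeff (\<lambda>\<theta>. mag_dzbar t g (polar r \<theta>)) (k + 1)
      = fourier_coeff (\<lambda>\<theta>. dzbar g (polar r \<theta>)) (k + 1) - of_real (t * r) * fourier_coeff (\<lambda>\<theta>. g (polar r \<theta>)) k"
    unfolding e2 fourier_coeff_add[OF c(3) c'] fourier_coeff_cmult fourier_coeff_shift by simp
  show thesis
  proof (rule that[OF D(1)])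
    show "r * fourier_coeff (\<lambda>\<theta>. mag_dz t g (polar r \<theta>)) (k - 1)
       = r * D + of_real (of_int k + t * r ^ 2) * fourier_coeff (\<lambda>\<theta>. g (polar r \<theta>)) k"
      unfolding f1 of_real_add of_real_mult of_real_power of_real_of_int_eq using D(2) by algebra
    show "r * fourier_coeff (\<lambda>\<theta>. mag_dzbar t g (polar r \<theta>)) (k + 1)
       = r * D - of_real (of_int k + t * r ^ 2) * fourier_coeff (\<lambda>\<theta>. g (polar r \<theta>)) k"
      unfolding f2 of_real_add of_real_mult of_real_power of_real_of_int_eq using D(3) by algebra
  qed
qed

section \<open>The radial differential equations\<close>

lemma zero_vector_derivative_const:
  fixes V :: "real \<Rightarrow> complex"
  assumes "\<And>r. r \<in> {0..1} \<Longrightarrow> (V has_vector_derivative 0) (at r within {0..1})"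
  shows "V 1 = V 0"
proof -
  have "\<exists>c. \<forall>x\<in>{0..1}. V x = c"
    by (rule has_derivative_zero_constant) (use assms in \<open>auto simp: has_vector_derivative_def\<close>)
  then show ?thesis by auto
qed

text \<open>Let A be the coefficient of p of index \<open>l + 1\<close> and H that of
  \<open>D' p\<close> of index l. Then \<open>r H' = (l + t r^2) H\<close> and
  \<open>r A' = r H - (l + 1 + t r^2) A\<close>. Suitable combinations of A and H are constant in r
  and vanish at \<open>r = 0\<close>, where regularity at the origin enters; their value at
  \<open>r = 1\<close> gives the claims. Each weight carries a power of r that can be spent on the
  factor r in front of the derivatives.\<close>

lemma fourier_mag_dz_boundary:
  assumes p: "smooth_on unit_disk p"
    and eq: "\<And>x. x \<in> unit_disk \<Longrightarrow> mag_dzbar t (mag_dz t p) x = 0"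
  shows "of_real (phi t m 1) * fourier_coeff (\<lambda>\<theta>. mag_dz t p (polar 1 \<theta>)) (int m)
          = of_real (2 * exp t) * fourier_coeff (\<lambda>\<theta>. p (polar 1 \<theta>)) (int m + 1)"
    and "l < 0 \<Longrightarrow> fourier_coeff (\<lambda>\<theta>. mag_dz t p (polar 1 \<theta>)) l = 0"
proof -
  let ?P = "mag_dz t p"
  have P: "smooth_on unit_disk ?P" by (rule smooth_on_mag_dz[OF p])
  define A where "A k r = fourier_coeff (\<lambda>\<theta>. p (polar r \<theta>)) k" for k and r :: real
  define H where "H l r = fourier_coeff (\<lambda>\<theta>. ?P (polar r \<theta>)) l" for l r
  have zero: "fourier_coeff (\<lambda>\<theta>. mag_dzbar t ?P (polar r \<theta>)) l = 0" if r: "r \<in> {0..1}" for r :: real and l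
    using eq polar_in_disk[OF r] by (simp add: fourier_coeff_def)
  have A: "\<exists>D::complex. (A (l + 1) has_vector_derivative D) (at r within {0..1}) \<and>
      r * D = r * H l r - of_real (of_int l + 1 + t * r ^ 2) * A (l + 1) r" if r: "r \<in> {0..1}" for l and r :: real
  proof -
    obtain D :: complex where "(A (l + 1) has_vector_derivative D) (at r within {0..1})"
      "r * H (l + 1 - 1) r = r * D + of_real (of_int (l + 1) + t * r ^ 2) * A (l + 1) r"
      using fourier_polar_mag[OF p r, of "l + 1" t] unfolding A_def[abs_def] H_def by metis
    then show ?thesis by (intro exI[of _ D]) simp
  qed
  have H: "\<exists>D::complex. (H l has_vector_derivative D) (at r within {0..1}) \<and>
      r * D = of_real (of_int l + t * r ^ 2) * H l r" if r: "r \<in> {0..1}" for l and r :: real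
  proof -
    obtain D :: complex where "(H l has_vector_derivative D) (at r within {0..1})"
      "r * fourier_coeff (\<lambda>\<theta>. mag_dzbar t ?P (polar r \<theta>)) (l + 1) = r * D - of_real (of_int l + t * r ^ 2) * H l r"
      using fourier_polar_mag[OF P r, of l t] unfolding H_def[abs_def] by metis
    then show ?thesis unfolding zero[OF r] by (intro exI[of _ D]) simp
  qed
  show "fourier_coeff (\<lambda>\<theta>. ?P (polar 1 \<theta>)) l = 0" if "l < 0"
  proof -
    obtain j where j: "l = - int (Suc j)" using \<open>l < 0\<close> negD by blast
    \<comment> \<open>The weight is the reciprocal of the radial solution
      \<open>r^l exp (t r^2 / 2)\<close>, which is singular at 0 for negative l; the weight vanishes
      there.\<close>
    define W where "W r = of_real (r ^ Suc j * exp (- t * r ^ 2 / 2)) * H l r" for r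
    have "(W has_vector_derivative 0) (at r within {0..1})" if r: "r \<in> {0..1}" for r
    proof -
      obtain D :: complex where D: "(H l has_vector_derivative D) (at r within {0..1})"
        "r * D = of_real (of_int l + t * r ^ 2) * H l r"
        using H[OF r] by blast
      have "((\<lambda>r. r ^ Suc j * exp (- t * r ^ 2 / 2)) has_real_derivative
          (real j + 1 - t * r ^ 2) * (r ^ j * exp (- t * r ^ 2 / 2))) (at r within {0..1})"
        by (auto intro!: derivative_eq_intros simp del: power_Suc simp: algebra_simps power2_eq_square) simp
      from has_vector_derivative_mult[OF has_vector_derivative_of_real[OF this] D(1)]
      have "(W has_vector_derivative of_real (r ^ Suc j * exp (- t * r ^ 2 / 2)) * D
          + of_real ((real j + 1 - t * r ^ 2) * (r ^ j * exp (- t * r ^ 2 / 2))) * H l r) (at r within {0..1})"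
        unfolding W_def[abs_def] .
      moreover have "of_real (r ^ Suc j * exp (- t * r ^ 2 / 2)) * D
          = of_real (r ^ j * exp (- t * r ^ 2 / 2)) * (r * D)"
        by simp
      ultimately show ?thesis unfolding D(2) j by (simp add: algebra_simps)
    qed
    from zero_vector_derivative_const[of W, OF this] show ?thesis by (simp add: W_def H_def)
  qed
  let ?l = "int m"
  \<comment> \<open>The Wronskian-like combination of the solution with the explicit mode is constant in \<open>r\<close>.\<close>
  define V where "V r = of_real (2 * (r ^ Suc m * exp (t * r ^ 2 / 2))) * A (?l + 1) r
     - of_real (r ^ Suc (Suc m) * (exp (- t * r ^ 2 / 2) * phi t m (r ^ 2))) * H ?l r" for r
  have "(V has_vector_derivative 0) (at r within {0..1})" if r: "r \<in> {0..1}" for r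
  proof -
    obtain D1 :: complex where D1: "(A (?l + 1) has_vector_derivative D1) (at r within {0..1})"
      "r * D1 = r * H ?l r - of_real (of_int ?l + 1 + t * r ^ 2) * A (?l + 1) r"
      using A[OF r] by blast
    obtain D2 :: complex where D2: "(H ?l has_vector_derivative D2) (at r within {0..1})"
      "r * D2 = of_real (of_int ?l + t * r ^ 2) * H ?l r"
      using H[OF r] by blast
    let ?e = "exp (t * r ^ 2 / 2)" and ?e' = "exp (- t * r ^ 2 / 2)"
    have d1: "((\<lambda>r. 2 * (r ^ Suc m * exp (t * r ^ 2 / 2))) has_real_derivative
        2 * (real m + 1 + t * r ^ 2) * (r ^ m * ?e)) (at r within {0..1})"
      by (auto intro!: derivative_eq_intros simp del: power_Suc simp: algebra_simps power2_eq_square) simp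
    have d2: "((\<lambda>r. r ^ Suc (Suc m) * (exp (- t * r ^ 2 / 2) * phi t m (r ^ 2))) has_real_derivative
        ((real m + 2 - t * r ^ 2) * phi t m (r ^ 2) + 2 * r ^ 2 * (t * phi t (Suc m) (r ^ 2)))
          * (r ^ Suc m * ?e')) (at r within {0..1})"
      by (auto intro!: derivative_eq_intros DERIV_chain2[OF phi_deriv]
          simp del: power_Suc simp: algebra_simps power2_eq_square)
        (simp add: algebra_simps)
    have "(V has_vector_derivative
        (of_real (2 * (r ^ Suc m * ?e)) * D1
           + of_real (2 * (real m + 1 + t * r ^ 2) * (r ^ m * ?e)) * A (?l + 1) r)
        - (of_real (r ^ Suc (Suc m) * (?e' * phi t m (r ^ 2))) * D2
           + of_real (((real m + 2 - t * r ^ 2) * phi t m (r ^ 2) + 2 * r ^ 2 * (t * phi t (Suc m) (r ^ 2)))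
               * (r ^ Suc m * ?e')) * H ?l r)) (at r within {0..1})"
      unfolding V_def[abs_def]
      by (intro has_vector_derivative_diff has_vector_derivative_mult has_vector_derivative_of_real d1 d2 D1 D2)
    \<comment> \<open>Both halves of the derivative of V equal
      \<open>2 r^(m+1) exp (t r^2 / 2)\<close> times H, the second one by
      \<open>phi_recursion\<close>, and therefore cancel.\<close>
    moreover have "of_real (2 * (r ^ Suc m * ?e)) * D1
        + of_real (2 * (real m + 1 + t * r ^ 2) * (r ^ m * ?e)) * A (?l + 1) r
        = of_real (2 * r ^ Suc m * ?e) * H ?l r"
    proof -
      have "of_real (2 * (r ^ Suc m * ?e)) * D1 = of_real (2 * (r ^ m * ?e)) * (r * D1)" by simp
      then show ?thesis unfolding D1(2) by (simp add: algebra_simps)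
    qed
    moreover have "of_real (r ^ Suc (Suc m) * (?e' * phi t m (r ^ 2))) * D2
        + of_real (((real m + 2 - t * r ^ 2) * phi t m (r ^ 2) + 2 * r ^ 2 * (t * phi t (Suc m) (r ^ 2)))
               * (r ^ Suc m * ?e')) * H ?l r = of_real (2 * r ^ Suc m * ?e) * H ?l r"
    proof -
      have "of_real (r ^ Suc (Suc m) * (?e' * phi t m (r ^ 2))) * D2
          = of_real (r ^ Suc m * (?e' * phi t m (r ^ 2))) * (r * D2)" by simp
      also have "\<dots> = of_real ((real m + t * r ^ 2) * phi t m (r ^ 2) * (r ^ Suc m * ?e')) * H ?l r"
        unfolding D2(2) by simp
      finally have "of_real (r ^ Suc (Suc m) * (?e' * phi t m (r ^ 2))) * D2
        + of_real (((real m + 2 - t * r ^ 2) * phi t m (r ^ 2) + 2 * r ^ 2 * (t * phi t (Suc m) (r ^ 2)))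
               * (r ^ Suc m * ?e')) * H ?l r
        = of_real ((2 * ((real m + 1) * phi t m (r ^ 2) + t * r ^ 2 * phi t (Suc m) (r ^ 2)))
               * (r ^ Suc m * ?e')) * H ?l r"
        by (simp add: algebra_simps)
      also have "(2 * ((real m + 1) * phi t m (r ^ 2) + t * r ^ 2 * phi t (Suc m) (r ^ 2))) * (r ^ Suc m * ?e')
          = 2 * r ^ Suc m * (exp (t * r ^ 2) * ?e')"
        unfolding phi_recursion by (simp only: mult_ac)
      also have "exp (t * r ^ 2) * ?e' = ?e" by (simp flip: exp_add)
      finally show ?thesis .
    qed
    ultimately show ?thesis by simp
  qed
  \<comment> \<open>The powers of r in V give \<open>V 0 = 0\<close>.\<close>
  from zero_vector_derivative_const[of V, OF this]
  have "of_real (2 * exp (t / 2)) * A (?l + 1) 1 = of_real (exp (- t / 2) * phi t m 1) * H ?l 1"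
    by (simp add: V_def)
  then have "of_real (exp (t / 2) * (2 * exp (t / 2))) * A (?l + 1) 1
      = of_real (exp (t / 2) * (exp (- t / 2) * phi t m 1)) * H ?l 1"
    unfolding of_real_mult[of "exp (t / 2)"] mult.assoc by simp
  moreover have "exp (t / 2) * (2 * exp (t / 2)) = 2 * exp t"
    by (simp add: mult.left_commute flip: exp_add)
  moreover have "exp (t / 2) * (exp (- t / 2) * phi t m 1) = phi t m 1"
    unfolding mult.assoc[symmetric] exp_add[symmetric] by simp
  ultimately show "of_real (phi t m 1) * fourier_coeff (\<lambda>\<theta>. ?P (polar 1 \<theta>)) (int m)
          = of_real (2 * exp t) * fourier_coeff (\<lambda>\<theta>. p (polar 1 \<theta>)) (int m + 1)"
    unfolding A_def H_def by (simp only:)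
qed

section \<open>Existence: series of modes\<close>

text \<open>Weierstrass test for termwise differentiation: one summable sequence B dominates values
  and derivatives, and its tails make the derivative series converge uniformly.\<close>

lemma has_derivative_suminf:
  fixes f :: "nat \<Rightarrow> 'a::real_normed_vector \<Rightarrow> 'b::banach"
  assumes S: "convex S"
    and der: "\<And>n x. x \<in> S \<Longrightarrow> (f n has_derivative f' n x) (at x within S)"
    and bf: "\<And>n x. x \<in> S \<Longrightarrow> norm (f n x) \<le> B n"
    and bf': "\<And>n x h. x \<in> S \<Longrightarrow> norm (f' n x h) \<le> B n * norm h"
    and B: "summable B" and x: "x \<in> S"
  shows "((\<lambda>x. \<Sum>n. f n x) has_derivative (\<lambda>h. \<Sum>n. f' n x h)) (at x within S)"
proof -
  have sf: "summable (\<lambda>n. f n x)" if "x \<in> S" for x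
    by (rule summable_comparison_test'[OF B]) (use bf that in auto)
  have Bh: "summable (\<lambda>n. B n * norm h)" for h :: 'a by (rule summable_mult2[OF B])
  have sf': "summable (\<lambda>n. f' n x h)" if "x \<in> S" for x h
    by (rule summable_comparison_test'[OF Bh[of h]]) (use bf' that in auto)
  have "\<exists>g. \<forall>x\<in>S. (\<lambda>n. f n x) sums g x \<and> (g has_derivative (\<lambda>h. \<Sum>n. f' n x h)) (at x within S)"
  proof (rule has_derivative_series[OF S der _ x summable_sums[OF sf[OF x]]])
    fix e :: real assume "e > 0"
    obtain N where N: "\<And>n. n \<ge> N \<Longrightarrow> norm (\<Sum>i. B (i + n)) < e"
      using suminf_exist_split[OF \<open>e > 0\<close> B] by blast
    show "\<forall>\<^sub>F n in sequentially. \<forall>x\<in>S. \<forall>h. norm ((\<Sum>i<n. f' i x h) - (\<Sum>n. f' n x h)) \<le> e * norm h"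
      unfolding eventually_sequentially
    proof (intro exI[of _ N] allI impI ballI)
      fix n x h assume "N \<le> n" "x \<in> S"
      have "norm ((\<Sum>i<n. f' i x h) - (\<Sum>n. f' n x h)) = norm (\<Sum>i. f' (i + n) x h)"
        using suminf_split_initial_segment[OF sf'[OF \<open>x \<in> S\<close>, of h], of n]
        by (simp add: norm_minus_commute)
      also have "\<dots> \<le> (\<Sum>i. B (i + n) * norm h)"
        using Bh[of h] bf'[OF \<open>x \<in> S\<close>]
        by (intro norm_suminf_le) (auto simp: summable_iff_shift[of "\<lambda>i. B i * norm h"])
      also have "\<dots> = (\<Sum>i. B (i + n)) * norm h"
        using B by (intro suminf_mult2[symmetric]) (simp add: summable_iff_shift)
      also have "\<dots> \<le> e * norm h" using N[OF \<open>N \<le> n\<close>] by (intro mult_right_mono) auto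
      finally show "norm ((\<Sum>i<n. f' i x h) - (\<Sum>n. f' n x h)) \<le> e * norm h" .
    qed
  qed
  then obtain g where g: "\<And>x. x \<in> S \<Longrightarrow> (\<lambda>n. f n x) sums g x"
    "\<And>x. x \<in> S \<Longrightarrow> (g has_derivative (\<lambda>h. \<Sum>n. f' n x h)) (at x within S)" by blast
  show ?thesis
    by (rule has_derivative_transform[OF x _ g(2)[OF x]]) (use g(1) in \<open>simp add: sums_iff\<close>)
qed

text \<open>Differentiation in z lowers p in one term and raises q and m in the other. Three
  independent exponents are what makes the family closed under differentiation. At
  \<open>t = 0\<close> and \<open>m = 0\<close> it consists of the plain monomials in z and
  z'.\<close>

definition mode :: "real \<Rightarrow> nat \<Rightarrow> nat \<Rightarrow> nat \<Rightarrow> real^2 \<Rightarrow> complex" where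
  "mode t p q m x = cx x ^ p * cnj (cx x) ^ q * of_real (phi t m (x \<bullet> x))"

lemma cx_mult_cnj: "cx x * cnj (cx x) = of_real (x \<bullet> x)"
  by (simp add: cx_def complex_eq_iff inner_vec_def UNIV_2)

lemma cx_inner: "2 * of_real (x \<bullet> v) = cx v * cnj (cx x) + cnj (cx v) * cx x"
  by (simp add: cx_def complex_eq_iff inner_vec_def UNIV_2 algebra_simps)

text \<open>Truncated subtraction is harmless: at \<open>p = 0\<close> or \<open>q = 0\<close> the
  factor \<open>of_nat\<close> removes the term.\<close>

lemma mode_has_derivative:
  "(mode t p q m has_derivative
    (\<lambda>v. cx v * (of_nat p * mode t (p - 1) q m x + of_real t * mode t p (q + 1) (m + 1) x)
       + cnj (cx v) * (of_nat q * mode t p (q - 1) m x + of_real t * mode t (p + 1) q (m + 1) x)))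
   (at x within S)"
proof -
  have d: "((\<lambda>x. phi t m (x \<bullet> x)) has_derivative (\<lambda>v. t * phi t (Suc m) (x \<bullet> x) * (2 * (x \<bullet> v)))) (at x within S)"
  proof -
    have "((\<lambda>x. x \<bullet> x) has_derivative (\<lambda>v. 2 * (x \<bullet> v))) (at x within S)"
      by (auto intro!: derivative_eq_intros simp: inner_commute)
    from has_derivative_compose[OF this phi_deriv[of t m "x \<bullet> x" UNIV, unfolded has_field_derivative_def]]
    show ?thesis by simp
  qed
  have c: "(cx has_derivative cx) (at x within S)" "((\<lambda>x. cnj (cx x)) has_derivative (\<lambda>x. cnj (cx x))) (at x within S)"
    by (auto intro!: bounded_linear_imp_has_derivative bounded_linear_cx bounded_linear_compose[OF bounded_linear_cnj])
  have e: "of_real (t * phi t (Suc m) (x \<bullet> x) * (2 * (x \<bullet> v)))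
      = of_real t * of_real (phi t (Suc m) (x \<bullet> x)) * (cx v * cnj (cx x) + cnj (cx v) * cx x)" for v
    unfolding cx_inner[symmetric] by simp
  show ?thesis
    unfolding mode_def[abs_def]
    by (rule has_derivative_eq_rhs[OF has_derivative_mult[OF has_derivative_mult[OF
          has_derivative_power[OF c(1)] has_derivative_power[OF c(2)]] has_derivative_of_real[OF d]]])
      (rule ext, simp only: e, simp add: algebra_simps)
qed

lemma norm_mode_le:
  assumes "x \<in> unit_disk"
  shows "norm (mode t p q m x) \<le> exp \<bar>t\<bar>"
proof -
  have n: "norm x \<le> 1" using assms by simp
  have "x \<bullet> x \<le> 1" using n by (simp add: dot_square_norm power_le_one)
  then have "phi t m (x \<bullet> x) \<le> exp \<bar>t\<bar>" by (intro phi_upper) auto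
  then have "norm (mode t p q m x) \<le> 1 * 1 * exp \<bar>t\<bar>"
    unfolding mode_def norm_mult norm_power using n
    by (intro mult_mono power_le_one) (auto simp: phi_nonneg)
  then show ?thesis by simp
qed

text \<open>
  Series of modes with rapidly decreasing coefficients are closed under differentiation, hence
  smooth up to the boundary.  For \<open>t = 0\<close> they contain the power series in \<open>z\<close> and in its conjugate.
\<close>

definition series :: "real \<Rightarrow> (nat \<Rightarrow> complex) \<Rightarrow> (nat \<Rightarrow> nat) \<Rightarrow> (nat \<Rightarrow> nat) \<Rightarrow> (nat \<Rightarrow> nat) \<Rightarrow> real^2 \<Rightarrow> complex" where
  "series t c p q m x = (\<Sum>n. c n * mode t (p n) (q n) (m n) x)"

text \<open>Decay is measured against the degree \<open>p n + q n\<close>, since differentiation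
  multiplies the n-th coefficient by \<open>p n\<close> or \<open>q n\<close>. Requiring all powers
  N makes the condition survive arbitrarily many derivatives.\<close>

definition rapid :: "(nat \<Rightarrow> complex) \<Rightarrow> (nat \<Rightarrow> nat) \<Rightarrow> (nat \<Rightarrow> nat) \<Rightarrow> bool" where
  "rapid c p q \<longleftrightarrow> (\<forall>N. summable (\<lambda>n. norm (c n) * (real (p n + q n) + 1) ^ N))"

text \<open>The effect of one differentiation: the coefficient grows by at most the weight and the
  degree by at most one. The former spends one power of the weight, the latter the factor
  \<open>2 ^ N\<close>.\<close>

lemma rapid_weaken:
  assumes "rapid c p q"
    and "\<And>n. norm (c' n) \<le> norm (c n) * (real (p n + q n) + 1)"
    and "\<And>n. p' n + q' n \<le> p n + q n + 1"
  shows "rapid c' p' q'"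
  unfolding rapid_def
proof
  fix N
  have "summable (\<lambda>n. 2 ^ N * (norm (c n) * (real (p n + q n) + 1) ^ Suc N))"
    using assms(1) unfolding rapid_def by (intro summable_mult) blast
  then show "summable (\<lambda>n. norm (c' n) * (real (p' n + q' n) + 1) ^ N)"
  proof (rule summable_comparison_test')
    fix n
    have "real (p' n + q' n) \<le> real (p n + q n + 1)" using assms(3)[of n] by (rule of_nat_mono)
    then have "(real (p' n + q' n) + 1) ^ N \<le> (2 * (real (p n + q n) + 1)) ^ N"
      by (intro power_mono) auto
    then have "norm (c' n) * (real (p' n + q' n) + 1) ^ N
        \<le> (norm (c n) * (real (p n + q n) + 1)) * (2 * (real (p n + q n) + 1)) ^ N"
      using assms(2)[of n] by (intro mult_mono) auto
    also have "\<dots> = 2 ^ N * (norm (c n) * (real (p n + q n) + 1) ^ Suc N)"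
      by (simp only: power_mult_distrib power_Suc mult_ac)
    finally show "norm (norm (c' n) * (real (p' n + q' n) + 1) ^ N)
        \<le> 2 ^ N * (norm (c n) * (real (p n + q n) + 1) ^ Suc N)" by simp
  qed
qed

lemma rapid_derivative:
  assumes "rapid c p q"
  shows "rapid (\<lambda>n. c n * of_nat (p n)) (\<lambda>n. p n - 1) q"
    "rapid (\<lambda>n. c n * of_nat (q n)) p (\<lambda>n. q n - 1)"
    "rapid c (\<lambda>n. p n + 1) q" "rapid c p (\<lambda>n. q n + 1)"
  by (rule rapid_weaken[OF assms]; simp add: norm_mult mult_left_mono mult_le_cancel_left1)+

lemma rapid_sums:
  assumes "rapid c p q" "x \<in> unit_disk"
  shows "(\<lambda>n. c n * mode t (p' n) (q' n) (m n) x) sums series t c p' q' m x"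
proof -
  have "summable (\<lambda>n. norm (c n) * (real (p n + q n) + 1) ^ 0)"
    using assms(1) unfolding rapid_def by blast
  then have "summable (\<lambda>n. norm (c n) * exp \<bar>t\<bar>)" by (intro summable_mult2) simp
  then have "summable (\<lambda>n. c n * mode t (p' n) (q' n) (m n) x)"
    by (rule summable_comparison_test') (simp add: norm_mult mult_left_mono norm_mode_le[OF assms(2)])
  then show ?thesis unfolding series_def by (rule summable_sums)
qed

lemma series_has_derivative:
  assumes c: "rapid c p q" and x: "x \<in> unit_disk"
  shows "(series t c p q m has_derivative
    (\<lambda>v. cx v * (series t (\<lambda>n. c n * of_nat (p n)) (\<lambda>n. p n - 1) q m x
                   + of_real t * series t c p (\<lambda>n. q n + 1) (\<lambda>n. m n + 1) x)
       + cnj (cx v) * (series t (\<lambda>n. c n * of_nat (q n)) p (\<lambda>n. q n - 1) m x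
                   + of_real t * series t c (\<lambda>n. p n + 1) q (\<lambda>n. m n + 1) x)))
   (at x within unit_disk)"
proof -
  define a where "a n x = of_nat (p n) * mode t (p n - 1) (q n) (m n) x
      + of_real t * mode t (p n) (q n + 1) (m n + 1) x" for n x
  define b where "b n x = of_nat (q n) * mode t (p n) (q n - 1) (m n) x
      + of_real t * mode t (p n + 1) (q n) (m n + 1) x" for n x
  \<comment> \<open>Bounds a mode and its derivative after the degree has been split off; each of
    the two Wirtinger parts contributes one
    \<open>\<bar>t\<bar> * exp \<bar>t\<bar>\<close>.\<close>
  define K where "K = exp \<bar>t\<bar> * (1 + 2 * \<bar>t\<bar>)"
  define B where "B n = norm (c n) * (real (p n + q n) + 1) ^ 1 * K" for n
  have K: "exp \<bar>t\<bar> \<le> K" by (simp add: K_def)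
  have der: "((\<lambda>x. c n * mode t (p n) (q n) (m n) x) has_derivative
      (\<lambda>v. c n * (cx v * a n x + cnj (cx v) * b n x))) (at x within unit_disk)" for n x
    unfolding a_def b_def by (intro has_derivative_mult_right mode_has_derivative)
  have "((\<lambda>x. \<Sum>n. c n * mode t (p n) (q n) (m n) x) has_derivative
      (\<lambda>v. \<Sum>n. c n * (cx v * a n x + cnj (cx v) * b n x))) (at x within unit_disk)"
  proof (rule has_derivative_suminf[OF convex_cball der _ _ _ x])
    show "summable B"
      using c unfolding rapid_def B_def by (intro summable_mult2) blast
  next
    fix n and x :: "real^2" assume x: "x \<in> unit_disk"
    have "norm (c n * mode t (p n) (q n) (m n) x) \<le> norm (c n) * (1 * K)"
      unfolding norm_mult using order_trans[OF norm_mode_le[OF x] K] by (intro mult_left_mono) auto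
    also have "\<dots> \<le> norm (c n) * ((real (p n + q n) + 1) ^ 1 * K)"
      using K by (intro mult_left_mono mult_right_mono) (auto intro: order_trans[OF exp_ge_zero])
    finally show "norm (c n * mode t (p n) (q n) (m n) x) \<le> B n" by (simp add: B_def mult.assoc)
    fix v
    have a: "norm (a n x) \<le> real (p n) * exp \<bar>t\<bar> + \<bar>t\<bar> * exp \<bar>t\<bar>"
      and b: "norm (b n x) \<le> real (q n) * exp \<bar>t\<bar> + \<bar>t\<bar> * exp \<bar>t\<bar>"
      unfolding a_def b_def
      by (rule order_trans[OF norm_triangle_ineq],
          intro add_mono; simp add: norm_mult mult_left_mono norm_mode_le[OF x])+
    have "norm (cx v * a n x + cnj (cx v) * b n x) \<le> norm v * norm (a n x) + norm v * norm (b n x)"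
      by (rule order_trans[OF norm_triangle_ineq]) (simp add: norm_mult)
    also have "\<dots> \<le> norm v * (real (p n) * exp \<bar>t\<bar> + \<bar>t\<bar> * exp \<bar>t\<bar>) + norm v * (real (q n) * exp \<bar>t\<bar> + \<bar>t\<bar> * exp \<bar>t\<bar>)"
      using a b by (intro add_mono mult_left_mono) auto
    also have "\<dots> = norm v * (exp \<bar>t\<bar> * (real (p n + q n) + 2 * \<bar>t\<bar>))"
      by (simp add: algebra_simps)
    also have "\<dots> \<le> norm v * (exp \<bar>t\<bar> * ((real (p n + q n) + 1) * (1 + 2 * \<bar>t\<bar>)))"
      by (intro mult_left_mono) (auto simp: algebra_simps)
    finally have "norm (c n) * norm (cx v * a n x + cnj (cx v) * b n x)
        \<le> norm (c n) * (norm v * (exp \<bar>t\<bar> * ((real (p n + q n) + 1) * (1 + 2 * \<bar>t\<bar>))))"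
      by (intro mult_left_mono) auto
    then show "norm (c n * (cx v * a n x + cnj (cx v) * b n x)) \<le> B n * norm v"
      by (simp add: norm_mult B_def K_def mult_ac)
  qed
  moreover have "(\<Sum>n. c n * (cx v * a n x + cnj (cx v) * b n x))
    = cx v * (series t (\<lambda>n. c n * of_nat (p n)) (\<lambda>n. p n - 1) q m x
                   + of_real t * series t c p (\<lambda>n. q n + 1) (\<lambda>n. m n + 1) x)
       + cnj (cx v) * (series t (\<lambda>n. c n * of_nat (q n)) p (\<lambda>n. q n - 1) m x
                   + of_real t * series t c (\<lambda>n. p n + 1) q (\<lambda>n. m n + 1) x)" for v
  proof -
    have "(\<lambda>n. cx v * (c n * of_nat (p n) * mode t (p n - 1) (q n) (m n) x
            + of_real t * (c n * mode t (p n) (q n + 1) (m n + 1) x))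
        + cnj (cx v) * (c n * of_nat (q n) * mode t (p n) (q n - 1) (m n) x
            + of_real t * (c n * mode t (p n + 1) (q n) (m n + 1) x))) sums
      (cx v * (series t (\<lambda>n. c n * of_nat (p n)) (\<lambda>n. p n - 1) q m x
                   + of_real t * series t c p (\<lambda>n. q n + 1) (\<lambda>n. m n + 1) x)
       + cnj (cx v) * (series t (\<lambda>n. c n * of_nat (q n)) p (\<lambda>n. q n - 1) m x
                   + of_real t * series t c (\<lambda>n. p n + 1) q (\<lambda>n. m n + 1) x))"
      by (intro sums_add sums_mult rapid_sums[OF rapid_derivative(1)[OF c] x]
          rapid_sums[OF rapid_derivative(2)[OF c] x] rapid_sums[OF c x])
    then show ?thesis by (simp add: sums_iff a_def b_def algebra_simps)
  qed
  moreover have eq: "series t c p q m = (\<lambda>x. \<Sum>n. c n * mode t (p n) (q n) (m n) x)"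
    by (rule ext) (rule series_def)
  ultimately show ?thesis unfolding eq by simp
qed

lemma Ck_on_series: "rapid c p q \<Longrightarrow> Ck_on k unit_disk (series t c p q m)"
proof (induction k arbitrary: c p q m)
  case 0
  then show ?case
    using series_has_derivative[OF 0] unfolding Ck_on.simps
    by (intro differentiable_imp_continuous_on) (fastforce simp: differentiable_on_def differentiable_def)
next
  case (Suc k)
  note r = rapid_derivative[OF Suc.prems]
  show ?case
    by (rule Ck_on_Suc_I[OF _ series_has_derivative[OF Suc.prems]])
      (simp, simp, intro Ck_on_add Ck_on_mult Ck_on_const Suc.IH r convex_body_cball zero_less_one)
qed

lemma smooth_on_series: "rapid c p q \<Longrightarrow> smooth_on unit_disk (series t c p q m)"
  by (simp add: smooth_on_def Ck_on_series)

section \<open>Wirtinger calculus and the Dirichlet problem\<close>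

definition wirtinger :: "(real^2 \<Rightarrow> complex) \<Rightarrow> complex \<Rightarrow> complex \<Rightarrow> real^2 \<Rightarrow> bool" where
  "wirtinger f a b x \<longleftrightarrow>
     (f has_derivative (\<lambda>v. cx v * a + cnj (cx v) * b)) (at x within unit_disk)"

text \<open>In \<open>wirtinger\<close> the numbers a and b are the usual Wirtinger derivatives;
  \<open>dz\<close> and \<open>dzbar\<close> lack the conventional factor one half.\<close>

lemma wirtinger_dz:
  assumes "wirtinger f a b x" "x \<in> unit_disk"
  shows "dz f x = 2 * a" "dzbar f x = 2 * b"
proof -
  have d: "dirderiv unit_disk f x v = cx v * a + cnj (cx v) * b" for v
    by (rule dirderiv_eqI[OF _ assms(2) assms(1)[unfolded wirtinger_def]]) simp
  have "cx (axis 1 1) = 1" "cx (axis 2 1) = \<i>"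
    by (simp_all add: cx_def axis_def complex_eq_iff)
  then show "dz f x = 2 * a" "dzbar f x = 2 * b"
    unfolding dz_def dzbar_def d by (simp_all add: algebra_simps)
qed

lemma wirtinger_add:
  assumes "wirtinger f a b x" "wirtinger g c d x"
  shows "wirtinger (\<lambda>x. f x + g x) (a + c) (b + d) x"
  unfolding wirtinger_def
  by (rule has_derivative_eq_rhs[OF has_derivative_add[OF assms[unfolded wirtinger_def]]])
    (auto simp: algebra_simps)

lemma wirtinger_mult:
  assumes "wirtinger f a b x" "wirtinger g c d x"
  shows "wirtinger (\<lambda>x. f x * g x) (f x * c + a * g x) (f x * d + b * g x) x"
  unfolding wirtinger_def
  by (rule has_derivative_eq_rhs[OF has_derivative_mult[OF assms[unfolded wirtinger_def]]])
    (auto simp: algebra_simps)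

lemma wirtinger_exp_inner:
  "wirtinger (\<lambda>x. exp (of_real (\<alpha> + \<beta> * (x \<bullet> x))))
     (of_real \<beta> * cnj (cx x) * exp (of_real (\<alpha> + \<beta> * (x \<bullet> x))))
     (of_real \<beta> * cx x * exp (of_real (\<alpha> + \<beta> * (x \<bullet> x)))) x"
proof -
  have "((\<lambda>x. \<alpha> + \<beta> * (x \<bullet> x)) has_derivative (\<lambda>v. \<beta> * (2 * (x \<bullet> v)))) (at x within unit_disk)"
    by (auto intro!: derivative_eq_intros simp: inner_commute)
  from has_derivative_compose[OF has_derivative_of_real[OF this] DERIV_exp[unfolded has_field_derivative_def]]
  have "((\<lambda>x. exp (complex_of_real (\<alpha> + \<beta> * (x \<bullet> x)))) has_derivative
      (\<lambda>v. exp (of_real (\<alpha> + \<beta> * (x \<bullet> x))) * of_real (\<beta> * (2 * (x \<bullet> v))))) (at x within unit_disk)" .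
  moreover have "complex_of_real (\<beta> * (2 * (x \<bullet> v))) = of_real \<beta> * (cx v * cnj (cx x) + cnj (cx v) * cx x)" for v
    unfolding cx_inner[symmetric] by simp
  ultimately show ?thesis
    unfolding wirtinger_def by (elim has_derivative_eq_rhs) (auto simp: algebra_simps)
qed

lemma smooth_on_exp_inner: "smooth_on unit_disk (\<lambda>x. exp (complex_of_real (\<alpha> + \<beta> * (x \<bullet> x))))"
proof -
  have "smooth_on unit_disk (\<lambda>x. complex_of_real \<alpha> + complex_of_real \<beta> * (cx x * cnj (cx x)))"
    by (intro smooth_on_add smooth_on_mult smooth_on_const smooth_on_cnj smooth_on_cx) simp_all
  then show ?thesis by (intro smooth_on_exp) (simp_all add: cx_mult_cnj)
qed

text \<open>Allows the two losses in the Dirichlet problem: one factor \<open>n + 1\<close> from the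
  lower bound on \<open>phi\<close>, and one extra degree from the factor
  \<open>z^(n+1)\<close>.\<close>

lemma rapid_fourier:
  assumes f: "smooth_on UNIV f" "\<And>\<theta>. f (\<theta> + 2 * pi) = f \<theta>" "\<And>n. int n \<le> \<bar>k n\<bar>"
    and c: "\<And>n. norm (c n) \<le> K * (norm (fourier_coeff f (k n)) * (real n + 1))"
    and pq: "\<And>n. p n + q n \<le> n + 1"
  shows "rapid c p q"
  unfolding rapid_def
proof
  fix N
  have "summable (\<lambda>n. K * 2 ^ N * (norm (fourier_coeff f (k n)) * (real n + 1) ^ Suc N))"
    by (intro summable_mult summable_fourier_coeff[OF f])
  then show "summable (\<lambda>n. norm (c n) * (real (p n + q n) + 1) ^ N)"
  proof (rule summable_comparison_test')
    fix n
    have "real (p n + q n) \<le> real (n + 1)" using pq by (rule of_nat_mono)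
    then have "(real (p n + q n) + 1) ^ N \<le> (2 * (real n + 1)) ^ N"
      by (intro power_mono) auto
    moreover have "0 \<le> K * (norm (fourier_coeff f (k n)) * (real n + 1))"
      using c[of n] norm_ge_zero order_trans by blast
    ultimately have "norm (c n) * (real (p n + q n) + 1) ^ N
        \<le> K * (norm (fourier_coeff f (k n)) * (real n + 1)) * (2 * (real n + 1)) ^ N"
      using c[of n] by (intro mult_mono) auto
    also have "\<dots> = K * 2 ^ N * (norm (fourier_coeff f (k n)) * (real n + 1) ^ Suc N)"
      by (simp only: power_mult_distrib power_Suc mult_ac)
    finally show "norm (norm (c n) * (real (p n + q n) + 1) ^ N)
        \<le> K * 2 ^ N * (norm (fourier_coeff f (k n)) * (real n + 1) ^ Suc N)" by simp
  qed
qed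

text \<open>Take \<open>p = G (S1 + S2)\<close> with G a Gaussian, S2 antiholomorphic and the
  z-derivative of S1 equal to \<open>exp (t s) h\<close>, where h is holomorphic. Then
  \<open>D' p\<close> is \<open>2 h\<close> times the reciprocal type of Gaussian,
  \<open>G' = G exp (t s)\<close>, which D annihilates. S1 and S2 carry the positive and the
  nonpositive frequencies of f.\<close>

lemma mag_dz_dirichlet:
  assumes f: "smooth_on UNIV f" "\<And>\<theta>. f (\<theta> + 2 * pi) = f \<theta>"
  obtains p where "smooth_on unit_disk p"
    "\<And>x. x \<in> unit_disk \<Longrightarrow> mag_dzbar t (mag_dz t p) x = 0"
    "\<And>\<theta>. p (polar 1 \<theta>) = f \<theta>"
proof -
  \<comment> \<open>The division makes the n-th term of S1 on the unit circle, where
    \<open>s = 1\<close>, the Fourier term of index \<open>n + 1\<close>.\<close>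
  define a where "a n = fourier_coeff f (int n + 1) / of_real (phi t n 1)" for n
  define b where "b n = fourier_coeff f (- int n)" for n
  have "norm (a n) \<le> exp \<bar>t\<bar> * (norm (fourier_coeff f (int n + 1)) * (real n + 1))" for n
  proof -
    have "1 \<le> exp \<bar>t\<bar> * (real n + 1) * phi t n 1"
      using phi_lower[of t n] by (simp add: exp_minus divide_simps mult_ac)
    then have "norm (fourier_coeff f (int n + 1)) * 1
        \<le> norm (fourier_coeff f (int n + 1)) * (exp \<bar>t\<bar> * (real n + 1) * phi t n 1)"
      by (intro mult_left_mono) auto
    then show ?thesis
      using phi_pos[of t n] by (simp add: a_def norm_divide divide_simps mult_ac)
  qed
  from rapid_fourier[OF f _ this]
  have ra: "rapid a p q" if "\<And>n. p n + q n \<le> n + 1" for p q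
    using that by simp
  have "norm (b n) \<le> 1 * (norm (fourier_coeff f (- int n)) * (real n + 1))" for n
    unfolding b_def by (simp add: mult_le_cancel_left1 distrib_left)
  from rapid_fourier[OF f _ this] have rb: "rapid b (\<lambda>_. 0) (\<lambda>n. n)" by simp
  have ra1: "rapid a (\<lambda>n. n + 1) (\<lambda>_. 0)" and ra0: "rapid a (\<lambda>n. n) (\<lambda>_. 0)"
    by (rule ra, simp)+
  define S1 where "S1 = series t a (\<lambda>n. n + 1) (\<lambda>_. 0) (\<lambda>n. n)"
  \<comment> \<open>With \<open>t = 0\<close> and \<open>m = 0\<close> the factor \<open>phi\<close>
    is 1, so S2 and h are power series in z' and z.\<close>
  define S2 where "S2 = series 0 b (\<lambda>_. 0) (\<lambda>n. n) (\<lambda>_. 0)"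
  define h where "h = series 0 a (\<lambda>n. n) (\<lambda>_. 0) (\<lambda>_. 0)"
  have zero: "series s (\<lambda>n. 0) p q m x = 0" for s p q m x by (simp add: series_def)
  have h: "\<exists>c. wirtinger h c 0 x" if "x \<in> unit_disk" for x
    using series_has_derivative[OF ra0 that, of 0 "\<lambda>_. 0"]
    by (auto simp: wirtinger_def h_def zero)
  have S2: "\<exists>c. wirtinger S2 0 c x" if "x \<in> unit_disk" for x
    using series_has_derivative[OF rb that, of 0 "\<lambda>_. 0"]
    by (auto simp: wirtinger_def S2_def zero)
  have S1: "\<exists>c. wirtinger S1 (exp (of_real (t * (x \<bullet> x))) * h x) c x" if x: "x \<in> unit_disk" for x
  proof -
    have "(\<lambda>n. a n * of_nat (n + 1) * mode t n 0 n x + of_real t * (a n * mode t (n + 1) 1 (n + 1) x))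
      sums (series t (\<lambda>n. a n * of_nat (n + 1)) (\<lambda>n. n) (\<lambda>_. 0) (\<lambda>n. n) x
         + of_real t * series t a (\<lambda>n. n + 1) (\<lambda>_. 1) (\<lambda>n. n + 1) x)"
      using rapid_derivative(1)[OF ra1]
      by (intro sums_add sums_mult rapid_sums[OF _ x] rapid_sums[OF ra1 x]) simp
    \<comment> \<open>By \<open>phi_recursion\<close> the z-derivative of each mode collapses to
      \<open>exp (t s) z^n\<close>, with an exponential that does not depend on n and can be pulled
      out of the sum.\<close>
    moreover have "a n * of_nat (n + 1) * mode t n 0 n x + of_real t * (a n * mode t (n + 1) 1 (n + 1) x)
        = exp (of_real (t * (x \<bullet> x))) * (a n * mode 0 n 0 0 x)" for n
    proof -
      have "exp (complex_of_real (t * (x \<bullet> x))) =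
          of_real ((real n + 1) * phi t n (x \<bullet> x) + t * (x \<bullet> x) * phi t (Suc n) (x \<bullet> x))"
        unfolding phi_recursion by (rule exp_of_real)
      also have "\<dots> = (of_nat n + 1) * of_real (phi t n (x \<bullet> x))
          + of_real t * (cx x * cnj (cx x)) * of_real (phi t (Suc n) (x \<bullet> x))"
        unfolding cx_mult_cnj by simp
      finally show ?thesis by (simp add: mode_def phi_0 algebra_simps)
    qed
    moreover have "(\<lambda>n. exp (of_real (t * (x \<bullet> x))) * (a n * mode 0 n 0 0 x)) sums (exp (of_real (t * (x \<bullet> x))) * h x)"
      unfolding h_def by (intro sums_mult rapid_sums[OF ra0 x])
    ultimately have "series t (\<lambda>n. a n * of_nat (n + 1)) (\<lambda>n. n) (\<lambda>_. 0) (\<lambda>n. n) x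
         + of_real t * series t a (\<lambda>n. n + 1) (\<lambda>_. 1) (\<lambda>n. n + 1) x = exp (of_real (t * (x \<bullet> x))) * h x"
      by (simp add: sums_unique2)
    then show ?thesis
      using series_has_derivative[OF ra1 x, of t "\<lambda>n. n"]
      unfolding wirtinger_def S1_def by auto
  qed
  \<comment> \<open>The constant \<open>t / 2\<close> normalizes G to 1 on the unit circle.\<close>
  define G where "G x = exp (complex_of_real (t / 2 + (- t / 2) * (x \<bullet> x)))" for x :: "real^2"
  define G' where "G' x = exp (complex_of_real (t / 2 + t / 2 * (x \<bullet> x)))" for x :: "real^2"
  define p where "p x = G x * (S1 x + S2 x)" for x
  have GG: "G x * exp (of_real (t * (x \<bullet> x))) = G' x" for x
    unfolding G_def G'_def exp_add[symmetric] of_real_add[symmetric]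
    by (rule arg_cong[where f = "\<lambda>u. exp (complex_of_real u)"]) (simp add: field_simps)
  have P: "mag_dz t p x = G' x * (2 * h x)" if x: "x \<in> unit_disk" for x
  proof -
    obtain c d where "wirtinger S1 (exp (of_real (t * (x \<bullet> x))) * h x) c x" "wirtinger S2 0 d x"
      using S1[OF x] S2[OF x] by blast
    from wirtinger_mult[OF wirtinger_exp_inner[of "t / 2" "- t / 2" x] wirtinger_add[OF this]]
    have dz: "dz p x = 2 * (G x * (exp (of_real (t * (x \<bullet> x))) * h x + 0)
        + of_real (- t / 2) * cnj (cx x) * G x * (S1 x + S2 x))"
      using wirtinger_dz(1)[OF _ x] unfolding p_def[abs_def] G_def by blast
    show ?thesis unfolding mag_dz_def dz GG[symmetric] by (simp add: p_def algebra_simps)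
  qed
  show thesis
  proof
    show "smooth_on unit_disk p"
      unfolding p_def[abs_def] G_def S1_def S2_def
      by (intro smooth_on_mult smooth_on_add smooth_on_exp_inner smooth_on_series ra1 rb) simp_all
    show "mag_dzbar t (mag_dz t p) x = 0" if x: "x \<in> unit_disk" for x
    proof -
      obtain c where c: "wirtinger h c 0 x" using h[OF x] by blast
      have c2: "wirtinger (\<lambda>x. 2) 0 0 x" by (simp add: wirtinger_def)
      have "dzbar (mag_dz t p) x = dzbar (\<lambda>x. G' x * (2 * h x)) x"
        unfolding dzbar_def using dirderiv_cong[OF P x] by simp
      also have "\<dots> = 2 * (G' x * (2 * 0 + 0 * h x) + of_real (t / 2) * cx x * G' x * (2 * h x))"
        using wirtinger_dz(2)[OF wirtinger_mult[OF wirtinger_exp_inner[of "t / 2" "t / 2" x] wirtinger_mult[OF c2 c]] x]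
        unfolding G'_def .
      finally show ?thesis unfolding mag_dzbar_def P[OF x] by simp
    qed
    show "p (polar 1 \<theta>) = f \<theta>" for \<theta>
    proof -
      have n: "polar 1 \<theta> \<bullet> polar 1 \<theta> = 1" by (simp add: dot_square_norm norm_polar)
      have "S1 (polar 1 \<theta>) = (\<Sum>n. fourier_coeff f (int n + 1) * cis (of_int (int n + 1) * \<theta>))"
        using phi_pos[of t, THEN less_imp_neq, symmetric]
        by (simp add: S1_def series_def mode_def n cx_polar a_def Complex.DeMoivre add.commute del: power_Suc)
      moreover have "S2 (polar 1 \<theta>) = (\<Sum>n. fourier_coeff f (- int n) * cis (of_int (- int n) * \<theta>))"
        by (simp add: S2_def series_def mode_def n cx_polar b_def phi_0 cis_cnj Complex.DeMoivre)
      moreover have "G (polar 1 \<theta>) = 1" by (simp add: G_def n)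
      ultimately show ?thesis by (simp only: p_def fourier_expansion[of f \<theta>, OF f]) simp
    qed
  qed
qed

section \<open>The magnetic Steklov operator\<close>

definition tangent :: "real \<Rightarrow> real^2" where
  "tangent \<theta> = vector [- sin \<theta>, cos \<theta>]"

definition circle_fun :: "(real^2 \<Rightarrow> real^2 \<Rightarrow> complex) \<Rightarrow> real \<Rightarrow> complex" where
  "circle_fun \<psi> \<theta> = \<psi> (polar 1 \<theta>) (tangent \<theta>)"

text \<open>The pointwise part of \<open>circle_one_forms\<close>, separated from smoothness. Such a
  form is determined by \<open>circle_fun\<close>, its values on the unit tangent.\<close>

definition tangential :: "(real^2 \<Rightarrow> real^2 \<Rightarrow> complex) \<Rightarrow> bool" where
  "tangential \<psi> \<longleftrightarrow>
     (\<forall>x v. \<not> (x \<in> unit_circle \<and> v \<bullet> x = 0) \<longrightarrow> \<psi> x v = 0) \<and>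
     (\<forall>x\<in>unit_circle. \<forall>u v a b. u \<bullet> x = 0 \<longrightarrow> v \<bullet> x = 0 \<longrightarrow>
        \<psi> x (a *\<^sub>R u + b *\<^sub>R v) = a *\<^sub>R \<psi> x u + b *\<^sub>R \<psi> x v)"

lemma circle_one_forms_iff:
  "\<psi> \<in> circle_one_forms \<longleftrightarrow> tangential \<psi> \<and> smooth_on UNIV (circle_fun \<psi>)"
  by (auto simp: circle_one_forms_def tangential_def circle_fun_def[abs_def] polar_def tangent_def)

lemma inner_vec2: "(x::real^2) \<bullet> y = x $ 1 * y $ 1 + x $ 2 * y $ 2"
  by (simp add: inner_vec_def UNIV_2)

lemma tangent_nth [simp]: "tangent \<theta> $ 1 = - sin \<theta>" "tangent \<theta> $ 2 = cos \<theta>"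
  by (simp_all add: tangent_def)

lemma polar_in_circle: "polar 1 \<theta> \<in> unit_circle"
  by (simp add: norm_polar)

lemma polar_1_in_disk: "polar 1 \<theta> \<in> unit_disk"
  by (rule polar_in_disk) simp

lemma tangent_orthogonal: "tangent \<theta> \<bullet> polar 1 \<theta> = 0"
  by (simp add: inner_vec2)

lemma circle_point:
  assumes "x \<in> unit_circle"
  obtains \<theta> where "x = polar 1 \<theta>"
proof -
  have "x \<bullet> x = 1" using assms by (simp add: dot_square_norm)
  then have "(x $ 1)\<^sup>2 + (x $ 2)\<^sup>2 = 1"
    by (simp add: inner_vec2 power2_eq_square)
  then obtain \<theta> where "x $ 1 = cos \<theta>" "x $ 2 = sin \<theta>"
    using sincos_total_2pi by metis
  then have "x = polar 1 \<theta>" by (simp add: vec_eq_iff forall_2)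
  then show thesis by (rule that)
qed

lemma tangent_vector:
  assumes "v \<bullet> polar 1 \<theta> = 0"
  shows "v = (v \<bullet> tangent \<theta>) *\<^sub>R tangent \<theta>"
proof -
  have s: "sin \<theta> * sin \<theta> + cos \<theta> * cos \<theta> = 1"
    using sin_cos_squared_add[of \<theta>] by (simp add: power2_eq_square)
  have o: "v $ 1 * cos \<theta> + v $ 2 * sin \<theta> = 0" using assms by (simp add: inner_vec2)
  have "v $ 1 = (v $ 1 * - sin \<theta> + v $ 2 * cos \<theta>) * - sin \<theta>"
    "v $ 2 = (v $ 1 * - sin \<theta> + v $ 2 * cos \<theta>) * cos \<theta>"
    using s o by algebra+
  then show ?thesis by (simp add: vec_eq_iff forall_2 inner_vec2)
qed

lemma tangential_eqI:
  assumes "tangential \<psi>" "tangential \<psi>'" "\<And>\<theta>. circle_fun \<psi> \<theta> = circle_fun \<psi>' \<theta>"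
  shows "\<psi> = \<psi>'"
proof (intro ext)
  fix x v
  show "\<psi> x v = \<psi>' x v"
  proof (cases "x \<in> unit_circle \<and> v \<bullet> x = 0")
    case False
    then show ?thesis using assms(1,2) unfolding tangential_def by metis
  next
    case True
    then obtain \<theta> where x: "x = polar 1 \<theta>" using circle_point by blast
    \<comment> \<open>The zero summand brings v into the two-term shape of the linearity
      clause.\<close>
    have v: "v = (v \<bullet> tangent \<theta>) *\<^sub>R tangent \<theta> + 0 *\<^sub>R tangent \<theta>"
      using tangent_vector[of v \<theta>] True x by simp
    have eq: "\<phi> x v = (v \<bullet> tangent \<theta>) *\<^sub>R circle_fun \<phi> \<theta>" if "tangential \<phi>" for \<phi>
    proof -
      have "\<phi> x ((v \<bullet> tangent \<theta>) *\<^sub>R tangent \<theta> + 0 *\<^sub>R tangent \<theta>)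
          = (v \<bullet> tangent \<theta>) *\<^sub>R \<phi> x (tangent \<theta>) + 0 *\<^sub>R \<phi> x (tangent \<theta>)"
        using that tangent_orthogonal[of \<theta>] polar_in_circle[of \<theta>] unfolding tangential_def x by blast
      then show ?thesis using v by (simp add: circle_fun_def x)
    qed
    show ?thesis unfolding eq[OF assms(1)] eq[OF assms(2)] assms(3) ..
  qed
qed

lemma tangential_circle_pullback:
  assumes "\<And>x. x \<in> unit_circle \<Longrightarrow> linear (\<omega> x)"
  shows "tangential (circle_pullback \<omega>)"
  using assms
  by (auto simp: tangential_def circle_pullback_def inner_add_left linear_add linear_cmul)

lemma circle_fun_pullback: "circle_fun (circle_pullback \<omega>) \<theta> = \<omega> (polar 1 \<theta>) (tangent \<theta>)"
  using tangent_orthogonal[of \<theta>] polar_in_circle[of \<theta>] by (simp add: circle_fun_def circle_pullback_def)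

lemma circle_fun_scale: "circle_fun (\<lambda>x v. z * \<psi> x v) \<theta> = z * circle_fun \<psi> \<theta>"
  by (simp add: circle_fun_def)

lemma tangential_scale: "tangential \<psi> \<Longrightarrow> tangential (\<lambda>x v. z * \<psi> x v)"
  by (auto simp: tangential_def distrib_left)

lemma circle_fun_periodic: "circle_fun \<psi> (\<theta> + 2 * pi) = circle_fun \<psi> \<theta>"
  by (simp add: circle_fun_def polar_def tangent_def)

text \<open>The normal component vanishes, so on the circle \<omega> is
  \<open>circle_fun \<psi>\<close> times the angular form, whose components are
  \<open>- sin \<theta>\<close> and \<open>cos \<theta>\<close>. The factor \<open>cis\<close>
  shifts the index by one, opposite to the shift caused by \<open>mag_dz\<close> or
  \<open>mag_dzbar\<close>, so that the operator acts on each Fourier coefficient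
  separately.\<close>

lemma harmonic_extension_boundary:
  assumes "is_harmonic_extension \<eta> \<psi> \<omega>"
  shows "comp_plus \<omega> (polar 1 \<theta>) = \<i> * (circle_fun \<psi> \<theta> * cis (of_int 1 * \<theta>))"
    and "comp_minus \<omega> (polar 1 \<theta>) = - \<i> * (circle_fun \<psi> \<theta> * cis (of_int (- 1) * \<theta>))"
proof -
  let ?x = "polar 1 \<theta>"
  define a b where "a = \<omega> ?x (axis 1 1)" and "b = \<omega> ?x (axis 2 1)"
  define c s where "c = complex_of_real (cos \<theta>)" and "s = complex_of_real (sin \<theta>)"
  have om: "\<omega> \<in> one_forms unit_disk" and psi: "circle_pullback \<omega> = \<psi>"
    and nu: "\<omega> ?x (inward_normal ?x) = 0"
    using assms polar_in_circle[of \<theta>] unfolding is_harmonic_extension_def by blast+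
  have lin: "\<omega> ?x v = of_real (v $ 1) * a + of_real (v $ 2) * b" for v
    unfolding a_def b_def by (rule one_form_vec2[OF om polar_1_in_disk])
  have t: "circle_fun \<psi> \<theta> = - s * a + c * b"
    unfolding psi[symmetric] circle_fun_pullback lin by (simp add: c_def s_def)
  have n: "c * a + s * b = 0"
    using nu unfolding lin inward_normal_def by (simp add: c_def s_def add_eq_0_iff)
  have cs: "c * c + s * s = 1"
    unfolding c_def s_def of_real_mult[symmetric] of_real_add[symmetric]
    using sin_cos_squared_add2[of \<theta>] by (simp add: power2_eq_square)
  have cis: "cis (of_int 1 * \<theta>) = c + \<i> * s" "cis (of_int (- 1) * \<theta>) = c - \<i> * s"
    by (simp_all add: c_def s_def complex_eq_iff)
  show "comp_plus \<omega> ?x = \<i> * (circle_fun \<psi> \<theta> * cis (of_int 1 * \<theta>))"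
    unfolding comp_plus_def a_def[symmetric] b_def[symmetric] t cis using n cs i_squared by algebra
  show "comp_minus \<omega> ?x = - \<i> * (circle_fun \<psi> \<theta> * cis (of_int (- 1) * \<theta>))"
    unfolding comp_minus_def a_def[symmetric] b_def[symmetric] t cis using n cs i_squared by algebra
qed

section \<open>Complex conjugation and reversal of the potential\<close>

lemma dirderiv_cnj:
  assumes "convex_body M" "smooth_on M f" "x \<in> M"
  shows "dirderiv M (\<lambda>x. cnj (f x)) x v = cnj (dirderiv M f x v)"
  by (rule dirderiv_eqI[OF assms(1,3)])
    (rule bounded_linear.has_derivative[OF bounded_linear_cnj smooth_on_has_derivative[OF assms(2,3)]])

lemma mag_dz_cnj:
  assumes "smooth_on unit_disk f" "x \<in> unit_disk"
  shows "mag_dz (- t) (\<lambda>x. cnj (f x)) x = cnj (mag_dzbar t f x)"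
    and "mag_dzbar (- t) (\<lambda>x. cnj (f x)) x = cnj (mag_dz t f x)"
  using dirderiv_cnj[OF convex_body_cball assms]
  by (simp_all add: mag_dz_def mag_dzbar_def dz_def dzbar_def)

lemma mag_dzbar_cong:
  assumes "\<And>y. y \<in> unit_disk \<Longrightarrow> f y = g y" "x \<in> unit_disk"
  shows "mag_dzbar t f x = mag_dzbar t g x"
  using dirderiv_cong[of unit_disk f g x, OF assms] assms by (simp add: mag_dzbar_def dzbar_def)

lemma mag_dzbar_mag_dz_cnj:
  assumes "smooth_on unit_disk f" "x \<in> unit_disk"
  shows "mag_dzbar (- t) (mag_dz (- t) (\<lambda>x. cnj (f x))) x = cnj (mag_dz t (mag_dzbar t f) x)"
proof -
  have "mag_dzbar (- t) (mag_dz (- t) (\<lambda>x. cnj (f x))) x = mag_dzbar (- t) (\<lambda>x. cnj (mag_dzbar t f x)) x"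
    by (rule mag_dzbar_cong[OF mag_dz_cnj(1)[OF assms(1)] assms(2)])
  also have "\<dots> = cnj (mag_dz t (mag_dzbar t f) x)"
    by (rule mag_dz_cnj(2)[OF smooth_on_mag_dzbar[OF assms(1)] assms(2)])
  finally show ?thesis .
qed

text \<open>The first summand stems from \<open>comp_plus\<close>, the second from
  \<open>comp_minus\<close>. Only at \<open>l = 0\<close> are both present, which accounts for the
  exceptional eigenvalue with the hyperbolic cotangent.\<close>

definition steklov_eigenvalue :: "real \<Rightarrow> int \<Rightarrow> real" where
  "steklov_eigenvalue t l =
     (if l \<ge> 0 then exp t / phi t (nat l) 1 else 0)
     + (if l \<le> 0 then exp (- t) / phi (- t) (nat (- l)) 1 else 0)"

lemma harmonic_laplace:
  assumes "is_harmonic_extension (potential t) \<psi> \<omega>" "x \<in> unit_disk"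
  shows "mag_dzbar t (mag_dz t (comp_plus \<omega>)) x = 0"
    and "mag_dz t (mag_dzbar t (comp_minus \<omega>)) x = 0"
proof -
  have om: "\<omega> \<in> one_forms unit_disk"
    and lap: "\<And>v. mag_laplace1 unit_disk (potential t) \<omega> x v = 0"
    using assms unfolding is_harmonic_extension_def by blast+
  have cx: "cx (axis 1 1) = 1" "cx (axis 2 1) = \<i>"
    by (simp_all add: cx_def axis_def complex_eq_iff)
  define X Y where "X = mag_dzbar t (mag_dz t (comp_plus \<omega>)) x"
    and "Y = mag_dz t (mag_dzbar t (comp_minus \<omega>)) x"
  have "X * cnj (cx v) + Y * cx v = 0" for v
    using lap[of v] unfolding mag_laplace1_potential[OF om assms(2)] X_def Y_def by simp
  from this[of "axis 1 1"] this[of "axis 2 1"] have "X + Y = 0" "\<i> * (Y - X) = 0"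
    unfolding cx by (simp_all add: algebra_simps)
  then show "mag_dzbar t (mag_dz t (comp_plus \<omega>)) x = 0"
    and "mag_dz t (mag_dzbar t (comp_minus \<omega>)) x = 0"
    unfolding X_def[symmetric] Y_def[symmetric] by simp_all
qed

text \<open>The coefficient of \<open>d\<^sup>\<eta> \<omega>\<close> with respect to the area form, along the circle.\<close>

definition boundary_curl :: "real \<Rightarrow> (real^2 \<Rightarrow> real^2 \<Rightarrow> complex) \<Rightarrow> real \<Rightarrow> complex" where
  "boundary_curl t \<omega> \<theta> =
     - (\<i>/2) * (mag_dz t (comp_plus \<omega>) (polar 1 \<theta>) - mag_dzbar t (comp_minus \<omega>) (polar 1 \<theta>))"

text \<open>\<open>fourier_mag_dz_boundary\<close> is applied to \<open>comp_plus \<omega>\<close>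
  with t and to the conjugate of \<open>comp_minus \<omega>\<close> with \<open>- t\<close>. The
  boundary data are \<i> times a shift of the data of \<psi> or of its conjugate; the resulting
  factors \<open>2 \<i>\<close> and \<open>- 2 \<i>\<close> cancel against \<open>- \<i> / 2\<close>
  in the curl.\<close>

lemma fourier_boundary_curl:
  assumes h: "is_harmonic_extension (potential t) \<psi> \<omega>"
  shows "fourier_coeff (boundary_curl t \<omega>) l
       = of_real (steklov_eigenvalue t l) * fourier_coeff (circle_fun \<psi>) l"
proof -
  let ?f = "circle_fun \<psi>"
  have om: "\<omega> \<in> one_forms unit_disk" using h unfolding is_harmonic_extension_def by blast
  have sp: "smooth_on unit_disk (comp_plus \<omega>)" by (rule smooth_on_comp_plus[OF om])
  have sm: "smooth_on unit_disk (comp_minus \<omega>)" by (rule smooth_on_comp_minus[OF om])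
  let ?P = "\<lambda>\<theta>. mag_dz t (comp_plus \<omega>) (polar 1 \<theta>)"
  let ?Q = "\<lambda>\<theta>. mag_dzbar t (comp_minus \<omega>) (polar 1 \<theta>)"
  have cP: "continuous_on {0..2*pi} ?P" and cQ: "continuous_on {0..2*pi} ?Q"
    by (rule continuous_on_smooth_polar(2)[OF smooth_on_mag_dz[OF sp]], simp)
      (rule continuous_on_smooth_polar(2)[OF smooth_on_mag_dzbar[OF sm]], simp)
  have P: "of_real (phi t m 1) * fourier_coeff ?P (int m) = of_real (2 * exp t) * (\<i> * fourier_coeff ?f (int m))"
    and P0: "l < 0 \<Longrightarrow> fourier_coeff ?P l = 0" for m l
    using fourier_mag_dz_boundary[OF sp harmonic_laplace(1)[OF h], of m]
      fourier_mag_dz_boundary(2)[OF sp harmonic_laplace(1)[OF h], of l]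
    unfolding harmonic_extension_boundary(1)[OF h] fourier_coeff_cmult fourier_coeff_shift by simp_all
  let ?q = "\<lambda>x. cnj (comp_minus \<omega> x)"
  have sq: "smooth_on unit_disk ?q" by (rule smooth_on_cnj[OF _ sm]) simp
  have q0: "mag_dzbar (- t) (mag_dz (- t) ?q) x = 0" if "x \<in> unit_disk" for x
    unfolding mag_dzbar_mag_dz_cnj[OF sm that] harmonic_laplace(2)[OF h that] by simp
  have qb: "?q (polar 1 \<theta>) = \<i> * (cnj (?f \<theta>) * cis (of_int 1 * \<theta>))" for \<theta>
    unfolding harmonic_extension_boundary(2)[OF h] by (simp add: cis_cnj)
  have dq: "mag_dz (- t) ?q (polar 1 \<theta>) = cnj (?Q \<theta>)" for \<theta>
    by (rule mag_dz_cnj(1)[OF sm polar_1_in_disk])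
  have Q: "of_real (phi (- t) m 1) * cnj (fourier_coeff ?Q (- int m))
        = of_real (2 * exp (- t)) * (\<i> * cnj (fourier_coeff ?f (- int m)))"
    and Q0: "l < 0 \<Longrightarrow> cnj (fourier_coeff ?Q (- l)) = 0" for m l
    using fourier_mag_dz_boundary[OF sq q0, of m] fourier_mag_dz_boundary(2)[OF sq q0, of l]
    unfolding qb dq fourier_coeff_cmult fourier_coeff_shift fourier_coeff_cnj by simp_all
  have P': "fourier_coeff ?P l = 2 * \<i> * of_real (if l \<ge> 0 then exp t / phi t (nat l) 1 else 0) * fourier_coeff ?f l"
  proof (cases "l \<ge> 0")
    case True
    then show ?thesis using P[of "nat l"] phi_pos[of t "nat l"] by (simp add: field_simps)
  next
    case False
    then show ?thesis using P0[of l] by simp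
  qed
  have Q': "fourier_coeff ?Q l = - 2 * \<i> * of_real (if l \<le> 0 then exp (- t) / phi (- t) (nat (- l)) 1 else 0) * fourier_coeff ?f l"
  proof (cases "l \<le> 0")
    case True
    then have "cnj (of_real (phi (- t) (nat (- l)) 1) * cnj (fourier_coeff ?Q l))
        = cnj (of_real (2 * exp (- t)) * (\<i> * cnj (fourier_coeff ?f l)))"
      using Q[of "nat (- l)"] by simp
    then show ?thesis using True phi_pos[of "- t" "nat (- l)"] by (simp add: field_simps)
  next
    case False
    then show ?thesis using Q0[of "- l"] by simp
  qed
  have "fourier_coeff (boundary_curl t \<omega>) l = - (\<i>/2) * (fourier_coeff ?P l - fourier_coeff ?Q l)"
    unfolding boundary_curl_def[abs_def] fourier_coeff_cmult fourier_coeff_diff[OF cP cQ] ..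
  then show ?thesis unfolding P' Q' steklov_eigenvalue_def of_real_add
    using i_squared by algebra
qed

lemma circle_fun_steklov:
  assumes "is_harmonic_extension (potential t) \<psi> (harmonic_extension (potential t) \<psi>)"
  shows "circle_fun (magnetic_steklov1 (potential t) \<psi>) \<theta>
       = boundary_curl t (harmonic_extension (potential t) \<psi>) \<theta>"
    and "tangential (magnetic_steklov1 (potential t) \<psi>)"
proof -
  let ?\<omega> = "harmonic_extension (potential t) \<psi>"
  have om: "?\<omega> \<in> one_forms unit_disk" using assms unfolding is_harmonic_extension_def by blast
  \<comment> \<open>The area form takes the value -1 on the inward normal and the tangent, which
    compensates the sign in the definition of the operator.\<close>
  have "- (cos \<theta> * cos \<theta>) - sin \<theta> * sin \<theta> = - 1"
    using sin_cos_squared_add2[of \<theta>] unfolding power2_eq_square by linarith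
  then show "circle_fun (magnetic_steklov1 (potential t) \<psi>) \<theta> = boundary_curl t ?\<omega> \<theta>"
    unfolding magnetic_steklov1_def circle_fun_pullback
      mag_d1_potential[OF om polar_1_in_disk] boundary_curl_def inward_normal_def
    by simp
  show "tangential (magnetic_steklov1 (potential t) \<psi>)"
    unfolding magnetic_steklov1_def
  proof (rule tangential_circle_pullback, rule linearI)
    fix x :: "real^2" and u v and c :: real
    assume "x \<in> unit_circle"
    then have x: "x \<in> unit_disk" by simp
    show "- mag_d1 unit_disk (potential t) ?\<omega> x (inward_normal x) (u + v)
      = - mag_d1 unit_disk (potential t) ?\<omega> x (inward_normal x) u
        + - mag_d1 unit_disk (potential t) ?\<omega> x (inward_normal x) v"
      "- mag_d1 unit_disk (potential t) ?\<omega> x (inward_normal x) (c *\<^sub>R u)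
      = c *\<^sub>R - mag_d1 unit_disk (potential t) ?\<omega> x (inward_normal x) u"
      unfolding mag_d1_potential[OF om x] by (simp_all add: algebra_simps scaleR_conv_of_real[where 'a = complex])
  qed
qed

section \<open>Existence of extensions and determination of the spectrum\<close>

lemma smooth_on_cis: "smooth_on UNIV cis"
proof -
  have "smooth_on UNIV (\<lambda>\<theta>::real. exp (\<i> * complex_of_real \<theta>))"
    by (intro smooth_on_exp smooth_on_linear_map bounded_linear_const_mult bounded_linear_of_real) simp_all
  then show ?thesis by (simp add: cis_conv_exp[abs_def])
qed

text \<open>Two scalar Dirichlet problems, one with t for \<open>comp_plus\<close> and one with
  \<open>- t\<close> for the conjugate of \<open>comp_minus\<close>. Their data are those forced by
  \<open>harmonic_extension_boundary\<close>.\<close>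

lemma harmonic_extension_exists:
  assumes "\<psi> \<in> circle_one_forms"
  shows "is_harmonic_extension (potential t) \<psi> (harmonic_extension (potential t) \<psi>)"
proof -
  let ?f = "circle_fun \<psi>"
  have tan: "tangential \<psi>" and sf: "smooth_on UNIV ?f"
    using assms by (simp_all add: circle_one_forms_iff)
  have per: "cis (\<theta> + 2 * pi) = cis \<theta>" for \<theta> by (simp add: complex_eq_iff)
  have "smooth_on UNIV (\<lambda>\<theta>. \<i> * (?f \<theta> * cis \<theta>))"
    by (intro smooth_on_mult smooth_on_const sf smooth_on_cis) simp_all
  then obtain p where p: "smooth_on unit_disk p"
    "\<And>x. x \<in> unit_disk \<Longrightarrow> mag_dzbar t (mag_dz t p) x = 0"
    "\<And>\<theta>. p (polar 1 \<theta>) = \<i> * (?f \<theta> * cis \<theta>)"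
    by (rule mag_dz_dirichlet[of _ t]) (simp add: per circle_fun_periodic, blast)
  have "smooth_on UNIV (\<lambda>\<theta>. \<i> * (cnj (?f \<theta>) * cis \<theta>))"
    by (intro smooth_on_mult smooth_on_const smooth_on_cnj sf smooth_on_cis) simp_all
  then obtain q where q: "smooth_on unit_disk q"
    "\<And>x. x \<in> unit_disk \<Longrightarrow> mag_dzbar (- t) (mag_dz (- t) q) x = 0"
    "\<And>\<theta>. q (polar 1 \<theta>) = \<i> * (cnj (?f \<theta>) * cis \<theta>)"
    by (rule mag_dz_dirichlet[of _ "- t"]) (simp add: per circle_fun_periodic, blast)
  let ?m = "\<lambda>x. cnj (q x)"
  have sm: "smooth_on unit_disk ?m" by (rule smooth_on_cnj[OF _ q(1)]) simp
  have m0: "mag_dz t (mag_dzbar t ?m) x = 0" if "x \<in> unit_disk" for x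
  proof -
    have "cnj (mag_dz t (mag_dzbar t ?m) x) = 0"
      using mag_dzbar_mag_dz_cnj[OF sm that, of t] q(2)[OF that] by simp
    then show ?thesis by simp
  qed
  \<comment> \<open>Reassembles the form from its complex components p and
    \<open>cnj q\<close>.\<close>
  define \<omega> where "\<omega> x v = 1/2 * (p x * cnj (cx v) + ?m x * cx v)" for x v
  have cx: "cx (axis 1 1) = 1" "cx (axis 2 1) = \<i>"
    by (simp_all add: cx_def axis_def complex_eq_iff)
  have cp: "comp_plus \<omega> = p" and cm: "comp_minus \<omega> = ?m"
    by (rule ext; simp add: comp_plus_def comp_minus_def \<omega>_def cx field_simps)+
  have lin: "linear (\<omega> x)" for x
    using bounded_linear.linear[OF bounded_linear_cx]
    by (intro linearI) (simp_all add: \<omega>_def linear_add linear_cmul algebra_simps scaleR_conv_of_real[where 'a = complex])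
  have om: "\<omega> \<in> one_forms unit_disk"
  proof -
    have "smooth_on unit_disk (\<lambda>x. \<omega> x v)" for v
      unfolding \<omega>_def by (intro smooth_on_mult smooth_on_add smooth_on_const p(1) sm) simp_all
    then show ?thesis using lin by (simp add: one_forms_def)
  qed
  have c1: "cis \<theta> * cnj (cis \<theta>) = 1" for \<theta>
    by (simp add: cis_cnj cis_mult)
  have cxt: "cx (tangent \<theta>) = \<i> * cis \<theta>" "cx (inward_normal (polar 1 \<theta>)) = - cis \<theta>" for \<theta>
    by (simp_all add: cx_def complex_eq_iff inward_normal_def)
  have "is_harmonic_extension (potential t) \<psi> \<omega>"
    unfolding is_harmonic_extension_def
  proof (intro conjI ballI allI om)
    show "mag_laplace1 unit_disk (potential t) \<omega> x v = 0" if "x \<in> unit_disk" for x v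
      unfolding mag_laplace1_potential[OF om that] cp cm p(2)[OF that] m0[OF that] by simp
    show "circle_pullback \<omega> = \<psi>"
    proof (rule tangential_eqI[OF tangential_circle_pullback[OF lin] tan])
      fix \<theta>
      show "circle_fun (circle_pullback \<omega>) \<theta> = ?f \<theta>"
        unfolding circle_fun_pullback \<omega>_def p(3) q(3) cxt complex_cnj_mult complex_cnj_cnj complex_cnj_i
        using c1[of \<theta>] i_squared by algebra
    qed
    fix x assume "x \<in> unit_circle"
    then obtain \<theta> where x: "x = polar 1 \<theta>" by (rule circle_point)
    show "\<omega> x (inward_normal x) = 0"
      unfolding x \<omega>_def p(3) q(3) cxt complex_cnj_mult complex_cnj_cnj complex_cnj_i
      by (simp add: mult_ac)
  qed
  then show ?thesis unfolding harmonic_extension_def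
    by (rule someI[where P = "is_harmonic_extension (potential t) \<psi>"])
qed

text \<open>The angular form times the exponential of index l: on the unit circle
  \<open>cx x\<close> is \<open>cis \<theta>\<close> and the rotation field is the unit
  tangent.\<close>

definition fourier_form :: "int \<Rightarrow> real^2 \<Rightarrow> real^2 \<Rightarrow> complex" where
  "fourier_form l = circle_pullback (\<lambda>x v. (cx x powi l) * of_real (rotation_field x \<bullet> v))"

lemma fourier_form:
  shows "circle_fun (fourier_form l) \<theta> = cis (of_int l * \<theta>)" and "fourier_form l \<in> circle_one_forms"
proof -
  have r: "rotation_field (polar 1 \<theta>) = tangent \<theta>" for \<theta>
    by (simp add: rotation_field_def vec_eq_iff forall_2)
  have t: "tangent \<theta> \<bullet> tangent \<theta> = 1" for \<theta>
    by (simp add: inner_vec2 flip: power2_eq_square)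
  show c: "circle_fun (fourier_form l) \<theta> = cis (of_int l * \<theta>)" for \<theta>
    unfolding fourier_form_def circle_fun_pullback r t by (simp add: cx_polar cis_power_int)
  have "tangential (fourier_form l)"
    unfolding fourier_form_def
    by (rule tangential_circle_pullback, rule linearI)
      (simp_all add: inner_add_right algebra_simps scaleR_conv_of_real[where 'a = complex])
  moreover have "smooth_on UNIV (\<lambda>\<theta>::real. cis (of_int l * \<theta>))"
  proof -
    have "smooth_on UNIV (\<lambda>\<theta>::real. exp (\<i> * complex_of_real (of_int l * \<theta>)))"
      by (intro smooth_on_exp smooth_on_linear_map bounded_linear_const_mult
          bounded_linear_compose[OF bounded_linear_of_real] bounded_linear_mult_right) simp_all
    then show ?thesis by (simp add: cis_conv_exp)
  qed
  ultimately show "fourier_form l \<in> circle_one_forms"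
    by (simp add: circle_one_forms_iff c[abs_def])
qed

text \<open>The operator is a Fourier multiplier. A nonzero eigenform has some nonzero coefficient,
  and there z must equal the multiplier. Conversely, \<open>fourier_form l\<close> is an eigenform,
  because both sides have the same Fourier coefficients.\<close>

lemma steklov_spectrum1_potential:
  "steklov_spectrum1 (potential t) = complex_of_real ` range (steklov_eigenvalue t)"
proof (intro equalityI subsetI)
  fix z assume "z \<in> steklov_spectrum1 (potential t)"
  then obtain \<psi> where psi: "\<psi> \<in> circle_one_forms" "\<psi> \<noteq> (\<lambda>x v. 0)"
    "magnetic_steklov1 (potential t) \<psi> = (\<lambda>x v. z * \<psi> x v)"
    unfolding steklov_spectrum1_def by blast
  note h = harmonic_extension_exists[OF psi(1), of t]
  have tan: "tangential \<psi>" and sf: "smooth_on UNIV (circle_fun \<psi>)"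
    using psi(1) by (simp_all add: circle_one_forms_iff)
  have "\<exists>l. fourier_coeff (circle_fun \<psi>) l \<noteq> 0"
  proof (rule ccontr)
    assume "\<nexists>l. fourier_coeff (circle_fun \<psi>) l \<noteq> 0"
    then have "circle_fun \<psi> \<theta> = 0" for \<theta>
      using fourier_coeff_unique[OF smooth_on_imp_continuous_on[OF sf] circle_fun_periodic] by blast
    then have "\<psi> = (\<lambda>x v. 0)"
      by (intro tangential_eqI[OF tan]) (simp_all add: tangential_def circle_fun_def)
    then show False using psi(2) by contradiction
  qed
  then obtain l where l: "fourier_coeff (circle_fun \<psi>) l \<noteq> 0" by blast
  have eq: "boundary_curl t (harmonic_extension (potential t) \<psi>) = (\<lambda>\<theta>. z * circle_fun \<psi> \<theta>)"
    using circle_fun_steklov(1)[OF h] unfolding psi(3) circle_fun_scale by (intro ext) simp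
  have "of_real (steklov_eigenvalue t l) * fourier_coeff (circle_fun \<psi>) l = z * fourier_coeff (circle_fun \<psi>) l"
    using fourier_boundary_curl[OF h, of l] unfolding eq fourier_coeff_cmult by (rule sym)
  then have "z = of_real (steklov_eigenvalue t l)" using l by (metis mult_right_cancel)
  then show "z \<in> complex_of_real ` range (steklov_eigenvalue t)" by blast
next
  fix z assume "z \<in> complex_of_real ` range (steklov_eigenvalue t)"
  then obtain l where z: "z = of_real (steklov_eigenvalue t l)" by blast
  let ?\<psi> = "fourier_form l" and ?\<omega> = "harmonic_extension (potential t) (fourier_form l)"
  note h = harmonic_extension_exists[OF fourier_form(2), of t l]
  have om: "?\<omega> \<in> one_forms unit_disk" using h unfolding is_harmonic_extension_def by blast
  have f: "circle_fun ?\<psi> = (\<lambda>\<theta>. cis (of_int l * \<theta>))" using fourier_form(1) by blast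
  have tan: "tangential ?\<psi>" using fourier_form(2) by (simp add: circle_one_forms_iff)
  have cB: "continuous_on T (boundary_curl t ?\<omega>)" for T
    unfolding boundary_curl_def[abs_def]
    by (intro continuous_intros continuous_on_smooth_polar(2) smooth_on_mag_dz smooth_on_mag_dzbar
        smooth_on_comp_plus smooth_on_comp_minus om) simp_all
  have cF: "continuous_on T (\<lambda>\<theta>. z * circle_fun ?\<psi> \<theta>)" for T
    unfolding f by (intro continuous_intros)
  have zero: "fourier_coeff (\<lambda>\<theta>. boundary_curl t ?\<omega> \<theta> - z * circle_fun ?\<psi> \<theta>) k = 0" for k
    unfolding fourier_coeff_diff[OF cB cF] fourier_coeff_cmult fourier_boundary_curl[OF h]
    by (simp add: f fourier_coeff_cis z)
  have "boundary_curl t ?\<omega> \<theta> - z * circle_fun ?\<psi> \<theta> = 0" for \<theta>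
  proof (rule fourier_coeff_unique[OF _ _ zero])
    show "continuous_on UNIV (\<lambda>\<theta>. boundary_curl t ?\<omega> \<theta> - z * circle_fun ?\<psi> \<theta>)"
      by (intro continuous_on_diff cB cF)
    show "boundary_curl t ?\<omega> (\<theta> + 2 * pi) - z * circle_fun ?\<psi> (\<theta> + 2 * pi)
        = boundary_curl t ?\<omega> \<theta> - z * circle_fun ?\<psi> \<theta>" for \<theta>
      by (simp add: circle_fun_periodic boundary_curl_def polar_def)
  qed
  then have "magnetic_steklov1 (potential t) ?\<psi> = (\<lambda>x v. z * ?\<psi> x v)"
    by (intro tangential_eqI circle_fun_steklov(2)[OF h] tangential_scale tan)
      (simp add: circle_fun_steklov(1)[OF h] circle_fun_scale)
  moreover have "?\<psi> \<noteq> (\<lambda>x v. 0)"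
  proof
    assume "?\<psi> = (\<lambda>x v. 0)"
    then have "cis (of_int l * 0) = 0" using fourier_form(1)[of l 0] by (simp add: circle_fun_def)
    then show False by simp
  qed
  ultimately show "z \<in> steklov_spectrum1 (potential t)"
    unfolding steklov_spectrum1_def using fourier_form(2) by blast
qed

section \<open>The eigenvalues\<close>

lemma phi_zero_closed_form: "t * phi t 0 1 = exp t - 1"
proof -
  have "((\<lambda>u. t * (u ^ 0 * exp (t * 1 * u))) has_integral exp (t * 1) - exp (t * 0)) {0..1}"
  proof (intro fundamental_theorem_of_calculus)
    show "((\<lambda>u. exp (t * u)) has_vector_derivative t * (u ^ 0 * exp (t * 1 * u))) (at u within {0..1})" for u
      unfolding has_real_derivative_iff_has_vector_derivative[symmetric]
      by (auto intro!: derivative_eq_intros)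
  qed simp
  from integral_unique[OF this] show ?thesis unfolding phi_def by simp
qed

text \<open>After the substitution of \<open>1 - u\<close> for u, this is the integral form of the
  Taylor remainder of \<open>exp\<close> at \<open>- t\<close>; the proof is by induction with
  \<open>phi_recursion\<close>. It is stated without division, since the denominators are not yet
  known to be nonzero.\<close>

lemma phi_closed_form:
  "phi t m 1 * (- t) ^ (m + 1) = exp t * (fact m * (exp (- t) - (\<Sum>j=0..m. (- t) ^ j / fact j)))"
proof (induction m)
  case 0
  have "exp t * exp (- t) = 1" by (simp flip: exp_add)
  then show ?case using phi_zero_closed_form[of t] by (simp add: algebra_simps)
next
  case (Suc m)
  have rec: "t * phi t (Suc m) 1 = exp t - (real m + 1) * phi t m 1"
    using phi_recursion[of m t 1] by simp
  have "phi t (Suc m) 1 * (- t) ^ (Suc m + 1) = - (t * phi t (Suc m) 1) * (- t) ^ (m + 1)" by simp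
  also have "\<dots> = (real m + 1) * (phi t m 1 * (- t) ^ (m + 1)) - exp t * (- t) ^ (m + 1)"
    unfolding rec by (simp add: algebra_simps)
  also have "\<dots> = exp t * ((real m + 1) * fact m * (exp (- t) - (\<Sum>j=0..m. (- t) ^ j / fact j)) - (- t) ^ (m + 1))"
    unfolding Suc.IH by (simp add: algebra_simps)
  also have "(real m + 1) * fact m * (exp (- t) - (\<Sum>j=0..m. (- t) ^ j / fact j)) - (- t) ^ (m + 1)
      = fact (Suc m) * (exp (- t) - (\<Sum>j=0..Suc m. (- t) ^ j / fact j))"
  proof -
    have "(- t) ^ (m + 1) = fact (Suc m) * ((- t) ^ Suc m / fact (Suc m))" by simp
    moreover have "(real m + 1) * fact m = fact (Suc m)" by (simp add: algebra_simps)
    moreover have "(\<Sum>j=0..Suc m. (- t) ^ j / fact j) = (\<Sum>j=0..m. (- t) ^ j / fact j) + (- t) ^ Suc m / fact (Suc m)"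
      by simp
    ultimately show ?thesis by (simp only: algebra_simps)
  qed
  finally show ?case .
qed

text \<open>Positivity of \<open>phi\<close> together with \<open>t \<noteq> 0\<close> shows that
  the Taylor remainder in the denominator does not vanish.\<close>

lemma exp_div_phi:
  assumes "t \<noteq> 0"
  shows "exp t / phi t m 1 = (- t) ^ (m + 1) / (fact m * (exp (- t) - (\<Sum>j=0..m. (- t) ^ j / fact j)))"
proof -
  let ?R = "fact m * (exp (- t) - (\<Sum>j=0..m. (- t) ^ j / fact j))"
  have p: "phi t m 1 > 0" by (rule phi_pos)
  have c: "phi t m 1 * (- t) ^ (m + 1) = exp t * ?R" by (rule phi_closed_form)
  have "phi t m 1 * (- t) ^ (m + 1) \<noteq> 0" using p assms by simp
  then have "?R \<noteq> 0" unfolding c by (metis mult_zero_right)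
  moreover have "exp t * ?R = (- t) ^ (m + 1) * phi t m 1" using c by (simp only: mult.commute)
  ultimately show ?thesis using p frac_eq_eq by (metis less_irrefl)
qed

lemma steklov_eigenvalue_pos:
  assumes "k \<ge> 1"
  shows "steklov_eigenvalue t (int k) = exp t / phi t k 1"
    and "steklov_eigenvalue t (- int k) = exp (- t) / phi (- t) k 1"
  using assms by (simp_all add: steklov_eigenvalue_def)

text \<open>The symmetry of the integral under \<open>u\<close> to \<open>1 - u\<close>, here
  obtained from the closed form by cancelling t.\<close>

lemma phi_reflect: "phi t 0 1 = exp t * phi (- t) 0 1"
proof (cases "t = 0")
  case False
  have "t * (exp t * phi (- t) 0 1) = - exp t * (- t * phi (- t) 0 1)" by simp
  also have "\<dots> = - exp t * (exp (- t) - 1)" unfolding phi_zero_closed_form ..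
  also have "\<dots> = t * phi t 0 1" unfolding phi_zero_closed_form by (simp add: algebra_simps flip: exp_add)
  finally show ?thesis using False by simp
qed simp

lemma steklov_eigenvalue_0: "steklov_eigenvalue t 0 = (exp t + 1) / phi t 0 1"
proof -
  have "exp (- t) / phi (- t) 0 1 = 1 / phi t 0 1"
    unfolding phi_reflect[of t] by (simp add: exp_minus divide_simps)
  then show ?thesis by (simp add: steklov_eigenvalue_def add_divide_distrib)
qed

lemma steklov_eigenvalue_0_coth:
  assumes "t \<noteq> 0"
  shows "steklov_eigenvalue t 0 = t * (cosh (t / 2) / sinh (t / 2))"
proof -
  have "phi t 0 1 = (exp t - 1) / t" using phi_zero_closed_form[of t] assms by (simp add: field_simps)
  moreover have "cosh (t / 2) / sinh (t / 2) = (exp t + 1) / (exp t - 1)"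
  proof -
    have e: "exp t = exp (t / 2) * exp (t / 2)" "exp (- t / 2) * exp (t / 2) = 1"
      by (simp_all flip: exp_add)
    have "cosh (t / 2) / sinh (t / 2) = (exp (t / 2) * (2 * cosh (t / 2))) / (exp (t / 2) * (2 * sinh (t / 2)))"
      by simp
    also have "exp (t / 2) * (2 * cosh (t / 2)) = exp t + 1"
      using e by (simp add: cosh_def algebra_simps)
    also have "exp (t / 2) * (2 * sinh (t / 2)) = exp t - 1"
      using e by (simp add: sinh_def algebra_simps)
    finally show ?thesis .
  qed
  ultimately show ?thesis unfolding steklov_eigenvalue_0 by simp
qed

text \<open>The claim is \<open>2 * phi t 0 1 \<le> exp t + 1\<close>. The recursions for m = 0 and
  m = 1 with \<open>phi t 2 1 \<le> phi t 1 1\<close> give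
  \<open>phi t 0 1 \<le> 2 * phi t 1 1\<close>; multiplied by t, this becomes the claim.\<close>

lemma steklov_eigenvalue_0_ge:
  assumes "t \<ge> 0"
  shows "2 \<le> steklov_eigenvalue t 0"
proof -
  have "phi t 2 1 \<le> 1 * phi t 1 1"
    by (rule phi_mono) (auto simp: power2_eq_square intro!: mult_right_mono mult_left_le_one_le)
  moreover have "2 * phi t 1 1 + t * phi t 2 1 = exp t" and a: "phi t 0 1 + t * phi t 1 1 = exp t"
    using phi_recursion[of 1 t 1] phi_recursion[of 0 t 1] by (simp_all add: numeral_2_eq_2)
  ultimately have "phi t 0 1 \<le> 2 * phi t 1 1"
    using mult_left_mono[of "phi t 2 1" "phi t 1 1" t] assms by linarith
  from mult_left_mono[OF this assms] have "2 * phi t 0 1 \<le> exp t + 1"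
    using a phi_zero_closed_form[of t] by linarith
  then show ?thesis using phi_pos[of t 0] by (simp add: steklov_eigenvalue_0 field_simps)
qed

text \<open>For \<open>l \<noteq> 0\<close> the integrands can be compared directly. For
  \<open>l = 0\<close> the number 2, the common value of the eigenvalues of index 0 and -1 at
  \<open>t = 0\<close>, separates the two sides.\<close>

lemma steklov_eigenvalue_minus_1_le:
  assumes "t \<ge> 0"
  shows "steklov_eigenvalue t (- 1) \<le> steklov_eigenvalue t l"
proof -
  have m1: "steklov_eigenvalue t (- 1) = exp (- t) / phi (- t) 1 1"
    using steklov_eigenvalue_pos(2)[of 1 t] by simp
  consider "l = 0" | k where "k \<ge> 1" "l = int k" | k where "k \<ge> 1" "l = - int k"
    by (metis One_nat_def Suc_leI int_cases2 of_nat_0 neq0_conv minus_zero)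
  then show ?thesis
  proof cases
    case 1
    have "phi 0 1 1 \<le> exp t * phi (- t) 1 1"
    proof (rule phi_mono)
      fix u :: real assume u: "u \<in> {0..1}"
      then have "1 \<le> exp (t + - t * 1 * u)" using assms by (simp add: mult_left_le)
      then show "u ^ 1 * exp (0 * 1 * u) \<le> exp t * (u ^ 1 * exp (- t * 1 * u))"
        using u mult_left_mono[of 1 "exp (t + - t * 1 * u)" u] unfolding exp_add by (simp add: mult_ac)
    qed
    then have "1 \<le> 2 * (exp t * phi (- t) 1 1)" by (simp add: phi_0)
    then have "steklov_eigenvalue t (- 1) \<le> 2"
      using phi_pos[of "- t" 1] by (simp add: m1 exp_minus divide_simps mult_ac)
    then show ?thesis using steklov_eigenvalue_0_ge[OF assms] 1 by simp
  next
    case (2 k)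
    have "phi t k 1 \<le> exp (2 * t) * phi (- t) 1 1"
    proof (rule phi_mono)
      fix u :: real assume u: "u \<in> {0..1}"
      then have "t * u \<le> t" using assms by (simp add: mult_left_le)
      then have "exp (t * u) \<le> exp (2 * t + - t * 1 * u)" by simp
      moreover have "u ^ k \<le> u ^ 1" using u 2 by (intro power_decreasing) auto
      ultimately have "u ^ k * exp (t * u) \<le> u ^ 1 * exp (2 * t + - t * 1 * u)"
        using u by (intro mult_mono) auto
      then show "u ^ k * exp (t * 1 * u) \<le> exp (2 * t) * (u ^ 1 * exp (- t * 1 * u))"
        unfolding exp_add by (simp add: mult_ac)
    qed
    then have "exp (- t) * phi t k 1 \<le> exp (- t) * (exp (2 * t) * phi (- t) 1 1)" by simp
    also have "\<dots> = exp t * phi (- t) 1 1" by (simp flip: exp_add mult.assoc)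
    finally show ?thesis
      using 2 phi_pos[of t k] phi_pos[of "- t" 1]
      by (simp only: m1 steklov_eigenvalue_pos frac_le_eq) (simp add: divide_simps mult_ac)
  next
    case (3 k)
    have "phi (- t) k 1 \<le> 1 * phi (- t) 1 1"
    proof (rule phi_mono)
      fix u :: real assume u: "u \<in> {0..1}"
      then have "u ^ k \<le> u ^ 1" using 3 by (intro power_decreasing) auto
      then show "u ^ k * exp (- t * 1 * u) \<le> 1 * (u ^ 1 * exp (- t * 1 * u))" by simp
    qed
    then show ?thesis
      using 3 phi_pos[of "- t" k] by (simp add: m1 steklov_eigenvalue_pos frac_le)
  qed
qed

text \<open>Including \<open>t = 0\<close> makes this cover the operator without magnetic field as
  well.\<close>

lemma is_lowest_eigenvalue1_potential:
  assumes "t \<ge> 0"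
  shows "is_lowest_eigenvalue1 (potential t) (steklov_eigenvalue t (- 1))"
  unfolding is_lowest_eigenvalue1_def steklov_spectrum1_potential
  using steklov_eigenvalue_minus_1_le[OF assms] by auto

text \<open>Squaring the quadratic Taylor bound at \<open>t / 2\<close> leaves positive cubic and
  quartic terms, which give the strict inequality.\<close>

lemma quadratic_less_exp:
  assumes "t > (0::real)"
  shows "1 + t + t\<^sup>2 / 2 < exp t"
proof -
  have "1 + t + t\<^sup>2 / 2 < (1 + t / 2 + (t / 2)\<^sup>2 / 2)\<^sup>2"
    using assms by (simp add: power2_eq_square algebra_simps add_pos_pos)
  also have "\<dots> \<le> (exp (t / 2))\<^sup>2"
    using assms by (intro power_mono exp_lower_Taylor_quadratic) auto
  also have "\<dots> = exp t" by (simp add: power2_eq_square flip: exp_add)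
  finally show ?thesis .
qed

theorem theorem4p3:
  fixes t :: real
  assumes "t > 0"
  shows "steklov_spectrum1 (\<lambda>x. t *\<^sub>R rotation_field x) =
           complex_of_real `
             ({t * (cosh (t / 2) / sinh (t / 2))}
              \<union> {(- t) ^ (k + 1) / (fact k * (exp (- t) - (\<Sum>j=0..k. (- t) ^ j / fact j))) |k::nat. k \<ge> 1}
              \<union> {t ^ (k + 1) / (fact k * (exp t - (\<Sum>j=0..k. t ^ j / fact j))) |k::nat. k \<ge> 1})
         \<and> is_lowest_eigenvalue1 (\<lambda>x. t *\<^sub>R rotation_field x) (t\<^sup>2 / (exp t - 1 - t))
         \<and> is_lowest_eigenvalue1 (\<lambda>x. 0) 2
         \<and> t\<^sup>2 / (exp t - 1 - t) < 2"
proof (intro conjI)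
  have t: "t \<noteq> 0" "- t \<noteq> 0" using assms by simp_all
  have pos: "steklov_eigenvalue t (int k)
      = (- t) ^ (k + 1) / (fact k * (exp (- t) - (\<Sum>j=0..k. (- t) ^ j / fact j)))" if "k \<ge> 1" for k
    unfolding steklov_eigenvalue_pos(1)[OF that] by (rule exp_div_phi[OF t(1)])
  have neg: "steklov_eigenvalue t (- int k)
      = t ^ (k + 1) / (fact k * (exp t - (\<Sum>j=0..k. t ^ j / fact j)))" if "k \<ge> 1" for k
    unfolding steklov_eigenvalue_pos(2)[OF that] using exp_div_phi[OF t(2), of k] by simp
  have "range (steklov_eigenvalue t) = {steklov_eigenvalue t 0}
      \<union> {steklov_eigenvalue t (int k) |k. k \<ge> 1} \<union> {steklov_eigenvalue t (- int k) |k. k \<ge> 1}"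
  proof (intro equalityI subsetI)
    fix z assume "z \<in> range (steklov_eigenvalue t)"
    then obtain l where z: "z = steklov_eigenvalue t l" by blast
    consider "l = 0" | k where "k \<ge> 1" "l = int k" | k where "k \<ge> 1" "l = - int k"
      by (metis One_nat_def Suc_leI int_cases2 of_nat_0 neq0_conv minus_zero)
    then show "z \<in> {steklov_eigenvalue t 0}
      \<union> {steklov_eigenvalue t (int k) |k. k \<ge> 1} \<union> {steklov_eigenvalue t (- int k) |k. k \<ge> 1}"
      unfolding z by cases blast+
  qed blast
  also have "{steklov_eigenvalue t (int k) |k. k \<ge> 1}
      = {(- t) ^ (k + 1) / (fact k * (exp (- t) - (\<Sum>j=0..k. (- t) ^ j / fact j))) |k::nat. k \<ge> 1}"
    using pos by (intro Collect_cong) metis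
  also have "{steklov_eigenvalue t (- int k) |k. k \<ge> 1}
      = {t ^ (k + 1) / (fact k * (exp t - (\<Sum>j=0..k. t ^ j / fact j))) |k::nat. k \<ge> 1}"
    using neg by (intro Collect_cong) metis
  finally show "steklov_spectrum1 (potential t) =
           complex_of_real `
             ({t * (cosh (t / 2) / sinh (t / 2))}
              \<union> {(- t) ^ (k + 1) / (fact k * (exp (- t) - (\<Sum>j=0..k. (- t) ^ j / fact j))) |k::nat. k \<ge> 1}
              \<union> {t ^ (k + 1) / (fact k * (exp t - (\<Sum>j=0..k. t ^ j / fact j))) |k::nat. k \<ge> 1})"
    unfolding steklov_spectrum1_potential steklov_eigenvalue_0_coth[OF t(1)] by (rule arg_cong)
  \<comment> \<open>The lowest eigenvalue is the member \<open>k = 1\<close> of the third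
    family.\<close>
  have "steklov_eigenvalue t (- 1) = t\<^sup>2 / (exp t - 1 - t)"
    using neg[of 1] by (simp add: power2_eq_square diff_diff_eq)
  then show "is_lowest_eigenvalue1 (potential t) (t\<^sup>2 / (exp t - 1 - t))"
    using is_lowest_eigenvalue1_potential[of t] assms by simp
  \<comment> \<open>At \<open>t = 0\<close> the potential is the zero field and
    \<open>phi 0 1 1\<close> is one half.\<close>
  have "steklov_eigenvalue 0 (- 1) = 2"
    using steklov_eigenvalue_pos(2)[of 1 0] by (simp add: phi_0)
  then show "is_lowest_eigenvalue1 (\<lambda>x. 0) 2"
    using is_lowest_eigenvalue1_potential[of 0] by simp
  show "t\<^sup>2 / (exp t - 1 - t) < 2"
    using quadratic_less_exp[OF assms] zero_less_power[OF assms, of 2]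
    by (subst pos_divide_less_eq) (linarith, simp)
qed

end
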